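(* Let $(M^{2m},J,g)$ be a standard Kähler locally symmetric manifold, let $(T^{*}_{1}M,{}^{BS}\hat g)$ be its unit cotangent bundle equipped with the Berger-type deformed Sasaki metric, and let $C$ be a geodesic on $(T^{*}_{1}M,{}^{BS}\hat g)$, parametrized by arc length. Then all Frenet curvatures of the projected curve $\gamma=\pi\circ C$ on $(M,g)$ are constant.
   Context: All objects are smooth. A standard Kähler manifold $(M^{2m},J,g)$ is a $2m$-dimensional manifold with an almost complex structure $J$ ($J^2=-I$) and a Riemannian metric $g$ with $g(JX,JY)=g(X,Y)$ such that $\nabla J=0$, where $\nabla$ is the Levi-Civita connection of $g$. Locally symmetric means that the curvature tensor $R$ satisfies $\nabla R=0$. $\pi$ is the projection to $M$. For a covector $\omega$, $\widetilde\omega$ is the vector with $g(\widetilde\omega,X)=\omega(X)$ for all $X$; $g^{-1}(\omega,\theta)=g(\widetilde\omega,\widetilde\theta)$; $\omega J$ is the covector $(\omega J)(X)=\omega(JX)$. In the coordinates $(x^i,p_i)$ on $T^{*}M$ induced by coordinates $(x^i)$ on $M$, with Christoffel symbols $\Gamma^k_{ij}$ of $g$, the horizontal lift of $X=X^i\partial_{x^i}$ is ${}^{H}X=X^{i}\partial_{x^i}+p_{h}\Gamma^{h}_{ij}X^{j}\partial_{p_i}$ and the vertical lift of $\omega=\omega_idx^i$ is ${}^{V}\omega=\omega_i\partial_{p_i}$. The Berger-type deformed Sasaki metric ${}^{BS}g$ on $T^{*}M$, with real constant $\delta$, is the Riemannian metric defined at $(x,p)$ by ${}^{BS}g({}^{H}X,{}^{H}Y)=g(X,Y)$,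 ${}^{BS}g({}^{H}X,{}^{V}\theta)=0$, ${}^{BS}g({}^{V}\omega,{}^{V}\theta)=g^{-1}(\omega,\theta)+\delta^{2}g^{-1}(\omega,pJ)\,g^{-1}(\theta,pJ)$. The unit cotangent bundle is the hypersurface $T^{*}_1M=\{(x,p)\in T^{*}M: g^{-1}(p,p)=1\}$ and ${}^{BS}\hat g$ is the metric induced on it by ${}^{BS}g$. Frenet curvatures: with $s$ an arc length parameter of $\gamma$ in $(M,g)$ and $\nu_1=\gamma'_s$, the Frenet frame $\nu_1,\nu_2,\dots$ (orthonormal along $\gamma$) and the Frenet curvatures $k_1,k_2,\dots$ are determined by the Frenet formulas $(\nu_1)'_s=k_1\nu_2$, $(\nu_i)'_s=-k_{i-1}\nu_{i-1}+k_i\nu_{i+1}$ for $i\ge 2$ (primes are covariant derivatives along $\gamma$), as far as they are defined. *)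

theory Defs
  imports "HOL-Analysis.Analysis"
begin

section \<open>Smooth manifolds given by an atlas\<close>

text \<open>\<open>C_diff k S f\<close> is meant for open \<open>S\<close>; on finite-dimensional domains, continuity of all iterated
  directional derivatives of differentiable functions is the usual class \<open>C\<^sup>k\<close>.\<close>

primrec C_diff :: "nat \<Rightarrow> 'a::real_normed_vector set \<Rightarrow> ('a \<Rightarrow> 'b::real_normed_vector) \<Rightarrow> bool" where
  "C_diff 0 S f \<longleftrightarrow> continuous_on S f"
| "C_diff (Suc k) S f \<longleftrightarrow> (\<forall>x\<in>S. f differentiable at x) \<and>
     (\<forall>v. C_diff k S (\<lambda>x. frechet_derivative f (at x) v))"

definition smooth_on :: "'a::real_normed_vector set \<Rightarrow> ('a \<Rightarrow> 'b::real_normed_vector) \<Rightarrow> bool" where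
  "smooth_on S f \<longleftrightarrow> (\<forall>k. C_diff k S f)"

text \<open>A chart is a domain together with a coordinate map. Only the values of the map on the
  domain matter.\<close>

type_synonym ('p, 'k) chart = "'p set \<times> ('p \<Rightarrow> real ^ 'k)"

abbreviation cdom :: "('p, 'k) chart \<Rightarrow> 'p set" where
  "cdom b \<equiv> fst b"

abbreviation cmap :: "('p, 'k) chart \<Rightarrow> 'p \<Rightarrow> real ^ 'k" where
  "cmap b \<equiv> snd b"

abbreviation cinv :: "('p, 'k) chart \<Rightarrow> real ^ 'k \<Rightarrow> 'p" where
  "cinv b \<equiv> inv_into (cdom b) (cmap b)"

definition atlas_space :: "('p, 'k) chart set \<Rightarrow> 'p set" where
  "atlas_space A = (\<Union>b\<in>A. cdom b)"

definition atlas_topology :: "('p, 'k::finite) chart set \<Rightarrow> 'p topology" where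
  "atlas_topology A = topology_generated_by {{x \<in> cdom b. cmap b x \<in> W} | b W. b \<in> A \<and> open W}"

definition smooth_manifold :: "('p, 'k::finite) chart set \<Rightarrow> bool" where
  "smooth_manifold A \<longleftrightarrow>
     (\<forall>b\<in>A. inj_on (cmap b) (cdom b) \<and> open (cmap b ` cdom b)) \<and>
     (\<forall>b\<in>A. \<forall>b'\<in>A. open (cmap b ` (cdom b \<inter> cdom b')) \<and>
        smooth_on (cmap b ` (cdom b \<inter> cdom b')) (cmap b' \<circ> cinv b)) \<and>
     Hausdorff_space (atlas_topology A) \<and> second_countable (atlas_topology A)"

text \<open>\<open>jac b b' x\<close> is the matrix of the partial derivatives of the \<open>b'\<close>-coordinates with respect
  to the \<open>b\<close>-coordinates.\<close>

definition jac :: "('p, 'k::finite) chart \<Rightarrow> ('p, 'k) chart \<Rightarrow> 'p \<Rightarrow> real ^ 'k ^ 'k" where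
  "jac b b' x = matrix (frechet_derivative (cmap b' \<circ> cinv b) (at (cmap b x)))"

definition pd :: "('p, 'k::finite) chart \<Rightarrow> 'k \<Rightarrow> ('p \<Rightarrow> real) \<Rightarrow> 'p \<Rightarrow> real" where
  "pd b i f x = frechet_derivative (f \<circ> cinv b) (at (cmap b x)) (axis i 1)"


section \<open>Tensors and Riemannian metrics\<close>

text \<open>A tensor (field) is the family of its component arrays in the charts of the atlas, subject to the
  transformation law. A metric \<open>G\<close> has the components \<open>G b x $ i $ j\<close>; an endomorphism field \<open>J\<close>
  acts on component vectors as \<open>J b x *v X\<close>.\<close>

definition riemannian_metric ::
  "('p, 'k::finite) chart set \<Rightarrow> (('p, 'k) chart \<Rightarrow> 'p \<Rightarrow> real ^ 'k ^ 'k) \<Rightarrow> bool" where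
  "riemannian_metric A G \<longleftrightarrow>
     (\<forall>b\<in>A. smooth_on (cmap b ` cdom b) (G b \<circ> cinv b) \<and>
        (\<forall>x\<in>cdom b. transpose (G b x) = G b x \<and> (\<forall>v. v \<noteq> 0 \<longrightarrow> v \<bullet> (G b x *v v) > 0))) \<and>
     (\<forall>b\<in>A. \<forall>b'\<in>A. \<forall>x\<in>cdom b \<inter> cdom b'.
        G b x = transpose (jac b b' x) ** G b' x ** jac b b' x)"

definition endomorphism_field ::
  "('p, 'k::finite) chart set \<Rightarrow> (('p, 'k) chart \<Rightarrow> 'p \<Rightarrow> real ^ 'k ^ 'k) \<Rightarrow> bool" where
  "endomorphism_field A J \<longleftrightarrow>
     (\<forall>b\<in>A. smooth_on (cmap b ` cdom b) (J b \<circ> cinv b)) \<and>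
     (\<forall>b\<in>A. \<forall>b'\<in>A. \<forall>x\<in>cdom b \<inter> cdom b'.
        jac b b' x ** J b x = J b' x ** jac b b' x)"

definition inner_of ::
  "(('p, 'k::finite) chart \<Rightarrow> 'p \<Rightarrow> real ^ 'k ^ 'k) \<Rightarrow> ('p, 'k) chart \<Rightarrow> 'p \<Rightarrow> real ^ 'k \<Rightarrow> real ^ 'k \<Rightarrow> real"
  where "inner_of G b x X Y = X \<bullet> (G b x *v Y)"

definition sharp ::
  "(('p, 'k::finite) chart \<Rightarrow> 'p \<Rightarrow> real ^ 'k ^ 'k) \<Rightarrow> ('p, 'k) chart \<Rightarrow> 'p \<Rightarrow> real ^ 'k \<Rightarrow> real ^ 'k" where
  "sharp G b x \<omega> = matrix_inv (G b x) *v \<omega>"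

definition coinner_of ::
  "(('p, 'k::finite) chart \<Rightarrow> 'p \<Rightarrow> real ^ 'k ^ 'k) \<Rightarrow> ('p, 'k) chart \<Rightarrow> 'p \<Rightarrow> real ^ 'k \<Rightarrow> real ^ 'k \<Rightarrow> real"
  where "coinner_of G b x \<omega> \<theta> = inner_of G b x (sharp G b x \<omega>) (sharp G b x \<theta>)"

text \<open>\<open>christoffel G b x h i j\<close> has \<open>h\<close> as its upper index.\<close>

definition christoffel ::
  "(('p, 'k::finite) chart \<Rightarrow> 'p \<Rightarrow> real ^ 'k ^ 'k) \<Rightarrow> ('p, 'k) chart \<Rightarrow> 'p \<Rightarrow> 'k \<Rightarrow> 'k \<Rightarrow> 'k \<Rightarrow> real"
  where
  "christoffel G b x h i j = (1 / 2) * (\<Sum>l\<in>UNIV. matrix_inv (G b x) $ h $ l *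
     (pd b i (\<lambda>y. G b y $ j $ l) x + pd b j (\<lambda>y. G b y $ i $ l) x - pd b l (\<lambda>y. G b y $ i $ j) x))"

text \<open>\<open>nabla_endo\<close> is the component with upper index \<open>i\<close> and lower index \<open>j\<close> of the covariant derivative
  of \<open>J\<close> in direction \<open>k\<close>.
  \<open>curvature G b x l k i j\<close> is the component with index \<open>l\<close> of
  \<open>R(\<partial>\<^sub>i, \<partial>\<^sub>j) \<partial>\<^sub>k\<close>, where \<open>R(X, Y) = [\<nabla>\<^sub>X, \<nabla>\<^sub>Y] - \<nabla>\<^sub>[\<^sub>X\<^sub>,\<^sub>Y\<^sub>]\<close>.\<close>

definition nabla_endo ::
  "(('p, 'k::finite) chart \<Rightarrow> 'p \<Rightarrow> real ^ 'k ^ 'k) \<Rightarrow> (('p, 'k) chart \<Rightarrow> 'p \<Rightarrow> real ^ 'k ^ 'k) \<Rightarrow>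
   ('p, 'k) chart \<Rightarrow> 'p \<Rightarrow> 'k \<Rightarrow> 'k \<Rightarrow> 'k \<Rightarrow> real" where
  "nabla_endo G J b x k i j = pd b k (\<lambda>y. J b y $ i $ j) x
     + (\<Sum>l\<in>UNIV. christoffel G b x i k l * J b x $ l $ j)
     - (\<Sum>l\<in>UNIV. christoffel G b x l k j * J b x $ i $ l)"

definition curvature ::
  "(('p, 'k::finite) chart \<Rightarrow> 'p \<Rightarrow> real ^ 'k ^ 'k) \<Rightarrow> ('p, 'k) chart \<Rightarrow> 'p \<Rightarrow> 'k \<Rightarrow> 'k \<Rightarrow> 'k \<Rightarrow> 'k \<Rightarrow> real"
  where
  "curvature G b x l k i j =
     pd b i (\<lambda>y. christoffel G b y l j k) x - pd b j (\<lambda>y. christoffel G b y l i k) x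
     + (\<Sum>a\<in>UNIV. christoffel G b x l i a * christoffel G b x a j k)
     - (\<Sum>a\<in>UNIV. christoffel G b x l j a * christoffel G b x a i k)"

definition nabla_curvature ::
  "(('p, 'k::finite) chart \<Rightarrow> 'p \<Rightarrow> real ^ 'k ^ 'k) \<Rightarrow> ('p, 'k) chart \<Rightarrow> 'p \<Rightarrow> 'k \<Rightarrow> 'k \<Rightarrow> 'k \<Rightarrow> 'k \<Rightarrow> 'k \<Rightarrow> real"
  where
  "nabla_curvature G b x m l k i j =
     pd b m (\<lambda>y. curvature G b y l k i j) x
     + (\<Sum>a\<in>UNIV. christoffel G b x l m a * curvature G b x a k i j)
     - (\<Sum>a\<in>UNIV. christoffel G b x a m k * curvature G b x l a i j)
     - (\<Sum>a\<in>UNIV. christoffel G b x a m i * curvature G b x l k a j)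
     - (\<Sum>a\<in>UNIV. christoffel G b x a m j * curvature G b x l k i a)"

definition standard_kaehler ::
  "('p, 'k::finite) chart set \<Rightarrow> (('p, 'k) chart \<Rightarrow> 'p \<Rightarrow> real ^ 'k ^ 'k) \<Rightarrow>
   (('p, 'k) chart \<Rightarrow> 'p \<Rightarrow> real ^ 'k ^ 'k) \<Rightarrow> bool" where
  "standard_kaehler A J g \<longleftrightarrow>
     smooth_manifold A \<and> riemannian_metric A g \<and> endomorphism_field A J \<and>
     (\<forall>b\<in>A. \<forall>x\<in>cdom b.
        J b x ** J b x = - mat 1 \<and>
        (\<forall>X Y. inner_of g b x (J b x *v X) (J b x *v Y) = inner_of g b x X Y) \<and>
        (\<forall>k i j. nabla_endo g J b x k i j = 0))"

definition locally_symmetric ::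
  "('p, 'k::finite) chart set \<Rightarrow> (('p, 'k) chart \<Rightarrow> 'p \<Rightarrow> real ^ 'k ^ 'k) \<Rightarrow> bool" where
  "locally_symmetric A g \<longleftrightarrow>
     (\<forall>b\<in>A. \<forall>x\<in>cdom b. \<forall>m l k i j. nabla_curvature g b x m l k i j = 0)"


section \<open>Curves, covariant derivatives, geodesics\<close>

definition smooth_curve :: "('p, 'k::finite) chart set \<Rightarrow> real set \<Rightarrow> (real \<Rightarrow> 'p) \<Rightarrow> bool" where
  "smooth_curve A I c \<longleftrightarrow>
     (\<forall>t\<in>I. \<exists>b\<in>A. \<exists>U. open U \<and> t \<in> U \<and> U \<subseteq> I \<and> c ` U \<subseteq> cdom b \<and> smooth_on U (cmap b \<circ> c))"

text \<open>A vector field along a curve is also given by its components \<open>V b t\<close> in the charts \<open>b\<close>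
  around the curve point with parameter \<open>t\<close>.\<close>

definition vector_field_along ::
  "('p, 'k::finite) chart set \<Rightarrow> real set \<Rightarrow> (real \<Rightarrow> 'p) \<Rightarrow> (('p, 'k) chart \<Rightarrow> real \<Rightarrow> real ^ 'k) \<Rightarrow> bool"
  where
  "vector_field_along A I c V \<longleftrightarrow>
     (\<forall>t\<in>I. \<forall>b\<in>A. c t \<in> cdom b \<longrightarrow>
        (\<exists>U. open U \<and> t \<in> U \<and> U \<subseteq> I \<and> c ` U \<subseteq> cdom b \<and> smooth_on U (V b)) \<and>
        (\<forall>b'\<in>A. c t \<in> cdom b' \<longrightarrow> V b' t = jac b b' (c t) *v V b t))"

definition velocity :: "(real \<Rightarrow> 'p) \<Rightarrow> ('p, 'k::finite) chart \<Rightarrow> real \<Rightarrow> real ^ 'k" where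
  "velocity c b t = vector_derivative (cmap b \<circ> c) (at t)"

definition cov_deriv ::
  "(('p, 'k::finite) chart \<Rightarrow> 'p \<Rightarrow> real ^ 'k ^ 'k) \<Rightarrow> (real \<Rightarrow> 'p) \<Rightarrow> (('p, 'k) chart \<Rightarrow> real \<Rightarrow> real ^ 'k) \<Rightarrow>
   ('p, 'k) chart \<Rightarrow> real \<Rightarrow> real ^ 'k" where
  "cov_deriv G c V b t = vector_derivative (V b) (at t) +
     (\<chi> h. \<Sum>i\<in>UNIV. \<Sum>j\<in>UNIV. christoffel G b (c t) h i j * velocity c b t $ i * V b t $ j)"

definition unit_speed ::
  "('p, 'k::finite) chart set \<Rightarrow> (('p, 'k) chart \<Rightarrow> 'p \<Rightarrow> real ^ 'k ^ 'k) \<Rightarrow> real set \<Rightarrow> (real \<Rightarrow> 'p) \<Rightarrow> bool"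
  where
  "unit_speed A G I c \<longleftrightarrow>
     (\<forall>t\<in>I. \<forall>b\<in>A. c t \<in> cdom b \<longrightarrow> inner_of G b (c t) (velocity c b t) (velocity c b t) = 1)"

definition geodesic ::
  "('p, 'k::finite) chart set \<Rightarrow> (('p, 'k) chart \<Rightarrow> 'p \<Rightarrow> real ^ 'k ^ 'k) \<Rightarrow> real set \<Rightarrow> (real \<Rightarrow> 'p) \<Rightarrow> bool"
  where
  "geodesic A G I c \<longleftrightarrow> smooth_curve A I c \<and>
     (\<forall>t\<in>I. \<forall>b\<in>A. c t \<in> cdom b \<longrightarrow> cov_deriv G c (velocity c) b t = 0)"

text \<open>\<open>\<beta>\<close> on \<open>K\<close> is the curve \<open>\<gamma>\<close> on \<open>I\<close> expressed in an arc length parameter \<open>s\<close> of \<open>\<gamma>\<close>.\<close>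

definition arc_length_parametrization ::
  "('p, 'k::finite) chart set \<Rightarrow> (('p, 'k) chart \<Rightarrow> 'p \<Rightarrow> real ^ 'k ^ 'k) \<Rightarrow>
   real set \<Rightarrow> (real \<Rightarrow> 'p) \<Rightarrow> real set \<Rightarrow> (real \<Rightarrow> 'p) \<Rightarrow> bool" where
  "arc_length_parametrization A G I \<gamma> K \<beta> \<longleftrightarrow>
     smooth_curve A K \<beta> \<and> unit_speed A G K \<beta> \<and>
     (\<exists>s :: real \<Rightarrow> real. smooth_on I s \<and> (\<forall>t\<in>I. deriv s t > 0) \<and> s ` I = K \<and>
        (\<forall>t\<in>I. \<gamma> t = \<beta> (s t)))"

text \<open>\<open>\<nu> 1, \<dots>, \<nu> r\<close> is the part of the Frenet frame, and \<open>\<kappa> 1, \<dots>, \<kappa> r\<close> are the Frenet curvatures,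
  that the Frenet formulas determine for a curve whose first \<open>r - 1\<close> curvatures have no zero.
  The curvature \<open>\<kappa> r\<close> may have zeros; the unit vector \<open>\<nu> (r + 1)\<close> is only
  determined, hence only constrained, at the parameters where \<open>\<kappa> r\<close> is not zero.\<close>

definition frenet_apparatus ::
  "('p, 'k::finite) chart set \<Rightarrow> (('p, 'k) chart \<Rightarrow> 'p \<Rightarrow> real ^ 'k ^ 'k) \<Rightarrow> real set \<Rightarrow> (real \<Rightarrow> 'p) \<Rightarrow>
   nat \<Rightarrow> (nat \<Rightarrow> ('p, 'k) chart \<Rightarrow> real \<Rightarrow> real ^ 'k) \<Rightarrow> (nat \<Rightarrow> real \<Rightarrow> real) \<Rightarrow> bool" where
  "frenet_apparatus A G K \<beta> r \<nu> \<kappa> \<longleftrightarrow>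
     1 \<le> r \<and>
     (\<forall>i\<in>{1..r}. vector_field_along A K \<beta> (\<nu> i)) \<and>
     (\<forall>s\<in>K. (\<forall>i\<in>{1..<r}. \<kappa> i s > 0) \<and> \<kappa> r s \<ge> 0) \<and>
     (\<forall>s\<in>K. \<forall>b\<in>A. \<beta> s \<in> cdom b \<longrightarrow>
        \<nu> 1 b s = velocity \<beta> b s \<and>
        (\<forall>i j. 1 \<le> i \<and> 1 \<le> j \<and> i \<le> (if \<kappa> r s = 0 then r else r + 1) \<and>
            j \<le> (if \<kappa> r s = 0 then r else r + 1) \<longrightarrow>
            inner_of G b (\<beta> s) (\<nu> i b s) (\<nu> j b s) = (if i = j then 1 else 0)) \<and>
        cov_deriv G \<beta> (\<nu> 1) b s = \<kappa> 1 s *\<^sub>R \<nu> 2 b s \<and>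
        (\<forall>i\<in>{2..r}. cov_deriv G \<beta> (\<nu> i) b s =
            - \<kappa> (i - 1) s *\<^sub>R \<nu> (i - 1) b s + \<kappa> i s *\<^sub>R \<nu> (i + 1) b s))"


section \<open>The cotangent bundle and the Berger-type deformed Sasaki metric\<close>

text \<open>A covector at \<open>x\<close> is the family of its component vectors in the charts around \<open>x\<close>. It is set
  to 0 elsewhere, so that different families are different covectors.\<close>

definition covectors :: "('p, 'k::finite) chart set \<Rightarrow> 'p \<Rightarrow> (('p, 'k) chart \<Rightarrow> real ^ 'k) set" where
  "covectors A x = {p.
     (\<forall>b\<in>A. \<forall>b'\<in>A. x \<in> cdom b \<inter> cdom b' \<longrightarrow> p b = transpose (jac b b' x) *v p b') \<and>
     (\<forall>b. \<not> (b \<in> A \<and> x \<in> cdom b) \<longrightarrow> p b = 0)}"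

type_synonym ('p, 'k) cotangent_point = "'p \<times> (('p, 'k) chart \<Rightarrow> real ^ 'k)"

definition cotangent_bundle :: "('p, 'k::finite) chart set \<Rightarrow> ('p, 'k) cotangent_point set" where
  "cotangent_bundle A = (SIGMA x : atlas_space A. covectors A x)"

text \<open>In the coordinates induced on the cotangent bundle, \<open>Inl i\<close> is the index of the coordinate
  \<open>x\<^sup>i\<close> and \<open>Inr i\<close> is the index of the coordinate \<open>p\<^sub>i\<close>.\<close>

definition join :: "real ^ 'k \<Rightarrow> real ^ 'k \<Rightarrow> real ^ ('k::finite + 'k)" where
  "join X \<omega> = (\<chi> a. case a of Inl i \<Rightarrow> X $ i | Inr i \<Rightarrow> \<omega> $ i)"

definition cotangent_chart ::
  "('p, 'k::finite) chart set \<Rightarrow> ('p, 'k) chart \<Rightarrow> (('p, 'k) cotangent_point, 'k + 'k) chart" where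
  "cotangent_chart A b =
     ({q \<in> cotangent_bundle A. fst q \<in> cdom b}, \<lambda>q. join (cmap b (fst q)) (snd q b))"

definition cotangent_atlas ::
  "('p, 'k::finite) chart set \<Rightarrow> (('p, 'k) cotangent_point, 'k + 'k) chart set" where
  "cotangent_atlas A = cotangent_chart A ` A"

definition horizontal_lift ::
  "(('p, 'k::finite) chart \<Rightarrow> 'p \<Rightarrow> real ^ 'k ^ 'k) \<Rightarrow> ('p, 'k) chart \<Rightarrow> ('p, 'k) cotangent_point \<Rightarrow>
   real ^ 'k \<Rightarrow> real ^ ('k + 'k)" where
  "horizontal_lift g b q X =
     join X (\<chi> i. \<Sum>h\<in>UNIV. \<Sum>j\<in>UNIV. snd q b $ h * christoffel g b (fst q) h i j * X $ j)"

definition vertical_lift :: "real ^ 'k \<Rightarrow> real ^ ('k::finite + 'k)" where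
  "vertical_lift \<omega> = join 0 \<omega>"

text \<open>The unique \<open>X\<close> and \<open>\<omega>\<close> such that a given vector is the sum of the horizontal lift of \<open>X\<close> and
  the vertical lift of \<open>\<omega>\<close>; see \<open>lift_decomposition\<close>.\<close>

definition horizontal_part :: "real ^ ('k::finite + 'k) \<Rightarrow> real ^ 'k" where
  "horizontal_part \<xi> = (\<chi> i. \<xi> $ Inl i)"

definition vertical_part ::
  "(('p, 'k::finite) chart \<Rightarrow> 'p \<Rightarrow> real ^ 'k ^ 'k) \<Rightarrow> ('p, 'k) chart \<Rightarrow> ('p, 'k) cotangent_point \<Rightarrow>
   real ^ ('k + 'k) \<Rightarrow> real ^ 'k" where
  "vertical_part g b q \<xi> = (\<chi> i. (\<xi> - horizontal_lift g b q (horizontal_part \<xi>)) $ Inr i)"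

lemma join_nth [simp]: "join X \<omega> $ Inl i = X $ i" "join X \<omega> $ Inr i = \<omega> $ i"
  by (simp_all add: join_def)

lemma lift_decomposition:
  "\<xi> = horizontal_lift g b q X + vertical_lift \<omega> \<longleftrightarrow>
     X = horizontal_part \<xi> \<and> \<omega> = vertical_part g b q \<xi>"
proof -
  have *: "\<xi> = \<eta> \<longleftrightarrow> (\<forall>i. \<xi> $ Inl i = \<eta> $ Inl i) \<and> (\<forall>i. \<xi> $ Inr i = \<eta> $ Inr i)"
    for \<eta> :: "real ^ ('a + 'a)"
    by (metis sum.exhaust vec_eq_iff)
  show ?thesis
    unfolding *
    by (auto simp: horizontal_part_def vertical_part_def horizontal_lift_def vertical_lift_def vec_eq_iff)
qed

text \<open>\<open>dual_J J b x \<omega>\<close> is the covector \<open>\<omega>J\<close>, i.e.\ \<open>X \<mapsto> \<omega> (J X)\<close>.\<close>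

definition dual_J ::
  "(('p, 'k::finite) chart \<Rightarrow> 'p \<Rightarrow> real ^ 'k ^ 'k) \<Rightarrow> ('p, 'k) chart \<Rightarrow> 'p \<Rightarrow> real ^ 'k \<Rightarrow> real ^ 'k" where
  "dual_J J b x \<omega> = transpose (J b x) *v \<omega>"

definition bs_form ::
  "(('p, 'k::finite) chart \<Rightarrow> 'p \<Rightarrow> real ^ 'k ^ 'k) \<Rightarrow> (('p, 'k) chart \<Rightarrow> 'p \<Rightarrow> real ^ 'k ^ 'k) \<Rightarrow> real \<Rightarrow>
   ('p, 'k) chart \<Rightarrow> ('p, 'k) cotangent_point \<Rightarrow> real ^ ('k + 'k) \<Rightarrow> real ^ ('k + 'k) \<Rightarrow> real" where
  "bs_form J g \<delta> b q \<xi> \<eta> =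
     (let x = fst q; pJ = dual_J J b x (snd q b);
          \<omega> = vertical_part g b q \<xi>; \<theta> = vertical_part g b q \<eta>
      in inner_of g b x (horizontal_part \<xi>) (horizontal_part \<eta>) +
         coinner_of g b x \<omega> \<theta> + \<delta>\<^sup>2 * coinner_of g b x \<omega> pJ * coinner_of g b x \<theta> pJ)"

lemma horizontal_part_lift [simp]:
  "horizontal_part (horizontal_lift g b q X) = X" "horizontal_part (vertical_lift \<omega>) = 0"
  by (simp_all add: horizontal_part_def horizontal_lift_def vertical_lift_def vec_eq_iff)

lemma horizontal_lift_0 [simp]: "horizontal_lift g b q 0 = 0"
  unfolding vec_eq_iff
proof
  fix a show "horizontal_lift g b q 0 $ a = 0 $ a"
    by (cases a) (simp_all add: horizontal_lift_def)
qed

lemma vertical_part_lift [simp]: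
  "vertical_part g b q (horizontal_lift g b q X) = 0" "vertical_part g b q (vertical_lift \<omega>) = \<omega>"
  by (simp_all add: vertical_part_def vec_eq_iff) (simp add: vertical_lift_def)

lemma bs_form_lifts:
  fixes \<omega> \<theta> X Y :: "real ^ 'k::finite"
  shows "bs_form J g \<delta> b q (horizontal_lift g b q X) (horizontal_lift g b q Y) = inner_of g b (fst q) X Y"
    and "bs_form J g \<delta> b q (horizontal_lift g b q X) (vertical_lift \<theta>) = 0"
    and "bs_form J g \<delta> b q (vertical_lift \<omega>) (vertical_lift \<theta>) =
      coinner_of g b (fst q) \<omega> \<theta> +
      \<delta>\<^sup>2 * coinner_of g b (fst q) \<omega> (dual_J J b (fst q) (snd q b)) *
        coinner_of g b (fst q) \<theta> (dual_J J b (fst q) (snd q b))"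
  by (simp_all add: bs_form_def Let_def inner_of_def coinner_of_def sharp_def)

text \<open>The matrix of the metric at \<open>q\<close> in the chart \<open>cotangent_chart A b\<close>.\<close>

definition bs_metric ::
  "(('p, 'k::finite) chart \<Rightarrow> 'p \<Rightarrow> real ^ 'k ^ 'k) \<Rightarrow> (('p, 'k) chart \<Rightarrow> 'p \<Rightarrow> real ^ 'k ^ 'k) \<Rightarrow> real \<Rightarrow>
   ('p, 'k) chart \<Rightarrow> ('p, 'k) cotangent_point \<Rightarrow> real ^ ('k + 'k) ^ ('k + 'k)" where
  "bs_metric J g \<delta> b q = (\<chi> a c. bs_form J g \<delta> b q (axis a 1) (axis c 1))"


section \<open>The unit cotangent bundle\<close>

definition unit_cotangent_bundle ::
  "('p, 'k::finite) chart set \<Rightarrow> (('p, 'k) chart \<Rightarrow> 'p \<Rightarrow> real ^ 'k ^ 'k) \<Rightarrow> ('p, 'k) cotangent_point set"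
  where
  "unit_cotangent_bundle A g = {q \<in> cotangent_bundle A.
     \<forall>b\<in>A. fst q \<in> cdom b \<longrightarrow> coinner_of g b (fst q) (snd q b) (snd q b) = 1}"

text \<open>An index type for the coordinates of a hypersurface of the cotangent bundle; which element
  is left out of the sum is irrelevant.\<close>

typedef 'k hyper = "{a :: 'k + 'k. a \<noteq> Inl undefined}"
  by (rule exI[of _ "Inr undefined"]) simp

instance hyper :: (finite) finite
proof
  have "(UNIV :: 'a hyper set) = Abs_hyper ` {a. a \<noteq> Inl undefined}"
    using type_definition.Abs_image[OF type_definition_hyper] by metis
  then show "finite (UNIV :: 'a hyper set)"
    by (metis finite finite_imageI)
qed

lemma CARD_hyper: "CARD('k::finite hyper) = 2 * CARD('k) - 1"
proof -
  have "CARD('k hyper) = card (UNIV - {Inl undefined :: 'k + 'k})"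
    using type_definition.card[OF type_definition_hyper]
    by (simp add: Compl_eq_Diff_UNIV[symmetric] Compl_eq)
  then show ?thesis
    by (simp add: card_Diff_singleton card_UNIV_sum)
qed

text \<open>The charts of the unit cotangent bundle as an embedded hypersurface of the cotangent bundle,
  small enough for their domain to lie in the domain of the chart induced by some chart \<open>b\<close> of the base.\<close>

definition unit_cotangent_chart ::
  "('p, 'k::finite) chart set \<Rightarrow> (('p, 'k) chart \<Rightarrow> 'p \<Rightarrow> real ^ 'k ^ 'k) \<Rightarrow> ('p, 'k) chart \<Rightarrow>
   (('p, 'k) cotangent_point, 'k hyper) chart \<Rightarrow> bool" where
  "unit_cotangent_chart A g b u \<longleftrightarrow>
     b \<in> A \<and> cdom u \<subseteq> cdom (cotangent_chart A b) \<and>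
     openin (subtopology (atlas_topology (cotangent_atlas A)) (unit_cotangent_bundle A g)) (cdom u) \<and>
     open (cmap u ` cdom u) \<and>
     homeomorphic_map (subtopology (atlas_topology (cotangent_atlas A)) (cdom u))
       (top_of_set (cmap u ` cdom u)) (cmap u) \<and>
     smooth_on (cmap u ` cdom u) (cmap (cotangent_chart A b) \<circ> cinv u) \<and>
     (\<forall>y\<in>cmap u ` cdom u. inj (frechet_derivative (cmap (cotangent_chart A b) \<circ> cinv u) (at y)))"

definition unit_cotangent_atlas ::
  "('p, 'k::finite) chart set \<Rightarrow> (('p, 'k) chart \<Rightarrow> 'p \<Rightarrow> real ^ 'k ^ 'k) \<Rightarrow>
   (('p, 'k) cotangent_point, 'k hyper) chart set" where
  "unit_cotangent_atlas A g = {u. \<exists>b. unit_cotangent_chart A g b u}"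

text \<open>The pullback of the metric of the cotangent bundle under the inclusion. It does not depend on
  the base chart that is chosen to express the inclusion in coordinates.\<close>

definition induced_bs_metric ::
  "('p, 'k::finite) chart set \<Rightarrow> (('p, 'k) chart \<Rightarrow> 'p \<Rightarrow> real ^ 'k ^ 'k) \<Rightarrow>
   (('p, 'k) chart \<Rightarrow> 'p \<Rightarrow> real ^ 'k ^ 'k) \<Rightarrow> real \<Rightarrow>
   (('p, 'k) cotangent_point, 'k hyper) chart \<Rightarrow> ('p, 'k) cotangent_point \<Rightarrow> real ^ 'k hyper ^ 'k hyper"
  where
  "induced_bs_metric A J g \<delta> u q =
     (let b = SOME b. unit_cotangent_chart A g b u;
          D = matrix (frechet_derivative (cmap (cotangent_chart A b) \<circ> cinv u) (at (cmap u q)))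
      in transpose D ** bs_metric J g \<delta> b q ** D)"

end

theory Submission
  imports Defs
begin

text \<open>
  Let \<open>x\<close> be the projected curve and \<open>u\<close> the unit vector field along \<open>x\<close> dual to the covector. The geodesic is a
  critical point of the integral of \<open>|x'|\<^sup>2 + |u'|\<^sup>2 + \<delta>\<^sup>2 F\<^sup>2\<close> with \<open>F = g(u', Ju)\<close>. Vertical variations show that
  \<open>F\<close> is constant and that \<open>u'' + 2 \<delta>\<^sup>2 F Ju'\<close> is a multiple of \<open>u\<close>. Horizontal variations give \<open>x'' = S x'\<close> for
  the skew operator \<open>S\<close> with \<open>g(S X, Y) = - g(R(X, Y) u, u' + \<delta>\<^sup>2 F Ju)\<close>. Since \<open>R\<close> is parallel and commutes with
  \<open>J\<close>, the equation for \<open>u''\<close> makes \<open>S\<close> parallel along \<open>x\<close>. Hence \<open>V' = S V\<close> is inherited from \<open>V\<close> by \<open>V'\<close>, and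
  it implies that \<open>|V|\<close> is constant. Starting from \<open>x'\<close>, the Frenet formulas carry this property to every
  vector of the Frenet frame, and each curvature is the length of a field with this property.
\<close>

section \<open>Smooth functions and directional derivatives\<close>

text \<open>The geodesic equation is stated with the Christoffel symbols of the induced metric in a
  chart of the hypersurface. These are never computed: contracted with the metric, the equation says
  that the derivative of the momentum against a coordinate vector \<open>e\<close> is half the
  \<open>e\<close>-derivative of the squared speed. For the straight-line variation of the curve in
  direction \<open>e\<close>, both sides are derivatives on an open set of the plane, where base
  point and \<open>u\<close> are differentiated with the Levi-Civita connection of the base alone.
  There, exchanging two covariant derivatives produces the curvature. Nothing is integrated, and the
  variation stays on the hypersurface because it is taken in its coordinates.

  \<open>F\<close> is constant because \<open>Ju\<close> is orthogonal to \<open>u\<close>, hence an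
  admissible vertical variation; testing with it gives \<open>(1 + \<delta>\<^sup>2) F' = 0\<close>.
  The factor 2 in the equation for \<open>u''\<close> comes from the skewness of \<open>J\<close>.

  As \<open>x'' = S x'\<close>, the speed of \<open>x\<close> is constant. An arc length parameter
  is therefore locally affine in the parameter of the geodesic, and the Frenet formulas can be read
  in the latter with rescaled curvatures.\<close>

definition dird :: "'a::real_normed_vector \<Rightarrow> ('a \<Rightarrow> 'b::real_normed_vector) \<Rightarrow> 'a \<Rightarrow> 'b" where
  "dird v f x = frechet_derivative f (at x) v"

lemma has_derivative_dird:
  "f differentiable at x \<Longrightarrow> (f has_derivative (\<lambda>v. dird v f x)) (at x)"
  unfolding dird_def by (simp add: frechet_derivative_works eta_contract_eq)

lemma dird_eqI: "(f has_derivative f') (at x) \<Longrightarrow> dird v f x = f' v"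
  unfolding dird_def using frechet_derivative_at by metis

lemma bounded_linear_dird: "f differentiable at x \<Longrightarrow> bounded_linear (\<lambda>v. dird v f x)"
  by (rule has_derivative_bounded_linear[OF has_derivative_dird])

lemma linear_dird: "f differentiable at x \<Longrightarrow> linear (\<lambda>v. dird v f x)"
  by (rule bounded_linear.linear[OF bounded_linear_dird])

text \<open>Holds even where \<open>f\<close> is not differentiable:
  \<open>frechet_derivative\<close> chooses among the derivatives at \<open>x\<close>, and both
  functions have the same ones.\<close>

lemma dird_cong:
  assumes "open S" "x \<in> S" "\<And>y. y \<in> S \<Longrightarrow> f y = g y"
  shows "dird v f x = dird v g x"
proof -
  have "(f has_derivative f') (at x) \<longleftrightarrow> (g has_derivative f') (at x)" for f'
    using assms by (metis has_derivative_transform_within_open)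
  then show ?thesis
    unfolding dird_def frechet_derivative_def by simp
qed

lemma dird_const [simp]: "dird v (\<lambda>x. c) x = 0"
  by (simp add: dird_def)

lemma dird_ident [simp]: "dird v (\<lambda>x. x) x = v"
  by (simp add: dird_def)

lemma dird_bounded_linear:
  assumes "bounded_linear h" "f differentiable at x"
  shows "dird v (\<lambda>x. h (f x)) x = h (dird v f x)"
  by (rule dird_eqI)
    (rule bounded_linear.has_derivative[OF assms(1) has_derivative_dird[OF assms(2)]])

lemma dird_add:
  "f differentiable at x \<Longrightarrow> g differentiable at x \<Longrightarrow>
    dird v (\<lambda>x. f x + g x) x = dird v f x + dird v g x"
  by (intro dird_eqI has_derivative_add has_derivative_dird)

lemma dird_sum:
  "(\<And>i. i \<in> I \<Longrightarrow> f i differentiable at x) \<Longrightarrow>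
    dird v (\<lambda>x. \<Sum>i\<in>I. f i x) x = (\<Sum>i\<in>I. dird v (f i) x)"
  by (intro dird_eqI has_derivative_sum has_derivative_dird)

lemma dird_bilinear:
  assumes "bounded_bilinear B" "f differentiable at x" "g differentiable at x"
  shows "dird v (\<lambda>x. B (f x) (g x)) x = B (f x) (dird v g x) + B (dird v f x) (g x)"
  by (rule dird_eqI)
    (rule bounded_bilinear.FDERIV[OF assms(1) has_derivative_dird[OF assms(2)] has_derivative_dird[OF assms(3)]])

lemma dird_compose:
  assumes "g differentiable at x" "f differentiable at (g x)"
  shows "dird v (\<lambda>x. f (g x)) x = dird (dird v g x) f (g x)"
  by (rule dird_eqI)
    (rule has_derivative_compose[OF has_derivative_dird[OF assms(1)] has_derivative_dird[OF assms(2)]])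

lemma differentiable_bounded_linear:
  "bounded_linear h \<Longrightarrow> f differentiable at x \<Longrightarrow> (\<lambda>x. h (f x)) differentiable at x"
  using bounded_linear.has_derivative[of h f _ "at x"] unfolding differentiable_def by blast

lemma differentiable_bilinear:
  "bounded_bilinear B \<Longrightarrow> f differentiable at x \<Longrightarrow> g differentiable at x \<Longrightarrow>
    (\<lambda>x. B (f x) (g x)) differentiable at x"
  using bounded_bilinear.FDERIV[of B f _ x UNIV g] unfolding differentiable_def by blast

lemma dird_sum_direction:
  assumes "f differentiable at x"
  shows "dird (\<Sum>i\<in>I. c i *\<^sub>R w i) f x = (\<Sum>i\<in>I. c i *\<^sub>R dird (w i) f x)"
  using linear_dird[OF assms] by (simp add: linear_sum[of "\<lambda>v. dird v f x"] linear_scale[of "\<lambda>v. dird v f x"])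

section \<open>Closure properties of functions of finite differentiability order\<close>

lemma C_diff_Suc_dird:
  "C_diff (Suc k) S f \<longleftrightarrow> (\<forall>x\<in>S. f differentiable at x) \<and> (\<forall>v. C_diff k S (dird v f))"
  by (simp add: dird_def[abs_def])

declare C_diff.simps(2) [simp del]

lemma C_diff_cong:
  assumes "open S" "\<And>x. x \<in> S \<Longrightarrow> f x = g x" "C_diff k S f"
  shows "C_diff k S g"
  using assms(2,3)
proof (induction k arbitrary: f g)
  case 0
  then show ?case by (simp cong: continuous_on_cong)
next
  case (Suc k)
  have "g differentiable at x" if "x \<in> S" for x
    using Suc.prems that \<open>open S\<close> unfolding C_diff_Suc_dird differentiable_def
    by (metis has_derivative_transform_within_open)
  moreover have "C_diff k S (dird v g)" for v
  proof (rule Suc.IH[of "dird v f"])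
    show "dird v f x = dird v g x" if "x \<in> S" for x
      by (rule dird_cong[OF \<open>open S\<close> that Suc.prems(1)])
  qed (use Suc.prems in \<open>simp add: C_diff_Suc_dird\<close>)
  ultimately show ?case by (simp add: C_diff_Suc_dird)
qed

lemma C_diff_SucD: "C_diff (Suc k) S f \<Longrightarrow> C_diff k S f"
proof (induction k arbitrary: f)
  case 0
  then show ?case
    by (simp add: C_diff_Suc_dird)
      (meson continuous_at_imp_continuous_on differentiable_imp_continuous_within)
next
  case (Suc k)
  then show ?case by (subst C_diff_Suc_dird) (auto simp: C_diff_Suc_dird[of "Suc k"])
qed

lemma C_diff_subset: "C_diff k T f \<Longrightarrow> S \<subseteq> T \<Longrightarrow> C_diff k S f"
  by (induction k arbitrary: f) (auto simp: C_diff_Suc_dird intro: continuous_on_subset)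

lemma C_diff_const: "C_diff k S (\<lambda>x. c)"
proof (induction k arbitrary: c)
  case (Suc k)
  have "dird v (\<lambda>x::'a. c) = (\<lambda>x. 0)" for v by (rule ext) simp
  with Suc show ?case by (simp add: C_diff_Suc_dird)
qed simp

lemma C_diff_bounded_linear:
  assumes "open S" "bounded_linear h" "C_diff k S f"
  shows "C_diff k S (\<lambda>x. h (f x))"
  using assms(3)
proof (induction k arbitrary: f)
  case 0
  then show ?case by (simp add: bounded_linear.continuous_on[OF assms(2)])
next
  case (Suc k)
  have "C_diff k S (dird v (\<lambda>x. h (f x)))" for v
    by (rule C_diff_cong[OF \<open>open S\<close> _ Suc.IH[of "dird v f"]])
      (use Suc.prems in \<open>auto simp: C_diff_Suc_dird dird_bounded_linear[OF assms(2)]\<close>)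
  then show ?case
    using Suc.prems by (auto simp: C_diff_Suc_dird intro: differentiable_bounded_linear[OF assms(2)])
qed

lemma C_diff_add:
  assumes "open S" "C_diff k S f" "C_diff k S g"
  shows "C_diff k S (\<lambda>x. f x + g x)"
  using assms(2,3)
proof (induction k arbitrary: f g)
  case 0
  then show ?case by (simp add: continuous_on_add)
next
  case (Suc k)
  have "C_diff k S (dird v (\<lambda>x. f x + g x))" for v
    by (rule C_diff_cong[OF \<open>open S\<close> _ Suc.IH[of "dird v f" "dird v g"]])
      (use Suc.prems in \<open>auto simp: C_diff_Suc_dird dird_add\<close>)
  then show ?case
    using Suc.prems by (auto simp: C_diff_Suc_dird)
qed

lemma C_diff_bilinear:
  assumes "open S" "bounded_bilinear B" "C_diff k S f" "C_diff k S g"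
  shows "C_diff k S (\<lambda>x. B (f x) (g x))"
  using assms(3,4)
proof (induction k arbitrary: f g)
  case 0
  then show ?case by (simp add: bounded_bilinear.continuous_on[OF assms(2)])
next
  case (Suc k)
  have "C_diff k S (dird v (\<lambda>x. B (f x) (g x)))" for v
  proof (rule C_diff_cong[OF \<open>open S\<close>])
    show "C_diff k S (\<lambda>x. B (f x) (dird v g x) + B (dird v f x) (g x))"
      using Suc.prems Suc.prems[THEN C_diff_SucD]
      by (intro C_diff_add[OF \<open>open S\<close>] Suc.IH) (auto simp: C_diff_Suc_dird)
  qed (use Suc.prems in \<open>auto simp: C_diff_Suc_dird dird_bilinear[OF assms(2)]\<close>)
  then show ?case
    using Suc.prems
    by (auto simp: C_diff_Suc_dird intro: differentiable_bilinear[OF assms(2)])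
qed

text \<open>In the chain rule the direction \<open>dird v g x\<close> depends on \<open>x\<close>,
  whereas \<open>C_diff\<close> speaks of fixed directions. Expanding it in the basis of the
  euclidean space leaves fixed directions, to which the induction hypothesis applies.\<close>

lemma C_diff_compose:
  fixes f :: "'b::euclidean_space \<Rightarrow> 'c::real_normed_vector"
  assumes "open S" "C_diff k S g" "C_diff k T f" "g ` S \<subseteq> T"
  shows "C_diff k S (\<lambda>x. f (g x))"
  using assms(2,3)
proof (induction k arbitrary: f)
  case 0
  then show ?case using continuous_on_compose2[of T f S g] assms by simp
next
  case (Suc k)
  have diff: "g differentiable at x" "f differentiable at (g x)" if "x \<in> S" for x
    using Suc.prems that assms by (auto simp: C_diff_Suc_dird)
  have "C_diff k S (dird v (\<lambda>x. f (g x)))" for v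
  proof (rule C_diff_cong[OF \<open>open S\<close>])
    have "C_diff k S (\<lambda>x. \<Sum>i\<in>J. (dird v g x \<bullet> i) *\<^sub>R dird i f (g x))" for J
    proof (induction J rule: infinite_finite_induct)
      case (insert i J)
      have "C_diff k S (\<lambda>x. (dird v g x \<bullet> i) *\<^sub>R dird i f (g x))"
        using Suc.prems
        by (intro C_diff_bilinear[OF \<open>open S\<close> bounded_bilinear_scaleR]
              C_diff_bounded_linear[OF \<open>open S\<close> bounded_linear_inner_left]
              Suc.IH[OF C_diff_SucD[OF Suc.prems(1)]])
          (simp_all add: C_diff_Suc_dird)
      with insert show ?case by (simp add: C_diff_add[OF \<open>open S\<close>])
    qed (simp_all add: C_diff_const)
    then show "C_diff k S (\<lambda>x. \<Sum>i\<in>Basis. (dird v g x \<bullet> i) *\<^sub>R dird i f (g x))" .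
    show "(\<Sum>i\<in>Basis. (dird v g x \<bullet> i) *\<^sub>R dird i f (g x)) = dird v (\<lambda>x. f (g x)) x" if "x \<in> S" for x
      using diff[OF that] by (simp add: dird_compose flip: dird_sum_direction) (simp add: euclidean_representation)
  qed
  moreover have "(\<lambda>x. f (g x)) differentiable at x" if "x \<in> S" for x
    using differentiable_chain_at[OF diff[OF that]] by (simp add: o_def)
  ultimately show ?case by (simp add: C_diff_Suc_dird)
qed

text \<open>The derivative is a product of \<open>dird v f\<close> and two copies of
  \<open>inverse f\<close>, so order \<open>k\<close> of the reciprocal, known by induction, yields
  order \<open>Suc k\<close>.\<close>

lemma C_diff_inverse:
  fixes f :: "'a::real_normed_vector \<Rightarrow> real"
  assumes "open S" "C_diff k S f" "\<And>x. x \<in> S \<Longrightarrow> f x \<noteq> 0"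
  shows "C_diff k S (\<lambda>x. inverse (f x))"
  using assms(2)
proof (induction k)
  case 0
  then show ?case using assms(3) by (auto intro: continuous_on_inverse)
next
  case (Suc k)
  have "((\<lambda>x. inverse (f x)) has_derivative (\<lambda>v. - (inverse (f x) * dird v f x * inverse (f x)))) (at x)"
    if "x \<in> S" for x
    using that Suc.prems assms(3)
    by (intro Deriv.has_derivative_inverse has_derivative_dird) (auto simp: C_diff_Suc_dird)
  note * = this dird_eqI[OF this]
  have "C_diff k S (dird v (\<lambda>x. inverse (f x)))" for v
  proof (rule C_diff_cong[OF \<open>open S\<close>])
    show "C_diff k S (\<lambda>x. - (inverse (f x) * dird v f x * inverse (f x)))"
      using Suc.prems Suc.IH[OF Suc.prems[THEN C_diff_SucD]]
      by (intro C_diff_bounded_linear[OF \<open>open S\<close> bounded_linear_minus[OF bounded_linear_ident]]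
            C_diff_bilinear[OF \<open>open S\<close> bounded_bilinear_mult])
        (auto simp: C_diff_Suc_dird)
  qed (simp add: *(2))
  then show ?case using *(1) by (auto simp: C_diff_Suc_dird differentiable_def)
qed

section \<open>Smooth functions with values in vectors and matrices\<close>

lemma smooth_on_differentiable: "smooth_on S f \<Longrightarrow> x \<in> S \<Longrightarrow> f differentiable at x"
  unfolding smooth_on_def by (metis C_diff_Suc_dird)

lemma smooth_on_dird: "smooth_on S f \<Longrightarrow> smooth_on S (dird v f)"
  unfolding smooth_on_def by (metis C_diff_Suc_dird)

lemma smooth_on_continuous: "smooth_on S f \<Longrightarrow> continuous_on S f"
  unfolding smooth_on_def by (metis C_diff.simps(1))

lemma smooth_on_subset: "smooth_on T f \<Longrightarrow> S \<subseteq> T \<Longrightarrow> smooth_on S f"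
  unfolding smooth_on_def by (metis C_diff_subset)

lemma smooth_on_cong: "open S \<Longrightarrow> smooth_on S f \<Longrightarrow> (\<And>x. x \<in> S \<Longrightarrow> f x = g x) \<Longrightarrow> smooth_on S g"
  unfolding smooth_on_def by (metis C_diff_cong)

lemma smooth_on_const: "smooth_on S (\<lambda>x. c)"
  by (simp add: smooth_on_def C_diff_const)

lemma smooth_on_ident: "smooth_on S (\<lambda>x. x)"
  unfolding smooth_on_def
proof
  fix k show "C_diff k S (\<lambda>x. x)"
    by (cases k) (simp_all add: C_diff_Suc_dird dird_def[abs_def] C_diff_const)
qed

lemma smooth_on_bounded_linear:
  "open S \<Longrightarrow> bounded_linear h \<Longrightarrow> smooth_on S f \<Longrightarrow> smooth_on S (\<lambda>x. h (f x))"
  by (simp add: smooth_on_def C_diff_bounded_linear)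

lemma smooth_on_bilinear:
  "open S \<Longrightarrow> bounded_bilinear B \<Longrightarrow> smooth_on S f \<Longrightarrow> smooth_on S g \<Longrightarrow> smooth_on S (\<lambda>x. B (f x) (g x))"
  by (simp add: smooth_on_def C_diff_bilinear)

lemma smooth_on_add:
  "open S \<Longrightarrow> smooth_on S f \<Longrightarrow> smooth_on S g \<Longrightarrow> smooth_on S (\<lambda>x. f x + g x)"
  by (simp add: smooth_on_def C_diff_add)

lemma smooth_on_minus: "open S \<Longrightarrow> smooth_on S f \<Longrightarrow> smooth_on S (\<lambda>x. - f x)"
  by (rule smooth_on_bounded_linear[OF _ bounded_linear_minus[OF bounded_linear_ident]])

lemma smooth_on_diff:
  "open S \<Longrightarrow> smooth_on S f \<Longrightarrow> smooth_on S g \<Longrightarrow> smooth_on S (\<lambda>x. f x - g x)"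
  using smooth_on_add[of S f "\<lambda>x. - g x"] smooth_on_minus[of S g] by simp

lemma smooth_on_sum:
  assumes "open S" "\<And>i. i \<in> I \<Longrightarrow> smooth_on S (f i)"
  shows "smooth_on S (\<lambda>x. \<Sum>i\<in>I. f i x)"
  using assms(2)
  by (induction I rule: infinite_finite_induct) (auto simp: smooth_on_const smooth_on_add[OF \<open>open S\<close>])

lemma smooth_on_scaleR:
  "open S \<Longrightarrow> smooth_on S f \<Longrightarrow> smooth_on S g \<Longrightarrow> smooth_on S (\<lambda>x. f x *\<^sub>R g x)"
  by (rule smooth_on_bilinear[OF _ bounded_bilinear_scaleR])

lemma smooth_on_mult:
  fixes f g :: "_ \<Rightarrow> 'b::real_normed_algebra"
  shows "open S \<Longrightarrow> smooth_on S f \<Longrightarrow> smooth_on S g \<Longrightarrow> smooth_on S (\<lambda>x. f x * g x)"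
  by (rule smooth_on_bilinear[OF _ bounded_bilinear_mult])

lemma smooth_on_inner:
  "open S \<Longrightarrow> smooth_on S f \<Longrightarrow> smooth_on S g \<Longrightarrow> smooth_on S (\<lambda>x. f x \<bullet> g x)"
  by (rule smooth_on_bilinear[OF _ bounded_bilinear_inner])

lemma smooth_on_prod:
  fixes f :: "_ \<Rightarrow> _ \<Rightarrow> real"
  assumes "open S" "\<And>i. i \<in> I \<Longrightarrow> smooth_on S (f i)"
  shows "smooth_on S (\<lambda>x. \<Prod>i\<in>I. f i x)"
  using assms(2)
  by (induction I rule: infinite_finite_induct) (auto simp: smooth_on_const smooth_on_mult[OF \<open>open S\<close>])

lemma smooth_on_inverse:
  fixes f :: "_ \<Rightarrow> real"
  shows "open S \<Longrightarrow> smooth_on S f \<Longrightarrow> (\<And>x. x \<in> S \<Longrightarrow> f x \<noteq> 0) \<Longrightarrow> smooth_on S (\<lambda>x. inverse (f x))"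
  by (simp add: smooth_on_def C_diff_inverse)

lemma smooth_on_compose:
  fixes f :: "'b::euclidean_space \<Rightarrow> _"
  shows "open S \<Longrightarrow> smooth_on S g \<Longrightarrow> smooth_on T f \<Longrightarrow> g ` S \<subseteq> T \<Longrightarrow> smooth_on S (\<lambda>x. f (g x))"
  using C_diff_compose[of S _ g T f] by (simp add: smooth_on_def)

lemma smooth_on_euclidean:
  fixes f :: "_ \<Rightarrow> 'b::euclidean_space"
  assumes "open S" "\<And>i. i \<in> Basis \<Longrightarrow> smooth_on S (\<lambda>x. f x \<bullet> i)"
  shows "smooth_on S f"
proof -
  have "smooth_on S (\<lambda>x. \<Sum>i\<in>Basis. (f x \<bullet> i) *\<^sub>R i)"
    by (intro smooth_on_sum smooth_on_scaleR assms smooth_on_const)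
  then show ?thesis by (simp add: euclidean_representation)
qed

lemma smooth_on_vec:
  fixes f :: "_ \<Rightarrow> 'b::euclidean_space ^ 'n::finite"
  assumes "open S" "\<And>i. smooth_on S (\<lambda>x. f x $ i)"
  shows "smooth_on S f"
proof (rule smooth_on_euclidean[OF \<open>open S\<close>])
  fix e :: "'b ^ 'n" assume "e \<in> Basis"
  then obtain i u where "e = axis i u" by (auto simp: Basis_vec_def)
  then show "smooth_on S (\<lambda>x. f x \<bullet> e)"
    using smooth_on_inner[OF \<open>open S\<close> assms(2)[of i] smooth_on_const[of S u]] by (simp add: inner_axis)
qed

lemma smooth_on_nth:
  "open S \<Longrightarrow> smooth_on S f \<Longrightarrow> smooth_on S (\<lambda>x. f x $ i)"
  by (rule smooth_on_bounded_linear[OF _ bounded_linear_vec_nth])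

lemma smooth_on_entry:
  "open S \<Longrightarrow> smooth_on S f \<Longrightarrow> smooth_on S (\<lambda>x. f x $ i $ j)"
  by (intro smooth_on_nth)

lemma bounded_bilinear_matrix_vector_mult:
  "bounded_bilinear ((*v) :: real ^ 'n::finite ^ 'm::finite \<Rightarrow> real ^ 'n \<Rightarrow> real ^ 'm)"
  unfolding bilinear_conv_bounded_bilinear[symmetric] bilinear_def
  by (auto intro!: linearI simp: matrix_vector_right_distrib matrix_vector_mult_add_rdistrib
      matrix_vector_mult_scaleR scaleR_matrix_vector_assoc)

lemma bounded_bilinear_matrix_matrix_mult:
  "bounded_bilinear ((**) :: real ^ 'n::finite ^ 'm::finite \<Rightarrow> real ^ 'k::finite ^ 'n \<Rightarrow> real ^ 'k ^ 'm)"
  unfolding bilinear_conv_bounded_bilinear[symmetric] bilinear_def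
  by (auto intro!: linearI simp: matrix_add_ldistrib vec_eq_iff matrix_matrix_mult_def
      sum.distrib sum_distrib_left algebra_simps)

lemma bounded_linear_transpose:
  "bounded_linear (transpose :: real ^ 'n::finite ^ 'm::finite \<Rightarrow> real ^ 'm ^ 'n)"
  unfolding linear_conv_bounded_linear[symmetric]
  by (auto intro!: linearI simp: transpose_def vec_eq_iff)

lemma smooth_on_det:
  fixes M :: "_ \<Rightarrow> real ^ 'n::finite ^ 'n"
  assumes "open S" "smooth_on S M"
  shows "smooth_on S (\<lambda>x. det (M x))"
  unfolding det_def
  by (intro smooth_on_sum smooth_on_mult smooth_on_const smooth_on_prod smooth_on_entry assms)

lemma
  fixes M :: "'a::semiring_1 ^ 'n::finite ^ 'm::finite"
  assumes "invertible M"
  shows matrix_inv_right: "M ** matrix_inv M = mat 1" and matrix_inv_left: "matrix_inv M ** M = mat 1"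
proof -
  have "M ** matrix_inv M = mat 1 \<and> matrix_inv M ** M = mat 1"
    using assms unfolding invertible_def matrix_inv_def by (rule someI_ex)
  then show "M ** matrix_inv M = mat 1" "matrix_inv M ** M = mat 1" by simp_all
qed

text \<open>Cramer's rule writes each entry of the inverse as a quotient of determinants, and a
  determinant is a polynomial in the entries.\<close>

lemma smooth_on_matrix_inv:
  fixes M :: "_ \<Rightarrow> real ^ 'n::finite ^ 'n"
  assumes "open S" "smooth_on S M" "\<And>x. x \<in> S \<Longrightarrow> invertible (M x)"
  shows "smooth_on S (\<lambda>x. matrix_inv (M x))"
proof (intro smooth_on_vec \<open>open S\<close>)
  fix i k
  have eq: "matrix_inv (M x) $ i $ k = det (\<chi> a j. if j = i then axis k 1 $ a else M x $ a $ j) * inverse (det (M x))"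
    if "x \<in> S" for x
  proof -
    have "det (M x) \<noteq> 0"
      using assms(3)[OF that] invertible_det_nz by blast
    moreover have "M x *v (matrix_inv (M x) *v axis k 1) = axis k 1"
      by (simp add: matrix_vector_mul_assoc matrix_inv_right[OF assms(3)[OF that]])
    ultimately have "matrix_inv (M x) *v axis k 1 =
        (\<chi> l. det (\<chi> a j. if j = l then axis k 1 $ a else M x $ a $ j) / det (M x))"
      using cramer by blast
    then have "(matrix_inv (M x) *v axis k 1) $ i =
        det (\<chi> a j. if j = i then axis k 1 $ a else M x $ a $ j) / det (M x)"
      by simp
    then show ?thesis
      by (simp add: matrix_vector_mul_component inner_axis divide_inverse)
  qed
  have "smooth_on S (\<lambda>x. det (\<chi> a j. if j = i then axis k 1 $ a else M x $ a $ j) * inverse (det (M x)))"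
  proof (intro smooth_on_mult smooth_on_inverse smooth_on_det assms)
    show "smooth_on S (\<lambda>x. \<chi> a j. if j = i then axis k 1 $ a else M x $ a $ j)"
    proof (intro smooth_on_vec \<open>open S\<close>)
      show "smooth_on S (\<lambda>x. (\<chi> a j. if j = i then axis k 1 $ a else M x $ a $ j) $ a $ j)" for a j
        by (cases "j = i") (auto intro: smooth_on_const smooth_on_entry assms)
    qed
    show "det (M x) \<noteq> 0" if "x \<in> S" for x
      using assms(3)[OF that] invertible_det_nz by blast
  qed
  then show "smooth_on S (\<lambda>x. matrix_inv (M x) $ i $ k)"
    by (rule smooth_on_cong[OF \<open>open S\<close>]) (simp add: eq)
qed

section \<open>Symmetry of second directional derivatives\<close>

lemma second_difference_mean_value:
  fixes f :: "'a::real_normed_vector \<Rightarrow> real"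
  assumes f: "smooth_on S f" and "h > 0"
    and S: "\<And>s t. 0 \<le> s \<Longrightarrow> s \<le> h \<Longrightarrow> 0 \<le> t \<Longrightarrow> t \<le> h \<Longrightarrow> x + s *\<^sub>R v + t *\<^sub>R w \<in> S"
  shows "\<exists>s t. 0 < s \<and> s < h \<and> 0 < t \<and> t < h \<and>
    f (x + h *\<^sub>R v + h *\<^sub>R w) - f (x + h *\<^sub>R v) - f (x + h *\<^sub>R w) + f x =
    h * h * dird w (dird v f) (x + s *\<^sub>R v + t *\<^sub>R w)"
proof -
  have line: "((\<lambda>r. F (y + r *\<^sub>R u)) has_real_derivative dird u F (y + r *\<^sub>R u)) (at r)"
    if "F differentiable at (y + r *\<^sub>R u)" for F :: "'a \<Rightarrow> real" and y u r
  proof -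
    have "((\<lambda>r. y + r *\<^sub>R u) has_derivative (\<lambda>s. s *\<^sub>R u)) (at r)"
      by (auto intro!: derivative_eq_intros)
    from has_derivative_compose[OF this has_derivative_dird[OF that]]
    show ?thesis
      using linear_scale[OF linear_dird[OF that]]
      by (simp add: has_field_derivative_def mult.commute[of _ "dird u F _"])
  qed
  have df: "f differentiable at y" "dird v f differentiable at y" if "y \<in> S" for y
    using f that by (auto intro: smooth_on_differentiable smooth_on_dird)
  \<comment> \<open>The mean value theorem is applied to the increment of \<open>f\<close> over
    \<open>h *\<^sub>R w\<close>, regarded as a function of the step \<open>s\<close> along
    \<open>v\<close>, and then to \<open>dird v f\<close> along \<open>w\<close>.\<close>
  have 1: "((\<lambda>s. f ((x + h *\<^sub>R w) + s *\<^sub>R v) - f (x + s *\<^sub>R v)) has_real_derivative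
      dird v f ((x + h *\<^sub>R w) + s *\<^sub>R v) - dird v f (x + s *\<^sub>R v)) (at s)" if "0 \<le> s" "s \<le> h" for s
    using S[of s h] S[of s 0] that \<open>h > 0\<close>
    by (intro DERIV_diff line df) (auto simp: algebra_simps)
  from MVT2[OF \<open>h > 0\<close> 1] obtain s where s: "0 < s" "s < h"
    "f (x + h *\<^sub>R w + h *\<^sub>R v) - f (x + h *\<^sub>R v) - (f (x + h *\<^sub>R w) - f x) =
      h * (dird v f (x + h *\<^sub>R w + s *\<^sub>R v) - dird v f (x + s *\<^sub>R v))"
    by auto
  have 2: "((\<lambda>t. dird v f ((x + s *\<^sub>R v) + t *\<^sub>R w)) has_real_derivative
      dird w (dird v f) ((x + s *\<^sub>R v) + t *\<^sub>R w)) (at t)" if "0 \<le> t" "t \<le> h" for t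
    using S[of s t] that s by (intro line df) auto
  from MVT2[OF \<open>h > 0\<close> 2] obtain t where t: "0 < t" "t < h"
    "dird v f (x + s *\<^sub>R v + h *\<^sub>R w) - dird v f (x + s *\<^sub>R v) =
      h * dird w (dird v f) (x + s *\<^sub>R v + t *\<^sub>R w)"
    by auto
  have "x + h *\<^sub>R w + s *\<^sub>R v = x + s *\<^sub>R v + h *\<^sub>R w" "x + h *\<^sub>R w + h *\<^sub>R v = x + h *\<^sub>R v + h *\<^sub>R w"
    by simp_all
  with s t show ?thesis
    by (intro exI[of _ s] exI[of _ t]) (simp add: algebra_simps)
qed

text \<open>The second difference of \<open>f\<close> over a parallelogram is symmetric in
  \<open>v\<close> and \<open>w\<close>, so the mean value theorem makes both mixed derivatives take
  a common value at points arbitrarily near \<open>x\<close>; continuity does the rest.\<close>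

lemma dird_commute_real:
  fixes f :: "'a::real_normed_vector \<Rightarrow> real"
  assumes "open S" and f: "smooth_on S f" and "x \<in> S"
  shows "dird v (dird w f) x = dird w (dird v f) x"
proof (rule ccontr)
  let ?F = "dird v (dird w f)" and ?G = "dird w (dird v f)"
  \<comment> \<open>Half the gap: one number cannot lie within \<open>e\<close> of both
    values.\<close>
  define e where "e = \<bar>?F x - ?G x\<bar> / 2"
  assume "?F x \<noteq> ?G x"
  then have "e > 0" by (simp add: e_def)
  have cont: "isCont (dird a (dird b f)) x" for a b
    using smooth_on_differentiable[OF smooth_on_dird[OF smooth_on_dird[OF f]] \<open>x \<in> S\<close>]
    by (simp add: differentiable_imp_continuous_within)
  obtain d1 where d1: "d1 > 0" "\<And>y. dist y x < d1 \<Longrightarrow> dist (?F y) (?F x) < e"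
    using cont[of v w] \<open>e > 0\<close> unfolding continuous_at_eps_delta by metis
  obtain d2 where d2: "d2 > 0" "\<And>y. dist y x < d2 \<Longrightarrow> dist (?G y) (?G x) < e"
    using cont[of w v] \<open>e > 0\<close> unfolding continuous_at_eps_delta by metis
  obtain d3 where d3: "d3 > 0" "\<And>y. dist y x < d3 \<Longrightarrow> y \<in> S"
    using \<open>open S\<close> \<open>x \<in> S\<close> unfolding open_dist by blast
  define d where "d = min d1 (min d2 d3)"
  have d: "d > 0" "\<And>y. dist y x < d \<Longrightarrow> dist (?F y) (?F x) < e \<and> dist (?G y) (?G x) < e \<and> y \<in> S"
    using d1 d2 d3 by (auto simp: d_def)
  \<comment> \<open>Keeps the parallelogram with sides \<open>h *\<^sub>R v\<close> and
    \<open>h *\<^sub>R w\<close> inside the ball of radius \<open>d\<close>; the summand 1 covers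
    \<open>v = w = 0\<close>.\<close>
  define h where "h = d / (2 * (norm v + norm w + 1))"
  have pos: "norm v + norm w + 1 > 0" by (simp add: add_nonneg_pos)
  have "h > 0" using d pos by (simp add: h_def)
  have near: "dist (x + s *\<^sub>R v + t *\<^sub>R w) x < d" if "0 \<le> s" "s \<le> h" "0 \<le> t" "t \<le> h" for s t
  proof -
    have "dist (x + s *\<^sub>R v + t *\<^sub>R w) x \<le> s * norm v + t * norm w"
      using that norm_triangle_ineq[of "s *\<^sub>R v" "t *\<^sub>R w"] by (simp add: dist_norm add.assoc)
    also have "\<dots> \<le> h * norm v + h * norm w"
      using that by (intro add_mono mult_right_mono) auto
    also have "\<dots> \<le> h * (norm v + norm w + 1)"
      using \<open>h > 0\<close> by (simp add: algebra_simps)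
    also have "\<dots> = d / 2" unfolding h_def using pos by (metis less_numeral_extra(3) mult.commute nonzero_mult_divide_mult_cancel_right times_divide_eq_right)
    finally show ?thesis using d(1) by linarith
  qed
  obtain s t where st: "0 < s" "s < h" "0 < t" "t < h"
    "f (x + h *\<^sub>R v + h *\<^sub>R w) - f (x + h *\<^sub>R v) - f (x + h *\<^sub>R w) + f x =
      h * h * ?G (x + s *\<^sub>R v + t *\<^sub>R w)"
    using second_difference_mean_value[OF f \<open>h > 0\<close>, of x v w] near d(2) by blast
  obtain s' t' where st': "0 < s'" "s' < h" "0 < t'" "t' < h"
    "f (x + h *\<^sub>R w + h *\<^sub>R v) - f (x + h *\<^sub>R w) - f (x + h *\<^sub>R v) + f x =
      h * h * ?F (x + s' *\<^sub>R w + t' *\<^sub>R v)"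
  proof -
    have "x + s *\<^sub>R w + t *\<^sub>R v \<in> S" if "0 \<le> s" "s \<le> h" "0 \<le> t" "t \<le> h" for s t
      using near[of t s] d(2) that by (simp add: algebra_simps)
    then show ?thesis
      using that second_difference_mean_value[OF f \<open>h > 0\<close>, of x w v] by blast
  qed
  have "f (x + h *\<^sub>R w + h *\<^sub>R v) = f (x + h *\<^sub>R v + h *\<^sub>R w)" by (simp add: ac_simps)
  then have "h * h * ?G (x + s *\<^sub>R v + t *\<^sub>R w) = h * h * ?F (x + s' *\<^sub>R w + t' *\<^sub>R v)"
    using st(5) st'(5) by linarith
  moreover have "x + s' *\<^sub>R w + t' *\<^sub>R v = x + t' *\<^sub>R v + s' *\<^sub>R w" by simp
  ultimately have "?G (x + s *\<^sub>R v + t *\<^sub>R w) = ?F (x + t' *\<^sub>R v + s' *\<^sub>R w)"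
    using \<open>h > 0\<close> by (metis mult_cancel_left mult_eq_0_iff less_irrefl)
  moreover have "dist (?G (x + s *\<^sub>R v + t *\<^sub>R w)) (?G x) < e"
    using near[of s t] st d(2) by auto
  moreover have "dist (?F (x + t' *\<^sub>R v + s' *\<^sub>R w)) (?F x) < e"
    using near[of t' s'] st' d(2) by auto
  ultimately show False
    unfolding dist_real_def e_def by argo
qed

lemma dird_commute:
  fixes f :: "'a::real_normed_vector \<Rightarrow> 'b::real_inner"
  assumes "open S" and f: "smooth_on S f" and "x \<in> S"
  shows "dird v (dird w f) x = dird w (dird v f) x"
proof -
  have inner: "dird a (dird b f) x \<bullet> c = dird a (dird b (\<lambda>y. f y \<bullet> c)) x" for a b c
  proof -
    have "dird a (dird b f) x \<bullet> c = dird a (\<lambda>y. dird b f y \<bullet> c) x"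
      using smooth_on_differentiable[OF smooth_on_dird[OF f] \<open>x \<in> S\<close>]
      by (simp add: dird_bounded_linear[OF bounded_linear_inner_left])
    also have "\<dots> = dird a (dird b (\<lambda>y. f y \<bullet> c)) x"
      using smooth_on_differentiable[OF f]
      by (intro dird_cong[OF \<open>open S\<close> \<open>x \<in> S\<close>]) (simp add: dird_bounded_linear[OF bounded_linear_inner_left])
    finally show ?thesis .
  qed
  have "dird v (dird w f) x \<bullet> c = dird w (dird v f) x \<bullet> c" for c
    unfolding inner
    by (intro dird_commute_real[OF \<open>open S\<close> _ \<open>x \<in> S\<close>] smooth_on_inner smooth_on_const f \<open>open S\<close>)
  then show ?thesis by (metis inner_commute vector_eq_rdot)
qed

section \<open>Covariant calculus in a coordinate domain\<close>

interpretation matmul: bounded_bilinear "(**) :: real ^ 'n::finite ^ 'n \<Rightarrow> real ^ 'n ^ 'n \<Rightarrow> real ^ 'n ^ 'n"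
  by (rule bounded_bilinear_matrix_matrix_mult)

interpretation matvec: bounded_bilinear "(*v) :: real ^ 'n::finite ^ 'm::finite \<Rightarrow> real ^ 'n \<Rightarrow> real ^ 'm"
  by (rule bounded_bilinear_matrix_vector_mult)

lemma inner_transpose_mult: "X \<bullet> (transpose M *v Y) = (M *v X) \<bullet> Y"
  for M :: "real ^ 'n::finite ^ 'm::finite"
  by (metis dot_lmul_matrix transpose_matrix_vector inner_commute)

lemma sum_axis: "(\<Sum>i\<in>UNIV. (X $ i) *\<^sub>R axis i 1) = X"
  for X :: "real ^ 'n::finite"
  using basis_expansion[of X] by (simp add: scalar_mult_eq_scaleR)

lemma dird_coordinates:
  fixes F :: "real ^ 'n::finite \<Rightarrow> 'b::real_normed_vector"
  assumes "F differentiable at x"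
  shows "dird X F x = (\<Sum>k\<in>UNIV. (X $ k) *\<^sub>R dird (axis k 1) F x)"
  using dird_sum_direction[OF assms, of "\<lambda>k. X $ k" "\<lambda>k. axis k 1" UNIV] by (simp add: sum_axis)

text \<open>The matrix \<open>\<Gamma> i\<close> has the entries \<open>\<Gamma> i $ h $ j\<close> with upper index \<open>h\<close>, and \<open>curv \<Gamma> i j\<close> is the
  matrix of \<open>R(\<partial>\<^sub>i, \<partial>\<^sub>j)\<close>.\<close>

definition curv :: "('n::finite \<Rightarrow> real ^ 'n \<Rightarrow> real ^ 'n ^ 'n) \<Rightarrow> 'n \<Rightarrow> 'n \<Rightarrow> real ^ 'n \<Rightarrow> real ^ 'n ^ 'n" where
  "curv \<Gamma> i j \<xi> = dird (axis i 1) (\<Gamma> j) \<xi> - dird (axis j 1) (\<Gamma> i) \<xi> + \<Gamma> i \<xi> ** \<Gamma> j \<xi> - \<Gamma> j \<xi> ** \<Gamma> i \<xi>"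

text \<open>\<open>\<Gamma>\<close> enters only through its properties, so the covariant calculus
  never meets the Christoffel formula: \<open>dG\<close> is metric compatibility, and
  \<open>dJ\<close> and \<open>dR\<close> are the vanishing of the covariant derivatives of
  \<open>J\<close> and of the curvature, solved for the partial derivatives.\<close>

locale symmetric_kaehler_chart =
  fixes \<Omega> :: "(real ^ 'n::finite) set"
    and G J :: "real ^ 'n \<Rightarrow> real ^ 'n ^ 'n"
    and \<Gamma> :: "'n \<Rightarrow> real ^ 'n \<Rightarrow> real ^ 'n ^ 'n"
  assumes open_dom: "open \<Omega>"
    and smooth_G: "smooth_on \<Omega> G"
    and smooth_J: "smooth_on \<Omega> J"
    and smooth_Gamma: "smooth_on \<Omega> (\<Gamma> i)"
    and G_sym: "\<xi> \<in> \<Omega> \<Longrightarrow> transpose (G \<xi>) = G \<xi>"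
    and G_pos: "\<xi> \<in> \<Omega> \<Longrightarrow> X \<noteq> 0 \<Longrightarrow> X \<bullet> (G \<xi> *v X) > 0"
    and dG: "\<xi> \<in> \<Omega> \<Longrightarrow> dird (axis k 1) G \<xi> = transpose (\<Gamma> k \<xi>) ** G \<xi> + G \<xi> ** \<Gamma> k \<xi>"
    and torsion_free: "\<xi> \<in> \<Omega> \<Longrightarrow> \<Gamma> i \<xi> $ h $ j = \<Gamma> j \<xi> $ h $ i"
    and dJ: "\<xi> \<in> \<Omega> \<Longrightarrow> dird (axis k 1) J \<xi> = J \<xi> ** \<Gamma> k \<xi> - \<Gamma> k \<xi> ** J \<xi>"
    and J_J: "\<xi> \<in> \<Omega> \<Longrightarrow> J \<xi> *v (J \<xi> *v X) = - X"
    and J_isometry: "\<xi> \<in> \<Omega> \<Longrightarrow> (J \<xi> *v X) \<bullet> (G \<xi> *v (J \<xi> *v Y)) = X \<bullet> (G \<xi> *v Y)"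
    and dR: "\<xi> \<in> \<Omega> \<Longrightarrow> dird (axis k 1) (curv \<Gamma> i j) \<xi> =
      curv \<Gamma> i j \<xi> ** \<Gamma> k \<xi> - \<Gamma> k \<xi> ** curv \<Gamma> i j \<xi>
      + (\<Sum>a\<in>UNIV. (\<Gamma> k \<xi> $ a $ i) *\<^sub>R curv \<Gamma> a j \<xi>) + (\<Sum>a\<in>UNIV. (\<Gamma> k \<xi> $ a $ j) *\<^sub>R curv \<Gamma> i a \<xi>)"
begin

section \<open>Metric, connection and curvature at a point of the chart\<close>

definition inn :: "real ^ 'n \<Rightarrow> real ^ 'n \<Rightarrow> real ^ 'n \<Rightarrow> real" where
  "inn \<xi> X Y = X \<bullet> (G \<xi> *v Y)"

definition conn :: "real ^ 'n \<Rightarrow> real ^ 'n \<Rightarrow> real ^ 'n ^ 'n" where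
  "conn \<xi> X = (\<Sum>i\<in>UNIV. (X $ i) *\<^sub>R \<Gamma> i \<xi>)"

definition Riem :: "real ^ 'n \<Rightarrow> real ^ 'n \<Rightarrow> real ^ 'n \<Rightarrow> real ^ 'n ^ 'n" where
  "Riem \<xi> X Y = (\<Sum>i\<in>UNIV. \<Sum>j\<in>UNIV. (X $ i * Y $ j) *\<^sub>R curv \<Gamma> i j \<xi>)"

text \<open>Covariant derivative of a field along a map \<open>x\<close>, in a direction
  \<open>v\<close> of the parameter space. The parameter space is arbitrary because four maps occur:
  the identity of the chart, a curve, a two-parameter variation of it, and the base point as a
  function of hypersurface coordinates.\<close>

definition cov :: "('e::real_normed_vector \<Rightarrow> real ^ 'n) \<Rightarrow> 'e \<Rightarrow> ('e \<Rightarrow> real ^ 'n) \<Rightarrow> 'e \<Rightarrow> real ^ 'n" where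
  "cov x v V z = dird v V z + conn (x z) (dird v x z) *v V z"

lemma inn_add [simp]:
  "inn \<xi> (X + Y) Z = inn \<xi> X Z + inn \<xi> Y Z" "inn \<xi> Z (X + Y) = inn \<xi> Z X + inn \<xi> Z Y"
  by (simp_all add: inn_def matvec.add_right algebra_simps)

lemma inn_minus [simp]:
  "inn \<xi> (- X) Z = - inn \<xi> X Z" "inn \<xi> Z (- X) = - inn \<xi> Z X"
  by (simp_all add: inn_def matvec.minus_right)

lemma inn_diff [simp]:
  "inn \<xi> (X - Y) Z = inn \<xi> X Z - inn \<xi> Y Z" "inn \<xi> Z (X - Y) = inn \<xi> Z X - inn \<xi> Z Y"
  by (simp_all add: inn_def matvec.diff_right inner_diff)

lemma inn_scaleR [simp]:
  "inn \<xi> (c *\<^sub>R X) Z = c * inn \<xi> X Z" "inn \<xi> Z (c *\<^sub>R X) = c * inn \<xi> Z X"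
  by (simp_all add: inn_def matvec.scaleR_right)

lemma inn_zero [simp]: "inn \<xi> 0 X = 0" "inn \<xi> X 0 = 0"
  by (simp_all add: inn_def)

lemma inn_commute: "\<xi> \<in> \<Omega> \<Longrightarrow> inn \<xi> X Y = inn \<xi> Y X"
  unfolding inn_def by (metis G_sym inner_transpose_mult inner_commute)

lemma inn_eq_0_iff: "\<xi> \<in> \<Omega> \<Longrightarrow> inn \<xi> X X = 0 \<longleftrightarrow> X = 0"
  using G_pos[of \<xi> X] by (cases "X = 0") (auto simp: inn_def)

lemma inn_pos: "\<xi> \<in> \<Omega> \<Longrightarrow> X \<noteq> 0 \<Longrightarrow> inn \<xi> X X > 0"
  using G_pos[of \<xi> X] by (auto simp: inn_def)

lemma inn_eqI: "\<xi> \<in> \<Omega> \<Longrightarrow> (\<And>Z. inn \<xi> X Z = inn \<xi> Y Z) \<Longrightarrow> X = Y"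
  using inn_eq_0_iff[of \<xi> "X - Y"] by simp

lemma inn_J: "\<xi> \<in> \<Omega> \<Longrightarrow> inn \<xi> (J \<xi> *v X) (J \<xi> *v Y) = inn \<xi> X Y"
  by (simp add: inn_def J_isometry)

lemma inn_J_left: "\<xi> \<in> \<Omega> \<Longrightarrow> inn \<xi> (J \<xi> *v X) Y = - inn \<xi> X (J \<xi> *v Y)"
  using inn_J[of \<xi> X "J \<xi> *v Y"] by (simp add: J_J)

lemma inn_J_self: "\<xi> \<in> \<Omega> \<Longrightarrow> inn \<xi> X (J \<xi> *v X) = 0" "\<xi> \<in> \<Omega> \<Longrightarrow> inn \<xi> (J \<xi> *v X) X = 0"
  using inn_J_left[of \<xi> X X] inn_commute[of \<xi> X "J \<xi> *v X"] by simp_all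

lemma conn_commute: "\<xi> \<in> \<Omega> \<Longrightarrow> conn \<xi> X *v Y = conn \<xi> Y *v X"
proof (subst vec_eq_iff, rule allI)
  fix h assume "\<xi> \<in> \<Omega>"
  have comp: "(conn \<xi> X *v Y) $ h = (\<Sum>j\<in>UNIV. \<Sum>i\<in>UNIV. X $ i * \<Gamma> i \<xi> $ h $ j * Y $ j)" for X Y
    by (simp add: conn_def matrix_vector_mult_def sum_distrib_right)
  show "(conn \<xi> X *v Y) $ h = (conn \<xi> Y *v X) $ h"
    unfolding comp
    by (subst sum.swap) (simp add: torsion_free[OF \<open>\<xi> \<in> \<Omega>\<close>, of _ h] mult_ac)
qed

lemma conn_mult: "conn \<xi> X ** conn \<xi> Y = (\<Sum>i\<in>UNIV. \<Sum>j\<in>UNIV. (X $ i * Y $ j) *\<^sub>R (\<Gamma> i \<xi> ** \<Gamma> j \<xi>))"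
  unfolding conn_def matmul.sum_left matmul.sum_right
  by (subst sum.swap) (simp add: matmul.scaleR_left matmul.scaleR_right scaleR_sum_right mult.commute)

lemma smooth_curv: "smooth_on \<Omega> (curv \<Gamma> i j)"
  unfolding curv_def[abs_def]
  by (intro smooth_on_diff smooth_on_add smooth_on_bilinear[OF _ bounded_bilinear_matrix_matrix_mult]
      smooth_on_dird smooth_Gamma open_dom)

lemma curv_skew: "curv \<Gamma> i j \<xi> = - curv \<Gamma> j i \<xi>"
  by (simp add: curv_def)

lemma Riem_skew: "Riem \<xi> X Y = - Riem \<xi> Y X"
proof -
  have "Riem \<xi> X Y = (\<Sum>j\<in>UNIV. \<Sum>i\<in>UNIV. (X $ i * Y $ j) *\<^sub>R - curv \<Gamma> j i \<xi>)"
    unfolding Riem_def by (subst sum.swap, intro sum.cong refl) (metis curv_skew)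
  then show ?thesis
    by (simp add: Riem_def sum_negf mult.commute)
qed

lemma Riem_add:
  "Riem \<xi> (X + X') Y = Riem \<xi> X Y + Riem \<xi> X' Y" "Riem \<xi> X (Y + Y') = Riem \<xi> X Y + Riem \<xi> X Y'"
  by (simp_all add: Riem_def sum.distrib algebra_simps)

lemma Riem_scaleR: "Riem \<xi> (c *\<^sub>R X) Y = c *\<^sub>R Riem \<xi> X Y"
  by (simp add: Riem_def scaleR_sum_right mult.assoc)

text \<open>Grouped as the terms appear when two covariant derivatives along a map are exchanged:
  derivatives of the connection matrix, then products of connection matrices.\<close>

lemma Riem_alt:
  "Riem \<xi> X Y = (\<Sum>i\<in>UNIV. \<Sum>j\<in>UNIV. (X $ i * Y $ j) *\<^sub>R dird (axis i 1) (\<Gamma> j) \<xi>)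
     - (\<Sum>i\<in>UNIV. \<Sum>j\<in>UNIV. (Y $ i * X $ j) *\<^sub>R dird (axis i 1) (\<Gamma> j) \<xi>)
     + conn \<xi> X ** conn \<xi> Y - conn \<xi> Y ** conn \<xi> X"
proof -
  have "Riem \<xi> X Y = (\<Sum>i\<in>UNIV. \<Sum>j\<in>UNIV. (X $ i * Y $ j) *\<^sub>R dird (axis i 1) (\<Gamma> j) \<xi>)
     - (\<Sum>i\<in>UNIV. \<Sum>j\<in>UNIV. (X $ i * Y $ j) *\<^sub>R dird (axis j 1) (\<Gamma> i) \<xi>)
     + (\<Sum>i\<in>UNIV. \<Sum>j\<in>UNIV. (X $ i * Y $ j) *\<^sub>R (\<Gamma> i \<xi> ** \<Gamma> j \<xi>))
     - (\<Sum>i\<in>UNIV. \<Sum>j\<in>UNIV. (X $ i * Y $ j) *\<^sub>R (\<Gamma> j \<xi> ** \<Gamma> i \<xi>))"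
    by (simp add: Riem_def curv_def scaleR_diff_right scaleR_add_right sum.distrib sum_subtractf)
  moreover have "(\<Sum>i\<in>UNIV. \<Sum>j\<in>UNIV. (X $ i * Y $ j) *\<^sub>R dird (axis j 1) (\<Gamma> i) \<xi>) =
      (\<Sum>i\<in>UNIV. \<Sum>j\<in>UNIV. (Y $ i * X $ j) *\<^sub>R dird (axis i 1) (\<Gamma> j) \<xi>)"
    by (subst sum.swap) (simp add: mult.commute)
  moreover have "(\<Sum>i\<in>UNIV. \<Sum>j\<in>UNIV. (X $ i * Y $ j) *\<^sub>R (\<Gamma> j \<xi> ** \<Gamma> i \<xi>)) = conn \<xi> Y ** conn \<xi> X"
    unfolding conn_mult by (subst sum.swap) (simp add: mult.commute)
  ultimately show ?thesis by (simp add: conn_mult)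
qed

end

section \<open>Covariant derivatives along a map into the chart\<close>

locale map_into_chart = symmetric_kaehler_chart \<Omega> G J \<Gamma>
  for \<Omega> :: "(real ^ 'n::finite) set" and G J \<Gamma> +
  fixes W :: "'e::real_normed_vector set" and x :: "'e \<Rightarrow> real ^ 'n"
  assumes open_W: "open W" and smooth_x: "smooth_on W x" and x_in: "z \<in> W \<Longrightarrow> x z \<in> \<Omega>"
begin

abbreviation D :: "'e \<Rightarrow> ('e \<Rightarrow> real ^ 'n) \<Rightarrow> 'e \<Rightarrow> real ^ 'n" where
  "D \<equiv> cov x"

lemma smooth_along:
  fixes F :: "real ^ 'n \<Rightarrow> 'b::real_normed_vector"
  shows "smooth_on \<Omega> F \<Longrightarrow> smooth_on W (\<lambda>z. F (x z))"
  by (rule smooth_on_compose[OF open_W smooth_x]) (auto simp: x_in)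

lemma dird_along:
  fixes F :: "real ^ 'n \<Rightarrow> 'b::real_normed_vector"
  assumes "smooth_on \<Omega> F" "z \<in> W"
  shows "dird v (\<lambda>z. F (x z)) z = (\<Sum>k\<in>UNIV. (dird v x z $ k) *\<^sub>R dird (axis k 1) F (x z))"
proof -
  have F: "F differentiable at (x z)" using assms x_in smooth_on_differentiable by blast
  show ?thesis
    using dird_compose[OF smooth_on_differentiable[OF smooth_x \<open>z \<in> W\<close>] F, of v]
      dird_coordinates[OF F, of "dird v x z"] by simp
qed

lemma dird_G_along:
  assumes "z \<in> W"
  shows "dird v (\<lambda>z. G (x z)) z =
    transpose (conn (x z) (dird v x z)) ** G (x z) + G (x z) ** conn (x z) (dird v x z)"
  by (simp add: dird_along[OF smooth_G assms] dG[OF x_in[OF assms]] conn_def scaleR_add_right sum.distrib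
      bounded_linear.linear[OF bounded_linear_transpose] linear_sum linear_scale
      matmul.sum_left matmul.sum_right matmul.scaleR_left matmul.scaleR_right)

lemma dird_J_along:
  assumes "z \<in> W"
  shows "dird v (\<lambda>z. J (x z)) z =
    J (x z) ** conn (x z) (dird v x z) - conn (x z) (dird v x z) ** J (x z)"
  by (simp add: dird_along[OF smooth_J assms] dJ[OF x_in[OF assms]] conn_def scaleR_diff_right sum_subtractf
      matmul.sum_left matmul.sum_right matmul.scaleR_left matmul.scaleR_right)

lemma smooth_conn: "smooth_on W X \<Longrightarrow> smooth_on W (\<lambda>z. conn (x z) (X z))"
  unfolding conn_def by (intro smooth_on_sum smooth_on_scaleR smooth_on_nth smooth_along smooth_Gamma open_W)

lemma smooth_cov: "smooth_on W V \<Longrightarrow> smooth_on W (D v V)"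
  unfolding cov_def[abs_def]
  by (intro smooth_on_add smooth_on_dird smooth_on_bilinear[OF _ bounded_bilinear_matrix_vector_mult]
      smooth_conn smooth_x open_W)

lemma smooth_inn: "smooth_on W V \<Longrightarrow> smooth_on W V' \<Longrightarrow> smooth_on W (\<lambda>z. inn (x z) (V z) (V' z))"
  unfolding inn_def
  by (intro smooth_on_inner smooth_on_bilinear[OF _ bounded_bilinear_matrix_vector_mult]
      smooth_along smooth_G open_W)

lemma smooth_J_mult: "smooth_on W V \<Longrightarrow> smooth_on W (\<lambda>z. J (x z) *v V z)"
  by (intro smooth_on_bilinear[OF _ bounded_bilinear_matrix_vector_mult] smooth_along smooth_J open_W)

lemma smooth_Riem:
  "smooth_on W X \<Longrightarrow> smooth_on W Y \<Longrightarrow> smooth_on W V \<Longrightarrow> smooth_on W (\<lambda>z. Riem (x z) (X z) (Y z) *v V z)"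
  unfolding Riem_def
  by (intro smooth_on_bilinear[OF _ bounded_bilinear_matrix_vector_mult] smooth_on_sum smooth_on_scaleR
      smooth_on_mult smooth_on_nth smooth_along smooth_curv open_W)

lemma cov_cong:
  assumes "z \<in> W" "\<And>z. z \<in> W \<Longrightarrow> V z = V' z"
  shows "D v V z = D v V' z"
  using dird_cong[OF open_W assms] assms by (simp add: cov_def)

lemma cov_add:
  "smooth_on W V \<Longrightarrow> smooth_on W V' \<Longrightarrow> z \<in> W \<Longrightarrow> D v (\<lambda>z. V z + V' z) z = D v V z + D v V' z"
  by (simp add: cov_def dird_add smooth_on_differentiable matvec.add_right)

lemma cov_scaleR:
  assumes "smooth_on W f" "smooth_on W V" "z \<in> W"
  shows "D v (\<lambda>z. f z *\<^sub>R V z) z = f z *\<^sub>R D v V z + dird v f z *\<^sub>R V z"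
  using assms
  by (simp add: cov_def dird_bilinear[OF bounded_bilinear_scaleR] smooth_on_differentiable
      matvec.scaleR_right scaleR_add_right)

text \<open>By \<open>dG\<close>, differentiating the metric along \<open>x\<close> supplies exactly
  the two connection terms that complete the partial derivatives of \<open>V\<close> and
  \<open>V'\<close>.\<close>

lemma dird_inn:
  assumes V: "smooth_on W V" "smooth_on W V'" and "z \<in> W"
  shows "dird v (\<lambda>z. inn (x z) (V z) (V' z)) z = inn (x z) (D v V z) (V' z) + inn (x z) (V z) (D v V' z)"
proof -
  note diff = smooth_on_differentiable[OF _ \<open>z \<in> W\<close>]
  have G: "(\<lambda>z. G (x z)) differentiable at z"
    by (intro diff smooth_along smooth_G)
  have "dird v (\<lambda>z. inn (x z) (V z) (V' z)) z =
      V z \<bullet> (G (x z) *v dird v V' z + dird v (\<lambda>z. G (x z)) z *v V' z) + dird v V z \<bullet> (G (x z) *v V' z)"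
    unfolding inn_def
    using diff[OF V(1)] diff[OF V(2)] G
    by (simp add: dird_bilinear[OF bounded_bilinear_inner] dird_bilinear[OF bounded_bilinear_matrix_vector_mult]
        differentiable_bilinear[OF bounded_bilinear_matrix_vector_mult])
  then show ?thesis
    by (simp add: dird_G_along[OF \<open>z \<in> W\<close>] cov_def inn_def algebra_simps
        del: transpose_matrix_vector flip: matrix_vector_mul_assoc)
      (simp add: inner_transpose_mult del: transpose_matrix_vector)
qed

lemma cov_J:
  assumes V: "smooth_on W V" and "z \<in> W"
  shows "D v (\<lambda>z. J (x z) *v V z) z = J (x z) *v D v V z"
proof -
  have "(\<lambda>z. J (x z)) differentiable at z"
    by (intro smooth_on_differentiable[OF _ \<open>z \<in> W\<close>] smooth_along smooth_J)
  then show ?thesis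
    using smooth_on_differentiable[OF V \<open>z \<in> W\<close>]
    by (simp add: cov_def dird_bilinear[OF bounded_bilinear_matrix_vector_mult] dird_J_along[OF \<open>z \<in> W\<close>]
        matvec.add_right matvec.add_left matvec.diff_left matrix_vector_mul_assoc)
qed

text \<open>The symmetry lemma of the calculus of variations: second partial derivatives commute,
  and the connection is torsion-free.\<close>

lemma cov_dird_commute: "z \<in> W \<Longrightarrow> D v (dird w x) z = D w (dird v x) z"
  by (simp add: cov_def dird_commute[OF open_W smooth_x, of z v w]
      conn_commute[OF x_in, of z "dird v x z" "dird w x z"])

lemma dird_conn:
  assumes X: "smooth_on W X" and "z \<in> W"
  shows "dird v (\<lambda>z. conn (x z) (X z)) z =
    (\<Sum>k\<in>UNIV. \<Sum>i\<in>UNIV. (dird v x z $ k * X z $ i) *\<^sub>R dird (axis k 1) (\<Gamma> i) (x z)) + conn (x z) (dird v X z)"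
proof -
  note diff = smooth_on_differentiable[OF _ \<open>z \<in> W\<close>]
  have 1: "(\<lambda>z. \<Gamma> i (x z)) differentiable at z" for i
    by (intro diff smooth_along smooth_Gamma)
  have 2: "(\<lambda>z. X z $ i) differentiable at z" for i
    by (intro diff smooth_on_nth open_W X)
  have "dird v (\<lambda>z. conn (x z) (X z)) z =
      (\<Sum>i\<in>UNIV. (X z $ i) *\<^sub>R dird v (\<lambda>z. \<Gamma> i (x z)) z) + (\<Sum>i\<in>UNIV. (dird v X z $ i) *\<^sub>R \<Gamma> i (x z))"
    unfolding conn_def
    using 1 2 diff[OF X]
    by (simp add: dird_sum differentiable_bilinear[OF bounded_bilinear_scaleR]
        dird_bilinear[OF bounded_bilinear_scaleR] dird_bounded_linear[OF bounded_linear_vec_nth] sum.distrib)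
  also have "(\<Sum>i\<in>UNIV. (X z $ i) *\<^sub>R dird v (\<lambda>z. \<Gamma> i (x z)) z) =
      (\<Sum>k\<in>UNIV. \<Sum>i\<in>UNIV. (dird v x z $ k * X z $ i) *\<^sub>R dird (axis k 1) (\<Gamma> i) (x z))"
    by (subst sum.swap)
      (simp add: dird_along[OF smooth_Gamma \<open>z \<in> W\<close>] scaleR_sum_right mult.commute)
  finally show ?thesis by (simp add: conn_def)
qed

text \<open>In the expansion of the two iterated derivatives everything symmetric in
  \<open>v\<close> and \<open>w\<close> cancels; the remainder is \<open>Riem_alt\<close>. The
  second derivatives of \<open>x\<close> inside the connection matrices cancel too.\<close>

lemma Ricci_identity:
  assumes V: "smooth_on W V" and "z \<in> W"
  shows "D v (D w V) z - D w (D v V) z = Riem (x z) (dird v x z) (dird w x z) *v V z"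
proof -
  have second: "D v (D w V) z = dird v (dird w V) z
      + dird v (\<lambda>z. conn (x z) (dird w x z)) z *v V z + conn (x z) (dird w x z) *v dird v V z
      + conn (x z) (dird v x z) *v dird w V z
      + (conn (x z) (dird v x z) ** conn (x z) (dird w x z)) *v V z" for v w
  proof -
    have "(\<lambda>z. conn (x z) (dird w x z)) differentiable at z"
      by (intro smooth_on_differentiable[OF _ \<open>z \<in> W\<close>] smooth_conn smooth_on_dird smooth_x)
    moreover have "dird w V differentiable at z" "V differentiable at z"
      using V \<open>z \<in> W\<close> by (auto intro: smooth_on_differentiable smooth_on_dird)
    ultimately have "dird v (D w V) z = dird v (dird w V) z
      + (conn (x z) (dird w x z) *v dird v V z + dird v (\<lambda>z. conn (x z) (dird w x z)) z *v V z)"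
      unfolding cov_def[abs_def]
      by (simp add: dird_add differentiable_bilinear[OF bounded_bilinear_matrix_vector_mult]
          dird_bilinear[OF bounded_bilinear_matrix_vector_mult])
    then show ?thesis
      by (subst cov_def) (simp add: cov_def[of x w] matvec.add_right matrix_vector_mul_assoc)
  qed
  show ?thesis
    unfolding second dird_conn[OF smooth_on_dird[OF smooth_x] \<open>z \<in> W\<close>] Riem_alt
    by (simp add: dird_commute[OF open_W V \<open>z \<in> W\<close>, of v w] dird_commute[OF open_W smooth_x \<open>z \<in> W\<close>, of v w]
        matvec.add_left matvec.diff_left)
qed

text \<open>Local symmetry in matrix form. The commutator with the connection matrix remains because
  the operator has not yet been applied to a vector.\<close>

lemma dird_Riem:
  assumes X: "smooth_on W X" and Y: "smooth_on W Y" and "z \<in> W"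
  shows "dird v (\<lambda>z. Riem (x z) (X z) (Y z)) z =
    Riem (x z) (D v X z) (Y z) + Riem (x z) (X z) (D v Y z)
    + Riem (x z) (X z) (Y z) ** conn (x z) (dird v x z) - conn (x z) (dird v x z) ** Riem (x z) (X z) (Y z)"
proof -
  let ?a = "dird v x z" and ?R = "\<lambda>i j. curv \<Gamma> i j (x z)" and ?C = "conn (x z) (dird v x z)"
  note diff = smooth_on_differentiable[OF _ \<open>z \<in> W\<close>]
  have 1: "(\<lambda>z. curv \<Gamma> i j (x z)) differentiable at z" for i j
    by (intro diff smooth_along smooth_curv)
  have 2: "(\<lambda>z. X z $ i) differentiable at z" "(\<lambda>z. Y z $ i) differentiable at z" for i
    by (intro diff smooth_on_nth open_W X Y)+
  \<comment> \<open>\<open>dR\<close> contracted with the derivative of \<open>x\<close>: the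
    symbols \<open>\<Gamma> k\<close> add up to the connection matrix \<open>?C\<close>.\<close>
  have curv': "dird v (\<lambda>z. curv \<Gamma> i j (x z)) z = ?R i j ** ?C - ?C ** ?R i j
      + (\<Sum>b\<in>UNIV. (?C $ b $ i) *\<^sub>R ?R b j) + (\<Sum>b\<in>UNIV. (?C $ b $ j) *\<^sub>R ?R i b)" for i j
  proof -
    have "(\<Sum>k\<in>UNIV. ?a $ k *\<^sub>R (\<Sum>b\<in>UNIV. (\<Gamma> k (x z) $ b $ i) *\<^sub>R M b)) = (\<Sum>b\<in>UNIV. (?C $ b $ i) *\<^sub>R M b)"
      for i and M :: "'n \<Rightarrow> real ^ 'n ^ 'n"
      unfolding conn_def scaleR_sum_right sum_component vector_scaleR_component
      by (subst sum.swap) (simp add: scaleR_sum_left)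
    then show ?thesis
      by (simp add: dird_along[OF smooth_curv \<open>z \<in> W\<close>] dR[OF x_in[OF \<open>z \<in> W\<close>]] scaleR_add_right
          scaleR_diff_right sum.distrib sum_subtractf)
        (simp add: conn_def matmul.sum_left matmul.sum_right matmul.scaleR_left matmul.scaleR_right)
  qed
  have "dird v (\<lambda>z. Riem (x z) (X z) (Y z)) z = (\<Sum>i\<in>UNIV. \<Sum>j\<in>UNIV.
      (X z $ i * Y z $ j) *\<^sub>R dird v (\<lambda>z. curv \<Gamma> i j (x z)) z
      + (X z $ i * dird v Y z $ j + dird v X z $ i * Y z $ j) *\<^sub>R ?R i j)"
    unfolding Riem_def
    using 1 2 diff[OF X] diff[OF Y]
    by (simp add: dird_sum differentiable_bilinear[OF bounded_bilinear_scaleR]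
        differentiable_bilinear[OF bounded_bilinear_mult] differentiable_sum
        dird_bilinear[OF bounded_bilinear_scaleR] dird_bilinear[OF bounded_bilinear_mult]
        dird_bounded_linear[OF bounded_linear_vec_nth])
  also have "\<dots> = (\<Sum>i\<in>UNIV. \<Sum>j\<in>UNIV. (X z $ i * Y z $ j) *\<^sub>R dird v (\<lambda>z. curv \<Gamma> i j (x z)) z)
      + Riem (x z) (X z) (dird v Y z) + Riem (x z) (dird v X z) (Y z)"
    by (simp add: Riem_def sum.distrib scaleR_add_left)
  also have "(\<Sum>i\<in>UNIV. \<Sum>j\<in>UNIV. (X z $ i * Y z $ j) *\<^sub>R dird v (\<lambda>z. curv \<Gamma> i j (x z)) z) =
      Riem (x z) (X z) (Y z) ** ?C - ?C ** Riem (x z) (X z) (Y z)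
      + Riem (x z) (?C *v X z) (Y z) + Riem (x z) (X z) (?C *v Y z)"
  \<comment> \<open>The two index corrections in \<open>dR\<close> provide the connection parts of
    \<open>D v X\<close> and \<open>D v Y\<close>.\<close>
  proof -
    have a: "(\<Sum>i\<in>UNIV. \<Sum>j\<in>UNIV. (X z $ i * Y z $ j) *\<^sub>R (\<Sum>b\<in>UNIV. (?C $ b $ i) *\<^sub>R ?R b j)) =
        Riem (x z) (?C *v X z) (Y z)"
    proof -
      have "(\<Sum>i\<in>UNIV. \<Sum>j\<in>UNIV. (X z $ i * Y z $ j) *\<^sub>R (\<Sum>b\<in>UNIV. (?C $ b $ i) *\<^sub>R ?R b j)) =
        (\<Sum>i\<in>UNIV. \<Sum>b\<in>UNIV. \<Sum>j\<in>UNIV. (?C $ b $ i * X z $ i * Y z $ j) *\<^sub>R ?R b j)"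
        unfolding scaleR_sum_right by (subst (2) sum.swap) (simp add: mult_ac)
      also have "\<dots> = (\<Sum>b\<in>UNIV. \<Sum>j\<in>UNIV. \<Sum>i\<in>UNIV. (?C $ b $ i * X z $ i * Y z $ j) *\<^sub>R ?R b j)"
        by (subst sum.swap) (rule sum.cong[OF refl], rule sum.swap)
      finally show ?thesis
        by (simp add: Riem_def matrix_vector_mult_def sum_distrib_right scaleR_sum_left)
    qed
    have b: "(\<Sum>i\<in>UNIV. \<Sum>j\<in>UNIV. (X z $ i * Y z $ j) *\<^sub>R (\<Sum>b\<in>UNIV. (?C $ b $ j) *\<^sub>R ?R i b)) =
        Riem (x z) (X z) (?C *v Y z)"
    proof -
      have "(\<Sum>i\<in>UNIV. \<Sum>j\<in>UNIV. (X z $ i * Y z $ j) *\<^sub>R (\<Sum>b\<in>UNIV. (?C $ b $ j) *\<^sub>R ?R i b)) =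
        (\<Sum>i\<in>UNIV. \<Sum>b\<in>UNIV. \<Sum>j\<in>UNIV. (X z $ i * (?C $ b $ j * Y z $ j)) *\<^sub>R ?R i b)"
        unfolding scaleR_sum_right by (subst (2) sum.swap) (simp add: mult_ac)
      then show ?thesis
        by (simp add: Riem_def matrix_vector_mult_def sum_distrib_left scaleR_sum_left)
    qed
    show ?thesis
      unfolding curv' scaleR_add_right scaleR_diff_right sum.distrib sum_subtractf a b
      by (simp add: Riem_def matmul.sum_left matmul.sum_right matmul.scaleR_left matmul.scaleR_right)
  qed
  finally show ?thesis by (simp add: cov_def Riem_add)
qed

text \<open>The product rule has no fourth term, since the curvature tensor is parallel; the
  commutator in \<open>dird_Riem\<close> is absorbed by the connection terms of the output and of
  \<open>V\<close>.\<close>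

lemma cov_Riem:
  assumes X: "smooth_on W X" and Y: "smooth_on W Y" and V: "smooth_on W V" and "z \<in> W"
  shows "D v (\<lambda>z. Riem (x z) (X z) (Y z) *v V z) z =
    Riem (x z) (D v X z) (Y z) *v V z + Riem (x z) (X z) (D v Y z) *v V z + Riem (x z) (X z) (Y z) *v D v V z"
proof -
  have "(\<lambda>z. Riem (x z) (X z) (Y z)) differentiable at z"
    unfolding Riem_def
    by (intro smooth_on_differentiable[OF _ \<open>z \<in> W\<close>] smooth_on_sum smooth_on_scaleR
      smooth_on_mult smooth_on_nth smooth_along smooth_curv open_W X Y)
  then have "dird v (\<lambda>z. Riem (x z) (X z) (Y z) *v V z) z =
      Riem (x z) (X z) (Y z) *v dird v V z + dird v (\<lambda>z. Riem (x z) (X z) (Y z)) z *v V z"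
    using smooth_on_differentiable[OF V \<open>z \<in> W\<close>]
    by (simp add: dird_bilinear[OF bounded_bilinear_matrix_vector_mult])
  then show ?thesis
    by (simp add: cov_def[of x v "\<lambda>z. Riem (x z) (X z) (Y z) *v V z"] cov_def[of x v V]
        dird_Riem[OF X Y \<open>z \<in> W\<close>] matvec.add_left matvec.diff_left matvec.add_right matrix_vector_mul_assoc)
qed

end

section \<open>Skewness of the curvature and its commutation with the complex structure\<close>

context symmetric_kaehler_chart
begin

text \<open>Transfers covariant derivatives taken in hypersurface coordinates to a variation of the
  curve.\<close>

lemma cov_pullback:
  assumes "\<phi> differentiable at s" "x differentiable at (\<phi> s)" "V differentiable at (\<phi> s)"
  shows "cov (\<lambda>s. x (\<phi> s)) v (\<lambda>s. V (\<phi> s)) s = cov x (dird v \<phi> s) V (\<phi> s)"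
  using assms by (simp add: cov_def dird_compose)

text \<open>Both follow from the Ricci identity along the identity map of the chart: the first
  because second derivatives of the function \<open>inn z Z Z\<close> commute, the second because
  \<open>J\<close> passes through both covariant derivatives.\<close>

lemma
  assumes "\<xi> \<in> \<Omega>"
  shows inn_Riem_self: "inn \<xi> (Riem \<xi> X Y *v Z) Z = 0"
    and Riem_J: "Riem \<xi> X Y *v (J \<xi> *v Z) = J \<xi> *v (Riem \<xi> X Y *v Z)"
proof -
  interpret id: map_into_chart \<Omega> G J \<Gamma> \<Omega> "\<lambda>z. z"
    by unfold_locales (auto simp: open_dom smooth_on_ident)
  \<comment> \<open>Constant in components but in general not parallel; only its value at
    \<open>\<xi>\<close> matters for the curvature.\<close>
  let ?V = "\<lambda>z::real ^ 'n. Z"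
  have V: "smooth_on \<Omega> ?V" by (rule smooth_on_const)
  have second: "dird v (dird w (\<lambda>z. inn z Z Z)) \<xi> =
      2 * (inn \<xi> (id.D v (id.D w ?V) \<xi>) Z + inn \<xi> (id.D w ?V \<xi>) (id.D v ?V \<xi>))" for v w
  proof -
    have "dird w (\<lambda>z. inn z Z Z) z = 2 * inn z (id.D w ?V z) Z" if "z \<in> \<Omega>" for z
      using id.dird_inn[OF V V that, of w] inn_commute[OF that] by simp
    then have "dird v (dird w (\<lambda>z. inn z Z Z)) \<xi> = dird v (\<lambda>z. 2 * inn z (id.D w ?V z) Z) \<xi>"
      by (rule dird_cong[OF open_dom \<open>\<xi> \<in> \<Omega>\<close>])
    also have "\<dots> = 2 * dird v (\<lambda>z. inn z (id.D w ?V z) Z) \<xi>"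
      by (rule dird_bounded_linear[OF bounded_linear_mult_right])
        (intro smooth_on_differentiable[OF _ \<open>\<xi> \<in> \<Omega>\<close>] id.smooth_inn id.smooth_cov V)
    also have "\<dots> = 2 * (inn \<xi> (id.D v (id.D w ?V) \<xi>) Z + inn \<xi> (id.D w ?V \<xi>) (id.D v ?V \<xi>))"
      using id.dird_inn[OF id.smooth_cov[OF V] V \<open>\<xi> \<in> \<Omega>\<close>, of v w] by simp
    finally show ?thesis .
  qed
  have "dird X (dird Y (\<lambda>z. inn z Z Z)) \<xi> = dird Y (dird X (\<lambda>z. inn z Z Z)) \<xi>"
    by (intro dird_commute[OF open_dom _ \<open>\<xi> \<in> \<Omega>\<close>] id.smooth_inn V)
  then have "inn \<xi> (id.D X (id.D Y ?V) \<xi> - id.D Y (id.D X ?V) \<xi>) Z = 0"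
    unfolding second using inn_commute[OF \<open>\<xi> \<in> \<Omega>\<close>, of "id.D X ?V \<xi>"] by simp
  then show "inn \<xi> (Riem \<xi> X Y *v Z) Z = 0"
    unfolding id.Ricci_identity[OF V \<open>\<xi> \<in> \<Omega>\<close>] by simp
  have JV: "id.D v (id.D w (\<lambda>z. J z *v Z)) \<xi> = J \<xi> *v id.D v (id.D w ?V) \<xi>" for v w
  proof -
    have "id.D v (id.D w (\<lambda>z. J z *v Z)) \<xi> = id.D v (\<lambda>z. J z *v id.D w ?V z) \<xi>"
      by (rule id.cov_cong[OF \<open>\<xi> \<in> \<Omega>\<close> id.cov_J[OF V]])
    also have "\<dots> = J \<xi> *v id.D v (id.D w ?V) \<xi>"
      by (rule id.cov_J[OF id.smooth_cov[OF V] \<open>\<xi> \<in> \<Omega>\<close>])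
    finally show ?thesis .
  qed
  show "Riem \<xi> X Y *v (J \<xi> *v Z) = J \<xi> *v (Riem \<xi> X Y *v Z)"
    using id.Ricci_identity[OF id.smooth_J_mult[OF V] \<open>\<xi> \<in> \<Omega>\<close>, of X Y]
      id.Ricci_identity[OF V \<open>\<xi> \<in> \<Omega>\<close>, of X Y]
    by (simp add: JV flip: matvec.diff_right)
qed

lemma inn_Riem_skew:
  assumes "\<xi> \<in> \<Omega>"
  shows "inn \<xi> (Riem \<xi> X Y *v Z) Z' = - inn \<xi> (Riem \<xi> X Y *v Z') Z"
  using inn_Riem_self[OF assms, of X Y "Z + Z'"] inn_Riem_self[OF assms, of X Y Z]
    inn_Riem_self[OF assms, of X Y Z'] by (simp add: matvec.add_right)

end

section \<open>The first variation and the structure of unit cotangent geodesics\<close>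

context symmetric_kaehler_chart
begin

lemma Riem_zero [simp]: "Riem \<xi> X 0 = 0" "Riem \<xi> 0 X = 0"
  by (simp_all add: Riem_def)

end

section \<open>The first variation of the energy\<close>

context map_into_chart
begin

text \<open>The metric of the cotangent bundle evaluated on the \<open>v\<close>- and
  \<open>w\<close>-derivatives of the point with base \<open>x\<close> and dual vector
  \<open>u\<close>. The polarized form is needed because the momentum pairs a velocity with a
  variation.\<close>

definition lagrangian :: "real \<Rightarrow> ('e \<Rightarrow> real ^ 'n) \<Rightarrow> 'e \<Rightarrow> 'e \<Rightarrow> 'e \<Rightarrow> real" where
  "lagrangian \<delta> u v w z = inn (x z) (dird v x z) (dird w x z) + inn (x z) (D v u z) (D w u z)
     + \<delta>\<^sup>2 * (inn (x z) (D v u z) (J (x z) *v u z) * inn (x z) (D w u z) (J (x z) *v u z))"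

lemma smooth_lagrangian: "smooth_on W u \<Longrightarrow> smooth_on W (lagrangian \<delta> u v w)"
  unfolding lagrangian_def[abs_def]
  by (intro smooth_on_add smooth_on_mult smooth_on_const smooth_inn smooth_on_dird smooth_cov
      smooth_J_mult smooth_x open_W)

text \<open>The Euler-Lagrange expression, with \<open>v\<close> as time and \<open>w\<close> as
  variation. The mixed derivatives of \<open>x\<close> cancel by \<open>cov_dird_commute\<close>,
  those of \<open>u\<close> up to curvature. The last line is the antisymmetrized derivative of the
  form \<open>H\<close>; its factor 2 arises because \<open>J\<close> is skew.\<close>

lemma first_variation:
  fixes \<delta> :: real and v w :: 'e
  assumes u: "smooth_on W u" and "z \<in> W"
  defines "F \<equiv> \<lambda>z. inn (x z) (D v u z) (J (x z) *v u z)"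
  shows "dird v (lagrangian \<delta> u v w) z - (1 / 2) * dird w (lagrangian \<delta> u v v) z =
    inn (x z) (D v (dird v x) z) (dird w x z) + inn (x z) (D v (D v u) z) (D w u z)
    + inn (x z) (D v u z) (Riem (x z) (dird v x z) (dird w x z) *v u z)
    + \<delta>\<^sup>2 * (dird v F z * inn (x z) (D w u z) (J (x z) *v u z)
        + F z * (inn (x z) (Riem (x z) (dird v x z) (dird w x z) *v u z) (J (x z) *v u z)
            + 2 * inn (x z) (D w u z) (J (x z) *v D v u z)))"
proof -
  define H where "H = (\<lambda>w z. inn (x z) (D w u z) (J (x z) *v u z))"
  have FH: "F = H v" by (simp add: F_def H_def)
  note x' = smooth_on_dird[OF smooth_x] and u' = smooth_cov[OF u] and Ju = smooth_J_mult[OF u]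
  have sH: "smooth_on W (H w)" for w
    unfolding H_def by (intro smooth_inn u' Ju)
  have L: "lagrangian \<delta> u a b = (\<lambda>z. inn (x z) (dird a x z) (dird b x z) + inn (x z) (D a u z) (D b u z)
      + \<delta>\<^sup>2 * (H a z * H b z))" for a b
    by (simp add: lagrangian_def[abs_def] H_def)
  have dL: "dird c (lagrangian \<delta> u a b) z =
      inn (x z) (D c (dird a x) z) (dird b x z) + inn (x z) (dird a x z) (D c (dird b x) z)
      + (inn (x z) (D c (D a u) z) (D b u z) + inn (x z) (D a u z) (D c (D b u) z))
      + \<delta>\<^sup>2 * (H a z * dird c (H b) z + dird c (H a) z * H b z)" for a b c
  proof -
    have "(\<lambda>z. inn (x z) (dird a x z) (dird b x z)) differentiable at z"
      "(\<lambda>z. inn (x z) (D a u z) (D b u z)) differentiable at z"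
      "(\<lambda>z. H a z * H b z) differentiable at z" "(\<lambda>z. \<delta>\<^sup>2 * (H a z * H b z)) differentiable at z"
      "H a differentiable at z" "H b differentiable at z"
      by (intro smooth_on_differentiable[OF _ \<open>z \<in> W\<close>] smooth_inn smooth_on_mult smooth_on_const x' u' sH open_W)+
    then show ?thesis
      unfolding L
      by (simp add: dird_add dird_bounded_linear[OF bounded_linear_mult_right]
          dird_bilinear[OF bounded_bilinear_mult] dird_inn[OF x' x' \<open>z \<in> W\<close>] dird_inn[OF u' u' \<open>z \<in> W\<close>])
  qed
  have dH: "dird c (H b) z = inn (x z) (D c (D b u) z) (J (x z) *v u z) + inn (x z) (D b u z) (J (x z) *v D c u z)" for b c
    unfolding H_def by (simp add: dird_inn[OF u' Ju \<open>z \<in> W\<close>] cov_J[OF u \<open>z \<in> W\<close>])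
  have R: "D v (D w u) z = D w (D v u) z + Riem (x z) (dird v x z) (dird w x z) *v u z"
    using Ricci_identity[OF u \<open>z \<in> W\<close>, of v w] by (simp add: algebra_simps)
  note comm = inn_commute[OF x_in[OF \<open>z \<in> W\<close>]]
  \<comment> \<open>Makes the two \<open>J\<close>-terms of
    \<open>dird v (H w) - dird w (H v)\<close> add up instead of cancelling.\<close>
  have 1: "inn (x z) (D v u z) (J (x z) *v D w u z) = - inn (x z) (D w u z) (J (x z) *v D v u z)"
    using inn_J_left[OF x_in[OF \<open>z \<in> W\<close>], of "D v u z" "D w u z"] comm[of "J (x z) *v D v u z"] by simp
  show ?thesis
    unfolding FH dL
    using comm[of "D w (dird v x) z" "dird v x z"] comm[of "D w (D v u) z" "D v u z"]
      cov_dird_commute[OF \<open>z \<in> W\<close>, of v w] R 1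
    by (simp add: dH[of w v] dH[of v w]) (simp add: H_def field_simps)
qed

end

text \<open>The assumption \<open>euler_lagrange\<close> is the geodesic equation, tested against the tangent vectors of the unit
  cotangent bundle: \<open>u\<close> is the vector dual to the covector, and \<open>X\<close>, \<open>V\<close> are the horizontal and the vertical
  part of the test vector.\<close>

locale unit_cotangent_geodesic = map_into_chart \<Omega> G J \<Gamma> W x
  for \<Omega> :: "(real ^ 'n::finite) set" and G J \<Gamma> and W :: "real set" and x +
  fixes u :: "real \<Rightarrow> real ^ 'n" and \<delta> :: real and F :: "real \<Rightarrow> real"
  assumes connected_W: "connected W"
    and smooth_u: "smooth_on W u"
    and unit: "z \<in> W \<Longrightarrow> inn (x z) (u z) (u z) = 1"
    and F_eq: "F = (\<lambda>z. inn (x z) (D 1 u z) (J (x z) *v u z))"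
    and euler_lagrange: "z \<in> W \<Longrightarrow> inn (x z) V (u z) = 0 \<Longrightarrow>
      inn (x z) (D 1 (dird 1 x) z) X + inn (x z) (D 1 (D 1 u) z) V
      + inn (x z) (D 1 u z) (Riem (x z) (dird 1 x z) X *v u z)
      + \<delta>\<^sup>2 * (dird 1 F z * inn (x z) V (J (x z) *v u z)
          + F z * (inn (x z) (Riem (x z) (dird 1 x z) X *v u z) (J (x z) *v u z)
              + 2 * inn (x z) V (J (x z) *v D 1 u z))) = 0"
begin

text \<open>This is \<open>- g(S X, Y)\<close>. Keeping the bilinear form avoids constructing the
  operator \<open>S\<close>; equations involving \<open>S\<close> are stated weakly, tested against
  all \<open>Y\<close>.\<close>

definition force :: "real \<Rightarrow> real ^ 'n \<Rightarrow> real ^ 'n \<Rightarrow> real" where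
  "force z X Y = inn (x z) (Riem (x z) X Y *v u z) (D 1 u z + (\<delta>\<^sup>2 * F z) *\<^sub>R (J (x z) *v u z))"

lemma smooth_F: "smooth_on W F"
  unfolding F_eq by (intro smooth_inn smooth_cov smooth_J_mult smooth_u)

text \<open>The skewness of \<open>S\<close>, inherited from that of the curvature in its two plane
  arguments.\<close>

lemma force_self: "force z X X = 0"
proof -
  have "Riem (x z) X X = 0"
    using Riem_skew[of "x z" X X] scaleR_2[of "Riem (x z) X X"] by (simp add: eq_neg_iff_add_eq_0)
  then show ?thesis by (simp add: force_def)
qed

lemma force_linear:
  "force z (X + X') Y = force z X Y + force z X' Y" "force z (c *\<^sub>R X) Y = c * force z X Y"
  by (simp_all add: force_def Riem_add Riem_scaleR matvec.add_left matvec.scaleR_left del: inn_add(2))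

lemma inn_u_cov: "z \<in> W \<Longrightarrow> inn (x z) (u z) (D 1 u z) = 0"
proof -
  assume "z \<in> W"
  have "dird 1 (\<lambda>z. inn (x z) (u z) (u z)) z = dird 1 (\<lambda>z. 1) z"
    using unit by (rule dird_cong[OF open_W \<open>z \<in> W\<close>])
  then show ?thesis
    using dird_inn[OF smooth_u smooth_u \<open>z \<in> W\<close>, of 1] inn_commute[OF x_in[OF \<open>z \<in> W\<close>], of "D 1 u z" "u z"]
    by simp
qed

text \<open>The test vector is \<open>V = Ju\<close>. Its pairing with \<open>Ju'\<close> is that of
  \<open>u\<close> with \<open>u'\<close>, which vanishes, so what remains is
  \<open>(1 + \<delta>\<^sup>2) F' = 0\<close>.\<close>

lemma dird_F:
  assumes "z \<in> W" shows "dird 1 F z = 0"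
proof -
  note \<xi> = x_in[OF \<open>z \<in> W\<close>]
  have F': "dird 1 F z = inn (x z) (D 1 (D 1 u) z) (J (x z) *v u z)"
    unfolding F_eq
    by (simp add: dird_inn[OF smooth_cov[OF smooth_u] smooth_J_mult[OF smooth_u] \<open>z \<in> W\<close>]
        cov_J[OF smooth_u \<open>z \<in> W\<close>] inn_J_self[OF \<xi>])
  have "inn (x z) (D 1 (D 1 u) z) (J (x z) *v u z) + \<delta>\<^sup>2 * dird 1 F z = 0"
    using euler_lagrange[OF \<open>z \<in> W\<close>, of "J (x z) *v u z" 0]
    by (simp add: inn_J_self[OF \<xi>] inn_J[OF \<xi>] unit[OF \<open>z \<in> W\<close>] inn_u_cov[OF \<open>z \<in> W\<close>])
  then have "(1 + \<delta>\<^sup>2) * dird 1 F z = 0"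
    unfolding F' by (simp add: algebra_simps)
  then show ?thesis
    using sum_power2_eq_zero_iff[of 1 \<delta>] by simp
qed

text \<open>Vertical tests show that \<open>q\<close> is orthogonal to everything orthogonal to
  \<open>u\<close>, hence is a multiple of \<open>u\<close>; \<open>l\<close> is the Lagrange
  multiplier of the constraint that \<open>u\<close> is a unit vector.\<close>

lemma cov_cov_u:
  assumes "z \<in> W"
  obtains l where "D 1 (D 1 u) z = l *\<^sub>R u z - (2 * \<delta>\<^sup>2 * F z) *\<^sub>R (J (x z) *v D 1 u z)"
proof -
  note \<xi> = x_in[OF \<open>z \<in> W\<close>]
  define q where "q = D 1 (D 1 u) z + (2 * \<delta>\<^sup>2 * F z) *\<^sub>R (J (x z) *v D 1 u z)"
  have "inn (x z) q V = 0" if "inn (x z) V (u z) = 0" for V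
    using euler_lagrange[OF \<open>z \<in> W\<close> that, of 0] dird_F[OF \<open>z \<in> W\<close>] inn_commute[OF \<xi>, of V]
    by (simp add: q_def)
  note q = this
  have "q = inn (x z) q (u z) *\<^sub>R u z"
  proof (rule inn_eqI[OF \<xi>])
    fix Z
    show "inn (x z) q Z = inn (x z) (inn (x z) q (u z) *\<^sub>R u z) Z"
      using q[of "Z - inn (x z) (u z) Z *\<^sub>R u z"] unit[OF \<open>z \<in> W\<close>] inn_commute[OF \<xi>, of Z "u z"]
      by simp
  qed
  then show ?thesis
    using that[of "inn (x z) q (u z)"] unfolding q_def by (metis add_diff_cancel_right')
qed

text \<open>The curvature operator of \<open>u \<and> (u' + \<delta>\<^sup>2 F Ju)\<close> is parallel: the equation for \<open>u''\<close> turns its derivative into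
  the operator of \<open>u \<and> Ju' - u' \<and> Ju\<close>, which vanishes because the curvature commutes with \<open>J\<close>.\<close>

lemma dird_force:
  assumes X: "smooth_on W X" and Y: "smooth_on W Y" and "z \<in> W"
  shows "dird 1 (\<lambda>z. force z (X z) (Y z)) z = force z (D 1 X z) (Y z) + force z (X z) (D 1 Y z)"
proof -
  note \<xi> = x_in[OF \<open>z \<in> W\<close>]
  let ?R = "Riem (x z) (X z) (Y z)" and ?w = "\<lambda>z. D 1 u z + (\<delta>\<^sup>2 * F z) *\<^sub>R (J (x z) *v u z)"
  have F: "smooth_on W (\<lambda>z. \<delta>\<^sup>2 * F z)" and FJ: "smooth_on W (\<lambda>z. (\<delta>\<^sup>2 * F z) *\<^sub>R (J (x z) *v u z))"
    by (intro smooth_on_scaleR smooth_on_mult smooth_on_const smooth_F smooth_J_mult smooth_u open_W)+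
  have w: "smooth_on W ?w"
    by (intro smooth_on_add FJ smooth_cov smooth_u open_W)
  have "dird 1 (\<lambda>z. \<delta>\<^sup>2 * F z) z = 0"
    using dird_F[OF \<open>z \<in> W\<close>] smooth_on_differentiable[OF smooth_F \<open>z \<in> W\<close>]
    by (simp add: dird_bounded_linear[OF bounded_linear_mult_right])
  then have Dw: "D 1 ?w z = D 1 (D 1 u) z + (\<delta>\<^sup>2 * F z) *\<^sub>R (J (x z) *v D 1 u z)"
    by (simp add: cov_add[OF smooth_cov[OF smooth_u] FJ \<open>z \<in> W\<close>]
        cov_scaleR[OF F smooth_J_mult[OF smooth_u] \<open>z \<in> W\<close>] cov_J[OF smooth_u \<open>z \<in> W\<close>])
  obtain l where l: "D 1 (D 1 u) z = l *\<^sub>R u z - (2 * \<delta>\<^sup>2 * F z) *\<^sub>R (J (x z) *v D 1 u z)"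
    by (rule cov_cov_u[OF \<open>z \<in> W\<close>])
  \<comment> \<open>Skewness of the curvature, commutation with \<open>J\<close>, and skewness of
    \<open>J\<close>; the two signs cancel.\<close>
  have "inn (x z) (?R *v u z) (J (x z) *v D 1 u z) = inn (x z) (?R *v D 1 u z) (J (x z) *v u z)"
    using inn_Riem_skew[OF \<xi>, of "X z" "Y z" "u z" "J (x z) *v D 1 u z"]
      inn_J_left[OF \<xi>, of "?R *v D 1 u z" "u z"] by (simp add: Riem_J[OF \<xi>])
  \<comment> \<open>By this equality the terms with \<open>\<delta>\<^sup>2 * F z\<close> have total
    coefficient \<open>1 - 2 + 1\<close>: from \<open>u'\<close> in the first argument, from
    \<open>u''\<close>, and from the derivative of \<open>Ju\<close>. The multiplier
    \<open>l\<close> drops out since \<open>g(R u, u) = 0\<close>.\<close>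
  then have "inn (x z) (?R *v D 1 u z) (?w z) + inn (x z) (?R *v u z) (D 1 ?w z) = 0"
    unfolding Dw l using inn_Riem_self[OF \<xi>] by (simp add: algebra_simps)
  moreover have "dird 1 (\<lambda>z. force z (X z) (Y z)) z =
      inn (x z) (Riem (x z) (D 1 X z) (Y z) *v u z + Riem (x z) (X z) (D 1 Y z) *v u z + ?R *v D 1 u z) (?w z)
      + inn (x z) (?R *v u z) (D 1 ?w z)"
    unfolding force_def
    by (simp only: dird_inn[OF smooth_Riem[OF X Y smooth_u] w \<open>z \<in> W\<close>] cov_Riem[OF X Y smooth_u \<open>z \<in> W\<close>])
  ultimately show ?thesis
    unfolding force_def inn_add(1) by linarith
qed

section \<open>Fields with \<open>V' = S V\<close> along the projected curve\<close>

definition dragged :: "(real \<Rightarrow> real ^ 'n) \<Rightarrow> bool" where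
  "dragged V \<longleftrightarrow> smooth_on W V \<and> (\<forall>z\<in>W. \<forall>Y. inn (x z) (D 1 V z) Y = - force z (V z) Y)"

lemma dragged_velocity: "dragged (dird 1 x)"
  unfolding dragged_def
proof (intro conjI ballI allI)
  fix z Y assume "z \<in> W"
  show "inn (x z) (D 1 (dird 1 x) z) Y = - force z (dird 1 x z) Y"
    using euler_lagrange[OF \<open>z \<in> W\<close>, of 0 Y] inn_commute[OF x_in[OF \<open>z \<in> W\<close>], of "D 1 u z"]
    by (simp add: force_def algebra_simps)
qed (intro smooth_on_dird smooth_x)

lemma dragged_cov:
  assumes "dragged V" shows "dragged (D 1 V)"
  unfolding dragged_def
proof (intro conjI ballI allI)
  have V: "smooth_on W V" and D: "\<And>z Y. z \<in> W \<Longrightarrow> inn (x z) (D 1 V z) Y = - force z (V z) Y"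
    using assms by (auto simp: dragged_def)
  show "smooth_on W (D 1 V)" by (intro smooth_cov V)
  fix z and Y :: "real ^ 'n" assume "z \<in> W"
  \<comment> \<open>\<open>Y\<close> has constant components but need not be parallel; the terms
    with its covariant derivative cancel by the equation for \<open>V\<close> itself.\<close>
  have c: "smooth_on W (\<lambda>z. Y)" by (rule smooth_on_const)
  have force: "smooth_on W (\<lambda>z. force z (V z) Y)"
    unfolding force_def
    by (intro smooth_inn smooth_Riem smooth_on_add smooth_on_scaleR smooth_on_mult smooth_on_const
        smooth_F smooth_J_mult smooth_cov smooth_u V open_W)
  have "dird 1 (\<lambda>z. inn (x z) (D 1 V z) Y) z = dird 1 (\<lambda>z. - force z (V z) Y) z"
    by (rule dird_cong[OF open_W \<open>z \<in> W\<close> D])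
  also have "\<dots> = - dird 1 (\<lambda>z. force z (V z) Y) z"
    by (intro dird_bounded_linear bounded_linear_minus bounded_linear_ident smooth_on_differentiable[OF force \<open>z \<in> W\<close>])
  finally show "inn (x z) (D 1 (D 1 V) z) Y = - force z (D 1 V z) Y"
    unfolding dird_inn[OF smooth_cov[OF V] c \<open>z \<in> W\<close>] dird_force[OF V c \<open>z \<in> W\<close>]
    using D[OF \<open>z \<in> W\<close>, of "D 1 (\<lambda>z. Y) z"] by simp
qed

lemma dragged_cong:
  assumes "dragged V" "\<And>z. z \<in> W \<Longrightarrow> V z = V' z"
  shows "dragged V'"
  using assms cov_cong[of _ V V' 1] smooth_on_cong[OF open_W _ assms(2)]
  by (auto simp: dragged_def)

lemma dragged_add: "dragged V \<Longrightarrow> dragged V' \<Longrightarrow> dragged (\<lambda>z. V z + V' z)"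
  by (auto simp: dragged_def cov_add force_linear intro: smooth_on_add open_W)

lemma dragged_scaleR: "dragged V \<Longrightarrow> dragged (\<lambda>z. c *\<^sub>R V z)"
  by (auto simp: dragged_def cov_scaleR[OF smooth_on_const] force_linear
      intro: smooth_on_scaleR[OF open_W smooth_on_const])

text \<open>The derivative is \<open>- 2 * force z (V z) (V z)\<close>, which is zero, and
  \<open>W\<close> is connected.\<close>

lemma dragged_norm_constant:
  assumes "dragged V"
  shows "(\<lambda>z. inn (x z) (V z) (V z)) constant_on W"
proof (rule has_derivative_zero_connected_constant_on[OF connected_W open_W finite.emptyI])
  have V: "smooth_on W V" and D: "\<And>z Y. z \<in> W \<Longrightarrow> inn (x z) (D 1 V z) Y = - force z (V z) Y"
    using assms by (auto simp: dragged_def)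
  show "continuous_on W (\<lambda>z. inn (x z) (V z) (V z))"
    by (intro smooth_on_continuous smooth_inn V)
  show "\<forall>z\<in>W - {}. ((\<lambda>z. inn (x z) (V z) (V z)) has_derivative (\<lambda>r. 0)) (at z within W)"
  proof
    fix z assume "z \<in> W - {}"
    then have "z \<in> W" by simp
    have "dird 1 (\<lambda>z. inn (x z) (V z) (V z)) z = 0"
      using dird_inn[OF V V \<open>z \<in> W\<close>, of 1] D[OF \<open>z \<in> W\<close>, of "V z"] force_self[of z "V z"]
        inn_commute[OF x_in[OF \<open>z \<in> W\<close>], of "V z" "D 1 V z"] by simp
    moreover have diff: "(\<lambda>z. inn (x z) (V z) (V z)) differentiable at z"
      by (intro smooth_on_differentiable[OF _ \<open>z \<in> W\<close>] smooth_inn V)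
    note d = diff linear_scale[OF linear_dird[OF diff], of _ 1]
    ultimately have "((\<lambda>z. inn (x z) (V z) (V z)) has_derivative (\<lambda>r. 0)) (at z)"
      using has_derivative_dird[OF d(1)] d(2) by simp
    then show "((\<lambda>z. inn (x z) (V z) (V z)) has_derivative (\<lambda>r. 0)) (at z within W)"
      by (rule has_derivative_at_withinI)
  qed
qed

text \<open>The field \<open>k i *\<^sub>R N (Suc i)\<close> is dragged and has length
  \<open>k i\<close>, so \<open>k i\<close> is constant; for \<open>i < r\<close> it is positive and
  can be divided out. The factor \<open>c\<close> allows a parameter proportional to arc
  length.\<close>

lemma frenet_curvatures_constant:
  fixes N :: "nat \<Rightarrow> real \<Rightarrow> real ^ 'n" and k :: "nat \<Rightarrow> real \<Rightarrow> real"
  assumes N1: "\<And>z. z \<in> W \<Longrightarrow> N 1 z = c *\<^sub>R dird 1 x z"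
    and k_pos: "\<And>i z. z \<in> W \<Longrightarrow> 1 \<le> i \<Longrightarrow> i < r \<Longrightarrow> k i z > 0"
    and k_nonneg: "\<And>z. z \<in> W \<Longrightarrow> k r z \<ge> 0"
    and N_unit: "\<And>i z. z \<in> W \<Longrightarrow> 1 \<le> i \<Longrightarrow> i \<le> r \<Longrightarrow> inn (x z) (N i z) (N i z) = 1"
    and N_last: "\<And>z. z \<in> W \<Longrightarrow> k r z \<noteq> 0 \<Longrightarrow> inn (x z) (N (Suc r) z) (N (Suc r) z) = 1"
    and frenet_1: "\<And>z. z \<in> W \<Longrightarrow> D 1 (N 1) z = k 1 z *\<^sub>R N 2 z"
    and frenet: "\<And>i z. z \<in> W \<Longrightarrow> 2 \<le> i \<Longrightarrow> i \<le> r \<Longrightarrow>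
      D 1 (N i) z = - k (i - 1) z *\<^sub>R N (i - 1) z + k i z *\<^sub>R N (Suc i) z"
    and "1 \<le> i" "i \<le> r"
  shows "dragged (N i) \<and> k i constant_on W"
  using \<open>1 \<le> i\<close> \<open>i \<le> r\<close>
proof (induction i rule: less_induct)
  case (less i)
  have step: "k j constant_on W \<and> (j < r \<longrightarrow> dragged (N (Suc j)))"
    if "1 \<le> j" "j \<le> r" and Z: "dragged Z" "\<And>z. z \<in> W \<Longrightarrow> Z z = k j z *\<^sub>R N (Suc j) z" for j Z
  proof -
    have nonneg: "k j z \<ge> 0" if "z \<in> W" for z
      using k_pos[OF that \<open>1 \<le> j\<close>] k_nonneg[OF that] \<open>j \<le> r\<close> by (cases "j = r") auto
    obtain a where a: "\<And>z. z \<in> W \<Longrightarrow> inn (x z) (Z z) (Z z) = a"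
      using dragged_norm_constant[OF Z(1)] by (auto simp: constant_on_def)
    have "(k j z)\<^sup>2 = a" if "z \<in> W" for z
    \<comment> \<open>Where the last curvature vanishes, the next frame vector is unconstrained, but
      there \<open>Z z = 0\<close> and hence \<open>a = 0\<close>.\<close>
    proof (cases "k j z = 0")
      case False
      then have "inn (x z) (N (Suc j) z) (N (Suc j) z) = 1"
        using N_unit[OF that, of "Suc j"] N_last[OF that] \<open>j \<le> r\<close> by (cases "j = r") auto
      with a[OF that] Z(2)[OF that] show ?thesis by (simp add: power2_eq_square)
    qed (use a[OF that] Z(2)[OF that] in simp)
    then have k: "k j z = sqrt a" if "z \<in> W" for z
      using nonneg[OF that] that by (metis real_sqrt_unique)
    moreover have "dragged (N (Suc j))" if "j < r"
    proof (rule dragged_cong[OF dragged_scaleR[OF Z(1), of "1 / sqrt a"]])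
      fix z assume "z \<in> W"
      then show "(1 / sqrt a) *\<^sub>R Z z = N (Suc j) z"
        using k_pos[OF \<open>z \<in> W\<close> \<open>1 \<le> j\<close> that] Z(2) k by simp
    qed
    ultimately show ?thesis by (auto simp: constant_on_def)
  qed
  have N: "dragged (N i)" and Z: "\<exists>Z. dragged Z \<and> (\<forall>z\<in>W. Z z = k i z *\<^sub>R N (Suc i) z)"
  proof -
    have start: "dragged (N 1)"
      by (rule dragged_cong[OF dragged_scaleR[OF dragged_velocity, of c]]) (rule N1[symmetric])
    have next_Z: "\<exists>Z. dragged Z \<and> (\<forall>z\<in>W. Z z = k j z *\<^sub>R N (Suc j) z)"
      if "1 \<le> j" "j \<le> r" "dragged (N j)" "2 \<le> j \<Longrightarrow> dragged (N (j - 1)) \<and> k (j - 1) constant_on W" for j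
    proof (cases "j = 1")
      case True
      with dragged_cov[OF that(3)] frenet_1 show ?thesis
        by (intro exI[of _ "D 1 (N j)"]) (auto simp: numeral_2_eq_2)
    next
      case False
      with that obtain a where a: "dragged (N (j - 1))" "\<And>z. z \<in> W \<Longrightarrow> k (j - 1) z = a"
        by (auto simp: constant_on_def)
      \<comment> \<open>By the Frenet formula \<open>Z\<close> is the derivative of
        \<open>N j\<close> plus \<open>k (j - 1)\<close> times \<open>N (j - 1)\<close>. That
        coefficient is already known to be constant, and only constant multiples are known to stay
        dragged.\<close>
      show ?thesis
        using dragged_add[OF dragged_cov[OF that(3)] dragged_scaleR[OF a(1), of a]] frenet[of _ j] that False a(2)
        by (intro exI[of _ "\<lambda>z. D 1 (N j) z + a *\<^sub>R N (j - 1) z"]) auto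
    qed
    show "dragged (N i)"
    proof (cases "i = 1")
      case False
      define j where "j = i - 1"
      have j: "i = Suc j" "1 \<le> j" "j < r" using less.prems False by (auto simp: j_def)
      have "\<exists>Z. dragged Z \<and> (\<forall>z\<in>W. Z z = k j z *\<^sub>R N (Suc j) z)"
        using j less.IH[of j] less.IH[of "j - 1"] by (intro next_Z) auto
      then show ?thesis using step[of j] j by auto
    qed (use start in simp)
    then show "\<exists>Z. dragged Z \<and> (\<forall>z\<in>W. Z z = k i z *\<^sub>R N (Suc i) z)"
      using less.prems less.IH[of "i - 1"] by (intro next_Z) auto
  qed
  with step[OF less.prems] show ?case by blast
qed

end

section \<open>Christoffel symbols and geodesics in a chart\<close>

lemma pd_eq_dird: "pd b i f x = dird (axis i 1) (\<lambda>\<eta>. f (cinv b \<eta>)) (cmap b x)"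
  by (simp add: pd_def dird_def o_def)

lemma dird_nth: "f differentiable at x \<Longrightarrow> dird v (\<lambda>x. f x $ i) x = dird v f x $ i"
  by (rule dird_bounded_linear[OF bounded_linear_vec_nth])

lemma dird_entry: "f differentiable at x \<Longrightarrow> dird v (\<lambda>x. f x $ i $ j) x = dird v f x $ i $ j"
  by (simp add: dird_nth differentiable_bounded_linear[OF bounded_linear_vec_nth])

lemma positive_definite_invertible:
  fixes M :: "real ^ 'n::finite ^ 'n"
  assumes "\<And>v. v \<noteq> 0 \<Longrightarrow> v \<bullet> (M *v v) > 0"
  shows "invertible M"
proof -
  have "v = 0" if "M *v v = 0" for v
    using assms[of v] that by auto
  then show ?thesis
    unfolding invertible_left_inverse matrix_left_invertible_ker by blast
qed

text \<open>Lowering the upper index removes the inverse matrix and leaves the Christoffel symbols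
  of the first kind.\<close>

lemma christoffel_lower:
  assumes "invertible (G b x)"
  shows "(\<Sum>h\<in>UNIV. G b x $ k $ h * christoffel G b x h i j) = (1 / 2) *
    (pd b i (\<lambda>y. G b y $ j $ k) x + pd b j (\<lambda>y. G b y $ i $ k) x - pd b k (\<lambda>y. G b y $ i $ j) x)"
proof -
  define E where "E l = pd b i (\<lambda>y. G b y $ j $ l) x + pd b j (\<lambda>y. G b y $ i $ l) x - pd b l (\<lambda>y. G b y $ i $ j) x" for l
  have inv: "(\<Sum>h\<in>UNIV. G b x $ k $ h * matrix_inv (G b x) $ h $ l) = (if k = l then 1 else 0)" for l
    using arg_cong[OF matrix_inv_right[OF assms], of "\<lambda>M. M $ k $ l"]
    by (simp add: matrix_matrix_mult_def mat_def)
  have "(\<Sum>h\<in>UNIV. G b x $ k $ h * christoffel G b x h i j) =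
      (\<Sum>h\<in>UNIV. \<Sum>l\<in>UNIV. (1 / 2) * (G b x $ k $ h * matrix_inv (G b x) $ h $ l * E l))"
    by (simp add: christoffel_def E_def[symmetric] sum_distrib_left mult_ac)
  also have "\<dots> = (1 / 2) * (\<Sum>l\<in>UNIV. (\<Sum>h\<in>UNIV. G b x $ k $ h * matrix_inv (G b x) $ h $ l) * E l)"
    by (subst sum.swap) (simp add: sum_distrib_left sum_distrib_right)
  finally show ?thesis
    by (simp add: inv E_def if_distrib[of "\<lambda>a. a * _"] cong: if_cong)
qed

section \<open>The geodesic equation without Christoffel symbols\<close>

lemma vector_derivative_dird:
  fixes f :: "real \<Rightarrow> 'b::real_normed_vector"
  assumes "open U" "t \<in> U" "g differentiable at t" "\<And>s. s \<in> U \<Longrightarrow> f s = g s"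
  shows "vector_derivative f (at t) = dird 1 g t"
proof -
  have "f differentiable at t"
    using assms unfolding differentiable_def by (metis has_derivative_transform_within_open)
  then have "vector_derivative f (at t) = dird 1 f t"
    by (simp add: dird_def frechet_derivative_eq_vector_derivative)
  also have "\<dots> = dird 1 g t"
    by (rule dird_cong[OF assms(1,2,4)])
  finally show ?thesis .
qed

text \<open>The geodesic equation contracted with the metric is the Euler-Lagrange equation of the
  energy in coordinates. Only the metric and its first derivative occur, which is what makes the
  hypersurface tractable.\<close>

lemma geodesic_first_form:
  fixes H :: "('q, 'k::finite) chart \<Rightarrow> 'q \<Rightarrow> real ^ 'k ^ 'k" and u :: "('q, 'k) chart"
    and c :: "real \<Rightarrow> 'q"
  defines "M \<equiv> \<lambda>\<eta>. H u (cinv u \<eta>)" and "y \<equiv> \<lambda>t. cmap u (c t)"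
  assumes inj: "inj_on (cmap u) (cdom u)" and "open (cmap u ` cdom u)"
    and M: "smooth_on (cmap u ` cdom u) M"
    and U: "open U" "c ` U \<subseteq> cdom u" and y: "smooth_on U y" and "t \<in> U"
    and inv: "invertible (H u (c t))" and sym: "transpose (H u (c t)) = H u (c t)"
    and geo: "cov_deriv H c (velocity c) u t = 0"
  shows "dird 1 (\<lambda>t. dird 1 y t \<bullet> (M (y t) *v e)) t = (1 / 2) * (dird 1 y t \<bullet> (dird e M (y t) *v dird 1 y t))"
proof -
  define a where "a = dird 1 y t"
  define a' where "a' = dird 1 (dird 1 y) t"
  define E where "E i = dird (axis i 1) M (y t)" for i
  let ?Y = "cmap u ` cdom u" and ?M = "H u (c t)"
  have ct: "c t \<in> cdom u" using U \<open>t \<in> U\<close> by blast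
  have Mt: "M (y t) = ?M" using inj ct by (simp add: M_def y_def)
  have dM: "M differentiable at (y t)"
    using ct by (intro smooth_on_differentiable[OF M]) (simp add: y_def)
  have dy: "y differentiable at s" "dird 1 y differentiable at s" if "s \<in> U" for s
    using that by (auto intro: smooth_on_differentiable[OF y] smooth_on_differentiable[OF smooth_on_dird[OF y]])
  have vel: "velocity c u s = dird 1 y s" if "s \<in> U" for s
    unfolding velocity_def using that dy(1) by (intro vector_derivative_dird[OF U(1)]) (simp_all add: y_def)
  have pd: "pd u i (\<lambda>q. H u q $ j $ l) (c t) = E i $ j $ l" for i j l
    unfolding pd_eq_dird E_def using dird_entry[OF dM] by (simp add: M_def y_def)
  have "a' $ h = - (\<Sum>i\<in>UNIV. \<Sum>j\<in>UNIV. christoffel H u (c t) h i j * a $ i * a $ j)" for h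
  proof -
    have "vector_derivative (velocity c u) (at t) = a'"
      unfolding a'_def using vel dy(2)[OF \<open>t \<in> U\<close>] by (intro vector_derivative_dird[OF U(1) \<open>t \<in> U\<close>]) auto
    then show ?thesis
      using geo unfolding cov_deriv_def vec_eq_iff by (simp add: vel[OF \<open>t \<in> U\<close>] a_def eq_neg_iff_add_eq_0)
  qed
  note a' = this
  have lower: "(?M *v a') $ k = - (\<Sum>i\<in>UNIV. \<Sum>j\<in>UNIV. E i $ j $ k * a $ i * a $ j)
      + (1 / 2) * (\<Sum>i\<in>UNIV. \<Sum>j\<in>UNIV. E k $ i $ j * a $ i * a $ j)" for k
  proof -
    have "(?M *v a') $ k = - (\<Sum>h\<in>UNIV. \<Sum>i\<in>UNIV. \<Sum>j\<in>UNIV. ?M $ k $ h * christoffel H u (c t) h i j * (a $ i * a $ j))"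
      by (simp add: matrix_vector_mult_def a' sum_distrib_left sum_negf mult_ac)
    also have "\<dots> = - (\<Sum>i\<in>UNIV. \<Sum>h\<in>UNIV. \<Sum>j\<in>UNIV. ?M $ k $ h * christoffel H u (c t) h i j * (a $ i * a $ j))"
      by (subst sum.swap) (rule refl)
    also have "\<dots> = - (\<Sum>i\<in>UNIV. \<Sum>j\<in>UNIV. \<Sum>h\<in>UNIV. ?M $ k $ h * christoffel H u (c t) h i j * (a $ i * a $ j))"
      by (subst (2) sum.swap) (rule refl)
    also have "\<dots> = - (\<Sum>i\<in>UNIV. \<Sum>j\<in>UNIV. ((1 / 2) * (E i $ j $ k + E j $ i $ k - E k $ i $ j)) * (a $ i * a $ j))"
      unfolding sum_distrib_right[symmetric] christoffel_lower[of H u "c t", OF inv] pd ..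
    also have "\<dots> = - (1 / 2) * (\<Sum>i\<in>UNIV. \<Sum>j\<in>UNIV. E i $ j $ k * a $ i * a $ j)
        - (1 / 2) * (\<Sum>i\<in>UNIV. \<Sum>j\<in>UNIV. E j $ i $ k * a $ i * a $ j)
        + (1 / 2) * (\<Sum>i\<in>UNIV. \<Sum>j\<in>UNIV. E k $ i $ j * a $ i * a $ j)"
    proof -
      have "(1 / 2 * (E i $ j $ k + E j $ i $ k - E k $ i $ j)) * (a $ i * a $ j) =
          (1 / 2) * (E i $ j $ k * a $ i * a $ j) + (1 / 2) * (E j $ i $ k * a $ i * a $ j)
          - (1 / 2) * (E k $ i $ j * a $ i * a $ j)" for i j
        by (simp add: algebra_simps)
      then show ?thesis
        by (simp only: sum.distrib sum_subtractf sum_distrib_left[symmetric])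
    qed
    \<comment> \<open>Contraction with \<open>a $ i * a $ j\<close> symmetrizes, so two of the three
      first-kind terms coincide.\<close>
    also have "(\<Sum>i\<in>UNIV. \<Sum>j\<in>UNIV. E j $ i $ k * a $ i * a $ j) = (\<Sum>i\<in>UNIV. \<Sum>j\<in>UNIV. E i $ j $ k * a $ i * a $ j)"
      by (subst sum.swap) (simp add: mult_ac)
    finally show ?thesis by simp
  qed
  have dMy: "dird 1 (\<lambda>t. M (y t)) t = (\<Sum>i\<in>UNIV. (a $ i) *\<^sub>R E i)" and dMy': "(\<lambda>t. M (y t)) differentiable at t"
    using dird_compose[OF dy(1)[OF \<open>t \<in> U\<close>] dM, of 1] dird_coordinates[OF dM, of "dird 1 y t"]
      differentiable_chain_at[OF dy(1)[OF \<open>t \<in> U\<close>] dM]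
    by (simp_all add: a_def E_def o_def)
  have "dird 1 (\<lambda>t. dird 1 y t \<bullet> (M (y t) *v e)) t = a \<bullet> ((\<Sum>i\<in>UNIV. (a $ i) *\<^sub>R E i) *v e) + a' \<bullet> (?M *v e)"
    using dy(2)[OF \<open>t \<in> U\<close>] dMy'
    by (simp add: dird_bilinear[OF bounded_bilinear_inner] dird_bilinear[OF bounded_bilinear_matrix_vector_mult]
        differentiable_bilinear[OF bounded_bilinear_matrix_vector_mult] dMy Mt a_def[symmetric] a'_def[symmetric])
  also have "a' \<bullet> (?M *v e) = (\<Sum>k\<in>UNIV. (?M *v a') $ k * e $ k)"
    by (metis sym inner_transpose_mult inner_vec_def inner_real_def)
  also have "a \<bullet> ((\<Sum>i\<in>UNIV. (a $ i) *\<^sub>R E i) *v e) =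
      (\<Sum>k\<in>UNIV. (\<Sum>i\<in>UNIV. \<Sum>j\<in>UNIV. E i $ j $ k * a $ i * a $ j) * e $ k)"
  proof -
    have "a \<bullet> ((\<Sum>i\<in>UNIV. (a $ i) *\<^sub>R E i) *v e) = (\<Sum>i\<in>UNIV. a $ i * (a \<bullet> (E i *v e)))"
      by (simp only: matvec.sum_left matvec.scaleR_left inner_sum_right inner_scaleR_right)
    also have "\<dots> = (\<Sum>i\<in>UNIV. \<Sum>j\<in>UNIV. \<Sum>k\<in>UNIV. E i $ j $ k * a $ i * a $ j * e $ k)"
      by (simp add: inner_vec_def matrix_vector_mult_def sum_distrib_left mult_ac)
    also have "\<dots> = (\<Sum>i\<in>UNIV. \<Sum>k\<in>UNIV. \<Sum>j\<in>UNIV. E i $ j $ k * a $ i * a $ j * e $ k)"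
      by (subst (2) sum.swap) (rule refl)
    also have "\<dots> = (\<Sum>k\<in>UNIV. \<Sum>i\<in>UNIV. \<Sum>j\<in>UNIV. E i $ j $ k * a $ i * a $ j * e $ k)"
      by (rule sum.swap)
    finally show ?thesis by (simp add: sum_distrib_right)
  qed
  also have "(\<Sum>k\<in>UNIV. (\<Sum>i\<in>UNIV. \<Sum>j\<in>UNIV. E i $ j $ k * a $ i * a $ j) * e $ k)
      + (\<Sum>k\<in>UNIV. (?M *v a') $ k * e $ k) =
      (\<Sum>k\<in>UNIV. (1 / 2) * (\<Sum>i\<in>UNIV. \<Sum>j\<in>UNIV. E k $ i $ j * a $ i * a $ j) * e $ k)"
    unfolding lower sum.distrib[symmetric] by (intro sum.cong refl) (simp add: algebra_simps)
  also have "\<dots> = (1 / 2) * (a \<bullet> (dird e M (y t) *v a))"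
  proof -
    have "a \<bullet> (dird e M (y t) *v a) = (\<Sum>k\<in>UNIV. e $ k * (a \<bullet> (E k *v a)))"
      unfolding dird_coordinates[OF dM, of e] E_def
      by (simp only: matvec.sum_left matvec.scaleR_left inner_sum_right inner_scaleR_right)
    also have "\<dots> = (\<Sum>k\<in>UNIV. (\<Sum>i\<in>UNIV. \<Sum>j\<in>UNIV. E k $ i $ j * a $ i * a $ j) * e $ k)"
      by (simp add: inner_vec_def matrix_vector_mult_def sum_distrib_left sum_distrib_right mult_ac)
    finally show ?thesis by (simp add: sum_distrib_left mult_ac)
  qed
  finally show ?thesis by (simp add: a_def)
qed

section \<open>The base manifold read in one chart\<close>

definition christoffel_matrix ::
  "(('p, 'k::finite) chart \<Rightarrow> 'p \<Rightarrow> real ^ 'k ^ 'k) \<Rightarrow> ('p, 'k) chart \<Rightarrow> 'k \<Rightarrow> real ^ 'k \<Rightarrow> real ^ 'k ^ 'k" where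
  "christoffel_matrix g b i \<xi> = (\<chi> h j. christoffel g b (cinv b \<xi>) h i j)"

text \<open>The conditions on \<open>J\<close> and on the curvature are the componentwise
  assumptions rearranged as matrix equations. Metric compatibility and vanishing torsion come out of
  the Christoffel formula and the symmetry of the metric.\<close>

lemma symmetric_kaehler_chart:
  fixes A :: "('p, 'k::finite) chart set"
  assumes "standard_kaehler A J g" "locally_symmetric A g" "b \<in> A"
  shows "symmetric_kaehler_chart (cmap b ` cdom b) (\<lambda>\<xi>. g b (cinv b \<xi>)) (\<lambda>\<xi>. J b (cinv b \<xi>)) (christoffel_matrix g b)"
proof -
  let ?\<Omega> = "cmap b ` cdom b" and ?G = "\<lambda>\<xi>. g b (cinv b \<xi>)" and ?J = "\<lambda>\<xi>. J b (cinv b \<xi>)"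
    and ?\<Gamma> = "christoffel_matrix g b"
  have man: "smooth_manifold A" and met: "riemannian_metric A g" and endo: "endomorphism_field A J"
    and kaehler: "\<And>x. x \<in> cdom b \<Longrightarrow> J b x ** J b x = - mat 1 \<and>
        (\<forall>X Y. inner_of g b x (J b x *v X) (J b x *v Y) = inner_of g b x X Y) \<and>
        (\<forall>k i j. nabla_endo g J b x k i j = 0)"
    and symm: "\<And>x m l k i j. x \<in> cdom b \<Longrightarrow> nabla_curvature g b x m l k i j = 0"
    using assms by (auto simp: standard_kaehler_def locally_symmetric_def)
  have inj: "inj_on (cmap b) (cdom b)" and op: "open ?\<Omega>"
    using man \<open>b \<in> A\<close> by (auto simp: smooth_manifold_def)
  have G: "smooth_on ?\<Omega> ?G"
    and sym: "\<And>x. x \<in> cdom b \<Longrightarrow> transpose (g b x) = g b x"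
    and pos: "\<And>x v. x \<in> cdom b \<Longrightarrow> v \<noteq> 0 \<Longrightarrow> v \<bullet> (g b x *v v) > 0"
    using met \<open>b \<in> A\<close> unfolding riemannian_metric_def o_def by blast+
  have J: "smooth_on ?\<Omega> ?J"
    using endo \<open>b \<in> A\<close> unfolding endomorphism_field_def o_def by blast
  have inv: "invertible (g b x)" if "x \<in> cdom b" for x
    using pos[OF that] by (rule positive_definite_invertible)
  have \<xi>: "cinv b \<xi> \<in> cdom b" "cmap b (cinv b \<xi>) = \<xi>" if "\<xi> \<in> ?\<Omega>" for \<xi>
    using that by (auto simp: inv_into_into f_inv_into_f)
  define E where "E i \<xi> = dird (axis i 1) ?G \<xi>" for i \<xi>
  have dG: "?G differentiable at \<xi>" and dJ: "?J differentiable at \<xi>" if "\<xi> \<in> ?\<Omega>" for \<xi>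
    using that smooth_on_differentiable[OF G] smooth_on_differentiable[OF J] by blast+
  have pd_g: "pd b i (\<lambda>y. g b y $ j $ l) (cinv b \<xi>) = E i \<xi> $ j $ l" if "\<xi> \<in> ?\<Omega>" for \<xi> i j l
    unfolding pd_eq_dird E_def using dird_entry[OF dG[OF that]] \<xi>[OF that] by simp
  have E_sym: "E i \<xi> $ j $ l = E i \<xi> $ l $ j" if "\<xi> \<in> ?\<Omega>" for i \<xi> j l
  proof -
    have "g b (cinv b \<eta>) $ j $ l = g b (cinv b \<eta>) $ l $ j" if "\<eta> \<in> ?\<Omega>" for \<eta>
      using arg_cong[OF sym[OF \<xi>(1)[OF that]], of "\<lambda>M. M $ j $ l"] by (simp add: transpose_def)
    then have "dird (axis i 1) (\<lambda>\<eta>. ?G \<eta> $ j $ l) \<xi> = dird (axis i 1) (\<lambda>\<eta>. ?G \<eta> $ l $ j) \<xi>"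
      by (rule dird_cong[OF op that])
    then show ?thesis by (simp add: E_def dird_entry[OF dG[OF that]])
  qed
  have \<Gamma>: "smooth_on ?\<Omega> (?\<Gamma> i)" for i
  proof (intro smooth_on_vec op)
    fix h j
    have "smooth_on ?\<Omega> (\<lambda>\<xi>. (1 / 2) * (\<Sum>l\<in>UNIV. matrix_inv (?G \<xi>) $ h $ l *
       (E i \<xi> $ j $ l + E j \<xi> $ i $ l - E l \<xi> $ i $ j)))"
      unfolding E_def
      by (intro smooth_on_mult smooth_on_const smooth_on_sum smooth_on_add smooth_on_diff smooth_on_entry
          smooth_on_matrix_inv smooth_on_dird G op inv \<xi>)
    then show "smooth_on ?\<Omega> (\<lambda>\<xi>. ?\<Gamma> i \<xi> $ h $ j)"
      by (rule smooth_on_cong[OF op]) (simp add: christoffel_matrix_def christoffel_def pd_g)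
  qed
  have d\<Gamma>: "?\<Gamma> i differentiable at \<xi>" if "\<xi> \<in> ?\<Omega>" for i \<xi>
    using smooth_on_differentiable[OF \<Gamma> that] .
  have pd_\<Gamma>: "pd b i (\<lambda>y. christoffel g b y l j k) (cinv b \<xi>) = dird (axis i 1) (?\<Gamma> j) \<xi> $ l $ k"
    if "\<xi> \<in> ?\<Omega>" for \<xi> i j k l
    unfolding pd_eq_dird using dird_entry[OF d\<Gamma>[OF that], of "axis i 1" j l k] \<xi>[OF that]
    by (simp add: christoffel_matrix_def)
  have curv: "curvature g b (cinv b \<xi>) l k i j = curv ?\<Gamma> i j \<xi> $ l $ k" if "\<xi> \<in> ?\<Omega>" for \<xi> i j k l
    by (simp add: curvature_def curv_def pd_\<Gamma>[OF that] matrix_matrix_mult_def)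
      (simp add: christoffel_matrix_def)
  have lower: "(\<Sum>h\<in>UNIV. ?G \<xi> $ k $ h * ?\<Gamma> i \<xi> $ h $ j) = (1 / 2) * (E i \<xi> $ j $ k + E j \<xi> $ i $ k - E k \<xi> $ i $ j)"
    if "\<xi> \<in> ?\<Omega>" for \<xi> i j k
    using christoffel_lower[of g b "cinv b \<xi>", OF inv[OF \<xi>(1)[OF that]], of k i j]
    by (simp add: christoffel_matrix_def pd_g[OF that])
  show ?thesis
  proof
    show "smooth_on ?\<Omega> ?G" "smooth_on ?\<Omega> ?J" "\<And>i. smooth_on ?\<Omega> (?\<Gamma> i)" "open ?\<Omega>"
      by (fact G J \<Gamma> op)+
  next
    fix \<xi> assume in_dom: "\<xi> \<in> ?\<Omega>"
    note x = \<xi>[OF in_dom]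
    show Gsym: "transpose (?G \<xi>) = ?G \<xi>" by (rule sym[OF x(1)])
    show "X \<bullet> (?G \<xi> *v X) > 0" if "X \<noteq> 0" for X by (rule pos[OF x(1) that])
    show "?\<Gamma> i \<xi> $ h $ j = ?\<Gamma> j \<xi> $ h $ i" for i h j
      using E_sym[OF in_dom, of _ i j]
      by (simp add: christoffel_matrix_def christoffel_def pd_g[OF in_dom] add.commute)
    show "dird (axis k 1) ?G \<xi> = transpose (?\<Gamma> k \<xi>) ** ?G \<xi> + ?G \<xi> ** ?\<Gamma> k \<xi>" for k
    proof -
      have "E k \<xi> $ i $ j = (\<Sum>h\<in>UNIV. ?\<Gamma> k \<xi> $ h $ i * ?G \<xi> $ h $ j) + (\<Sum>h\<in>UNIV. ?G \<xi> $ i $ h * ?\<Gamma> k \<xi> $ h $ j)" for i j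
      proof -
        have "?G \<xi> $ h $ j = ?G \<xi> $ j $ h" for h
          using arg_cong[OF Gsym, of "\<lambda>M. M $ j $ h"] by (simp add: transpose_def)
        then have "(\<Sum>h\<in>UNIV. ?\<Gamma> k \<xi> $ h $ i * ?G \<xi> $ h $ j) = (\<Sum>h\<in>UNIV. ?G \<xi> $ j $ h * ?\<Gamma> k \<xi> $ h $ i)"
          by (simp add: mult.commute)
        \<comment> \<open>Adding the first-kind symbols with \<open>i\<close> and \<open>j\<close>
          exchanged cancels all derivatives except the one in direction \<open>k\<close>.\<close>
        then have first: "(\<Sum>h\<in>UNIV. ?\<Gamma> k \<xi> $ h $ i * ?G \<xi> $ h $ j) = (1 / 2) * (E k \<xi> $ i $ j + E i \<xi> $ k $ j - E j \<xi> $ k $ i)"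
          by (simp only: lower[OF in_dom])
        show ?thesis
          unfolding first lower[OF in_dom]
          using E_sym[OF in_dom, of k i j] E_sym[OF in_dom, of i k j] E_sym[OF in_dom, of j k i] by argo
      qed
      then show ?thesis by (simp add: E_def[symmetric] vec_eq_iff matrix_matrix_mult_def transpose_def)
    qed
    show "dird (axis k 1) ?J \<xi> = ?J \<xi> ** ?\<Gamma> k \<xi> - ?\<Gamma> k \<xi> ** ?J \<xi>" for k
    proof -
      have "pd b k (\<lambda>y. J b y $ i $ j) (cinv b \<xi>) = dird (axis k 1) ?J \<xi> $ i $ j" for i j
        unfolding pd_eq_dird using dird_entry[OF dJ[OF in_dom]] x by simp
      moreover have "nabla_endo g J b (cinv b \<xi>) k i j = 0" for i j
        using kaehler[OF x(1)] by blast
      ultimately show ?thesis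
        by (simp add: vec_eq_iff matrix_matrix_mult_def nabla_endo_def christoffel_matrix_def mult.commute
            algebra_simps)
    qed
    show "?J \<xi> *v (?J \<xi> *v X) = - X" for X
      using kaehler[OF x(1)] by (simp add: matrix_vector_mul_assoc matvec.minus_left)
    show "(?J \<xi> *v X) \<bullet> (?G \<xi> *v (?J \<xi> *v Y)) = X \<bullet> (?G \<xi> *v Y)" for X Y
      using kaehler[OF x(1)] by (simp add: inner_of_def)
    show "dird (axis k 1) (curv ?\<Gamma> i j) \<xi> =
      curv ?\<Gamma> i j \<xi> ** ?\<Gamma> k \<xi> - ?\<Gamma> k \<xi> ** curv ?\<Gamma> i j \<xi>
      + (\<Sum>a\<in>UNIV. (?\<Gamma> k \<xi> $ a $ i) *\<^sub>R curv ?\<Gamma> a j \<xi>) + (\<Sum>a\<in>UNIV. (?\<Gamma> k \<xi> $ a $ j) *\<^sub>R curv ?\<Gamma> i a \<xi>)" for k i j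
    proof -
      have sm: "smooth_on ?\<Omega> (curv ?\<Gamma> i j)"
        unfolding curv_def[abs_def]
        by (intro smooth_on_diff smooth_on_add smooth_on_bilinear[OF _ bounded_bilinear_matrix_matrix_mult]
            smooth_on_dird \<Gamma> op)
      have "pd b k (\<lambda>y. curvature g b y l m i j) (cinv b \<xi>) = dird (axis k 1) (curv ?\<Gamma> i j) \<xi> $ l $ m" for l m
      proof -
        have "pd b k (\<lambda>y. curvature g b y l m i j) (cinv b \<xi>) = dird (axis k 1) (\<lambda>\<eta>. curv ?\<Gamma> i j \<eta> $ l $ m) \<xi>"
          unfolding pd_eq_dird x(2) by (rule dird_cong[OF op in_dom]) (simp add: curv)
        then show ?thesis
          by (simp add: dird_entry smooth_on_differentiable[OF sm in_dom])
      qed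
      moreover have "nabla_curvature g b (cinv b \<xi>) k l m i j = 0" for l m
        by (rule symm[OF x(1)])
      ultimately show ?thesis
        by (simp add: vec_eq_iff matrix_matrix_mult_def nabla_curvature_def curv[OF in_dom])
          (simp add: christoffel_matrix_def mult.commute algebra_simps)
    qed
  qed
qed

section \<open>Geodesics of the unit cotangent bundle\<close>

lemma bounded_linear_join:
  "bounded_linear (\<lambda>z. join (fst z) (snd z) :: real ^ ('k::finite + 'k))"
  unfolding linear_conv_bounded_linear[symmetric]
proof (rule linearI)
  show "join (fst (y + z)) (snd (y + z)) = join (fst y) (snd y) + join (fst z) (snd z)"
    for y z :: "(real ^ 'k) \<times> (real ^ 'k)"
    unfolding vec_eq_iff join_def by (auto split: sum.split)
  show "join (fst (r *\<^sub>R z)) (snd (r *\<^sub>R z)) = r *\<^sub>R join (fst z) (snd z)"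
    for r and z :: "(real ^ 'k) \<times> (real ^ 'k)"
    unfolding vec_eq_iff join_def by (auto split: sum.split)
qed

lemma join_eq_iff: "join X P = join X' P' \<longleftrightarrow> X = X' \<and> P = P'"
proof
  assume "join X P = join X' P'"
  then have "join X P $ Inl i = join X' P' $ Inl i" "join X P $ Inr i = join X' P' $ Inr i" for i
    by simp_all
  then show "X = X' \<and> P = P'" by (simp add: vec_eq_iff)
qed simp

lemma linear_bs_form:
  fixes J g :: "('p, 'k::finite) chart \<Rightarrow> 'p \<Rightarrow> real ^ 'k ^ 'k"
  shows "linear (\<lambda>\<xi>. bs_form J g \<delta> b q \<xi> \<eta>)" "linear (bs_form J g \<delta> b q \<eta>)"
proof -
  have h: "horizontal_part (\<xi> + \<zeta>) = horizontal_part \<xi> + horizontal_part \<zeta>"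
    "horizontal_part (r *\<^sub>R \<xi>) = r *\<^sub>R horizontal_part \<xi>" for \<xi> \<zeta> :: "real ^ ('k + 'k)" and r
    by (simp_all add: horizontal_part_def vec_eq_iff)
  have v: "vertical_part g b q (\<xi> + \<zeta>) = vertical_part g b q \<xi> + vertical_part g b q \<zeta>"
    "vertical_part g b q (r *\<^sub>R \<xi>) = r *\<^sub>R vertical_part g b q \<xi>" for \<xi> \<zeta> :: "real ^ ('k + 'k)" and r
    by (simp_all add: vertical_part_def horizontal_lift_def horizontal_part_def vec_eq_iff sum.distrib
        sum_distrib_left algebra_simps)
  have i: "inner_of g b x (X + X') Y = inner_of g b x X Y + inner_of g b x X' Y"
    "inner_of g b x Y (X + X') = inner_of g b x Y X + inner_of g b x Y X'"
    "inner_of g b x (r *\<^sub>R X) Y = r * inner_of g b x X Y"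
    "inner_of g b x Y (r *\<^sub>R X) = r * inner_of g b x Y X" for x X X' Y r
    by (simp_all add: inner_of_def inner_add matvec.add_right matvec.scaleR_right)
  have s: "sharp g b x (X + X') = sharp g b x X + sharp g b x X'" "sharp g b x (r *\<^sub>R X) = r *\<^sub>R sharp g b x X"
    for x X X' r
    by (simp_all add: sharp_def matvec.add_right matvec.scaleR_right)
  show "linear (\<lambda>\<xi>. bs_form J g \<delta> b q \<xi> \<eta>)" "linear (bs_form J g \<delta> b q \<eta>)"
    by (auto intro!: linearI simp: bs_form_def Let_def coinner_of_def h v i s algebra_simps)
qed

lemma bs_metric_form: "\<xi> \<bullet> (bs_metric J g \<delta> b q *v \<eta>) = bs_form J g \<delta> b q \<xi> \<eta>"
proof -
  have "bs_form J g \<delta> b q \<xi> \<eta> = (\<Sum>a\<in>UNIV. \<xi> $ a * bs_form J g \<delta> b q (axis a 1) \<eta>)"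
    using linear_sum[OF linear_bs_form(1)[where J = J and g = g and \<delta> = \<delta> and b = b and q = q and \<eta> = \<eta>], of "\<lambda>a. \<xi> $ a *\<^sub>R axis a 1" UNIV]
    by (simp add: sum_axis linear_scale[OF linear_bs_form(1)])
  moreover have "bs_form J g \<delta> b q (axis a 1) \<eta> = (\<Sum>c\<in>UNIV. \<eta> $ c * bs_form J g \<delta> b q (axis a 1) (axis c 1))" for a
    using linear_sum[OF linear_bs_form(2)[where J = J and g = g and \<delta> = \<delta> and b = b and q = q and \<eta> = "axis a 1"], of "\<lambda>c. \<eta> $ c *\<^sub>R axis c 1" UNIV]
    by (simp add: sum_axis linear_scale[OF linear_bs_form(2)])
  ultimately show ?thesis
    by (simp add: bs_metric_def inner_vec_def matrix_vector_mult_def sum_distrib_left mult_ac)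
qed

text \<open>\<open>b\<close> is the very base chart that the induced metric selects by choice, so
  the metric can be unfolded without comparing different base charts.\<close>

locale unit_cotangent_coordinates =
  fixes A :: "('p, 'n::finite) chart set"
    and J g :: "('p, 'n) chart \<Rightarrow> 'p \<Rightarrow> real ^ 'n ^ 'n"
    and \<delta> :: real
    and u :: "(('p, 'n) cotangent_point, 'n hyper) chart"
    and b :: "('p, 'n) chart"
  assumes kaehler: "standard_kaehler A J g"
    and symm: "locally_symmetric A g"
    and chart: "unit_cotangent_chart A g b u"
    and b_eq: "b = (SOME b. unit_cotangent_chart A g b u)"
begin

section \<open>Base point, covector and dual unit vector in hypersurface coordinates\<close>

abbreviation "Y \<equiv> cmap u ` cdom u"
abbreviation "xh \<eta> \<equiv> cmap b (fst (cinv u \<eta>))"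
abbreviation "ph \<eta> \<equiv> snd (cinv u \<eta>) b"
abbreviation "gb \<xi> \<equiv> g b (cinv b \<xi>)"
abbreviation "Jb \<xi> \<equiv> J b (cinv b \<xi>)"

definition "uh \<eta> = matrix_inv (gb (xh \<eta>)) *v ph \<eta>"

definition "hyper_metric \<eta> = induced_bs_metric A J g \<delta> u (cinv u \<eta>)"

lemma b_in: "b \<in> A"
  using chart by (simp add: unit_cotangent_chart_def)

sublocale symmetric_kaehler_chart "cmap b ` cdom b" gb Jb "christoffel_matrix g b"
  by (rule symmetric_kaehler_chart[OF kaehler symm b_in])

lemma inj_b: "inj_on (cmap b) (cdom b)"
  using kaehler b_in unfolding standard_kaehler_def smooth_manifold_def by blast

lemma open_Y: "open Y"
  using chart by (simp add: unit_cotangent_chart_def)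

text \<open>A homeomorphic map is injective on the topspace. This is all of \<open>cdom u\<close>,
  because \<open>cdom u\<close> is open in a subspace of the cotangent bundle.\<close>

lemma inj_u: "inj_on (cmap u) (cdom u)"
proof -
  let ?T = "atlas_topology (cotangent_atlas A)"
  have "openin (subtopology ?T (unit_cotangent_bundle A g)) (cdom u)"
    and homeo: "homeomorphic_map (subtopology ?T (cdom u)) (top_of_set Y) (cmap u)"
    using chart unfolding unit_cotangent_chart_def by blast+
  then have "topspace (subtopology ?T (cdom u)) = cdom u"
    using openin_subset by fastforce
  then show ?thesis
    using homeomorphic_imp_injective_map[OF homeo] by simp
qed

lemma cdom_u:
  assumes "q \<in> cdom u"
  shows "fst q \<in> cdom b" "coinner_of g b (fst q) (snd q b) (snd q b) = 1"
proof -
  have "q \<in> cdom (cotangent_chart A b)"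
    using chart assms unfolding unit_cotangent_chart_def by blast
  then show "fst q \<in> cdom b" by (simp add: cotangent_chart_def)
  moreover have "q \<in> unit_cotangent_bundle A g"
    using chart assms openin_subset unfolding unit_cotangent_chart_def by fastforce
  ultimately show "coinner_of g b (fst q) (snd q b) (snd q b) = 1"
    using b_in by (simp add: unit_cotangent_bundle_def)
qed

lemma cinv_u: "\<eta> \<in> Y \<Longrightarrow> cinv u \<eta> \<in> cdom u" "\<eta> \<in> Y \<Longrightarrow> cmap u (cinv u \<eta>) = \<eta>"
  by (auto simp: inv_into_into f_inv_into_f)

lemma xh_in: "\<eta> \<in> Y \<Longrightarrow> xh \<eta> \<in> cmap b ` cdom b"
  using cdom_u(1)[OF cinv_u(1)] by blast

lemma cinv_xh: "\<eta> \<in> Y \<Longrightarrow> cinv b (xh \<eta>) = fst (cinv u \<eta>)"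
  by (rule inv_into_f_f[OF inj_b cdom_u(1)[OF cinv_u(1)]])

lemma invertible_gb: "\<xi> \<in> cmap b ` cdom b \<Longrightarrow> invertible (gb \<xi>)"
  using G_pos by (rule positive_definite_invertible)

lemma smooth_join: "smooth_on Y (\<lambda>\<eta>. join (xh \<eta>) (ph \<eta>))"
  using chart by (simp add: unit_cotangent_chart_def cotangent_chart_def o_def)

lemma smooth_xh: "smooth_on Y (\<lambda>\<eta>. xh \<eta>)"
  using smooth_on_nth[OF open_Y smooth_join, of "Inl _"] by (intro smooth_on_vec[OF open_Y]) simp

lemma smooth_ph: "smooth_on Y (\<lambda>\<eta>. ph \<eta>)"
  using smooth_on_nth[OF open_Y smooth_join, of "Inr _"] by (intro smooth_on_vec[OF open_Y]) simp

sublocale map_into_chart "cmap b ` cdom b" gb Jb "christoffel_matrix g b" Y "\<lambda>\<eta>. xh \<eta>"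
  by unfold_locales (fact open_Y smooth_xh xh_in)+

lemma smooth_uh: "smooth_on Y uh"
  unfolding uh_def[abs_def]
  by (intro smooth_on_bilinear[OF _ bounded_bilinear_matrix_vector_mult] smooth_on_matrix_inv smooth_along
      smooth_G invertible_gb x_in smooth_ph open_Y)

lemma ph_eq: "\<eta> \<in> Y \<Longrightarrow> ph \<eta> = gb (xh \<eta>) *v uh \<eta>"
  by (simp add: uh_def matrix_vector_mul_assoc matrix_inv_right invertible_gb x_in)

lemma sharp_gb: "\<eta> \<in> Y \<Longrightarrow> sharp g b (fst (cinv u \<eta>)) (gb (xh \<eta>) *v X) = X"
  using matrix_inv_left[OF invertible_gb[OF x_in, of \<eta>]]
  by (simp add: sharp_def matrix_vector_mul_assoc cinv_xh)

lemma coinner_gb: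
  "\<eta> \<in> Y \<Longrightarrow> coinner_of g b (fst (cinv u \<eta>)) (gb (xh \<eta>) *v X) (gb (xh \<eta>) *v X') = inn (xh \<eta>) X X'"
  by (simp add: coinner_of_def sharp_gb) (simp add: inner_of_def inn_def cinv_xh)

lemma uh_unit: "\<eta> \<in> Y \<Longrightarrow> inn (xh \<eta>) (uh \<eta>) (uh \<eta>) = 1"
  using cdom_u(2)[OF cinv_u(1), of \<eta>] coinner_gb[of \<eta> "uh \<eta>" "uh \<eta>"] ph_eq[of \<eta>] by metis

text \<open>Since \<open>J\<close> is skew, \<open>pJ\<close> is dual to \<open>- Ju\<close>. The
  sign is harmless: \<open>pJ\<close> occurs twice in the metric.\<close>

lemma dual_J_ph:
  assumes "\<eta> \<in> Y"
  shows "dual_J J b (fst (cinv u \<eta>)) (ph \<eta>) = gb (xh \<eta>) *v (- (Jb (xh \<eta>) *v uh \<eta>))"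
proof -
  have "X \<bullet> (transpose (Jb (xh \<eta>)) *v (gb (xh \<eta>) *v uh \<eta>)) = X \<bullet> (gb (xh \<eta>) *v (- (Jb (xh \<eta>) *v uh \<eta>)))" for X
    using inn_J_left[OF x_in[OF assms], of X "uh \<eta>"]
    unfolding inner_transpose_mult by (simp add: inn_def matvec.minus_right)
  then show ?thesis
    unfolding dual_J_def ph_eq[OF assms] by (metis cinv_xh[OF assms] vector_eq_ldot)
qed

lemma dird_join:
  assumes "\<eta> \<in> Y"
  shows "dird e (\<lambda>\<eta>. join (xh \<eta>) (ph \<eta>)) \<eta> = join (dird e (\<lambda>\<eta>. xh \<eta>) \<eta>) (dird e (\<lambda>\<eta>. ph \<eta>) \<eta>)"
proof (subst vec_eq_iff, rule allI)
  fix a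
  have d: "(\<lambda>\<eta>. join (xh \<eta>) (ph \<eta>)) differentiable at \<eta>" "(\<lambda>\<eta>. xh \<eta>) differentiable at \<eta>"
    "(\<lambda>\<eta>. ph \<eta>) differentiable at \<eta>"
    by (intro smooth_on_differentiable[OF _ assms] smooth_join smooth_xh smooth_ph)+
  show "dird e (\<lambda>\<eta>. join (xh \<eta>) (ph \<eta>)) \<eta> $ a = join (dird e (\<lambda>\<eta>. xh \<eta>) \<eta>) (dird e (\<lambda>\<eta>. ph \<eta>) \<eta>) $ a"
    unfolding dird_nth[OF d(1), symmetric]
    by (cases a) (simp_all add: dird_nth[OF d(2)] dird_nth[OF d(3)])
qed

text \<open>The splitting into lifts: the first summand is the fibre part of the horizontal lift,
  the second is the covector dual to the covariant derivative of \<open>uh\<close>.\<close>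

lemma dird_ph:
  assumes "\<eta> \<in> Y"
  shows "dird e (\<lambda>\<eta>. ph \<eta>) \<eta> = transpose (conn (xh \<eta>) (dird e (\<lambda>\<eta>. xh \<eta>) \<eta>)) *v ph \<eta>
    + gb (xh \<eta>) *v D e uh \<eta>"
proof -
  have "dird e (\<lambda>\<eta>. ph \<eta>) \<eta> = dird e (\<lambda>\<eta>. gb (xh \<eta>) *v uh \<eta>) \<eta>"
    by (rule dird_cong[OF open_Y assms ph_eq])
  also have "\<dots> = gb (xh \<eta>) *v dird e uh \<eta> + dird e (\<lambda>\<eta>. gb (xh \<eta>)) \<eta> *v uh \<eta>"
    by (intro dird_bilinear[OF bounded_bilinear_matrix_vector_mult] smooth_on_differentiable[OF _ assms]
        smooth_along smooth_G smooth_uh)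
  finally show ?thesis
    unfolding dird_G_along[OF assms] ph_eq[OF assms] cov_def
    by (simp only: matvec.add_left matvec.add_right matrix_vector_mul_assoc add_ac)
qed

text \<open>The horizontal lift sums over the second lower index of the Christoffel symbol,
  \<open>conn\<close> over the first; torsion-freeness reconciles them.\<close>

lemma vertical_part_join:
  assumes "\<eta> \<in> Y"
  shows "vertical_part g b (cinv u \<eta>) (join X P) = P - transpose (conn (xh \<eta>) X) *v ph \<eta>"
proof -
  have "(\<Sum>h\<in>UNIV. \<Sum>j\<in>UNIV. ph \<eta> $ h * christoffel g b (fst (cinv u \<eta>)) h i j * X $ j) =
      (transpose (conn (xh \<eta>) X) *v ph \<eta>) $ i" for i
  proof -
    have "christoffel g b (fst (cinv u \<eta>)) h i j = christoffel_matrix g b j (xh \<eta>) $ h $ i" for h j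
      using torsion_free[OF x_in[OF assms], of i h j] by (simp add: christoffel_matrix_def cinv_xh[OF assms])
    then show ?thesis
      by (simp add: conn_def matrix_vector_mult_def transpose_def sum_distrib_left sum_distrib_right mult_ac
          del: transpose_matrix_vector)
  qed
  then show ?thesis
    by (simp add: vertical_part_def horizontal_lift_def horizontal_part_def vec_eq_iff del: transpose_matrix_vector)
qed

text \<open>Pulling back along base point and covector puts the derivative of \<open>xh\<close> into
  the horizontal slot and the dual of the covariant derivative of \<open>uh\<close> into the
  vertical one. The induced metric is thus the form whose first variation is known.\<close>

lemma hyper_metric_lagrangian:
  assumes "\<eta> \<in> Y"
  shows "e \<bullet> (hyper_metric \<eta> *v f) = lagrangian \<delta> uh e f \<eta>"
proof -
  let ?q = "cinv u \<eta>" and ?\<Phi> = "\<lambda>\<eta>. join (xh \<eta>) (ph \<eta>)"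
  let ?D = "matrix (frechet_derivative (cmap (cotangent_chart A b) \<circ> cinv u) (at (cmap u ?q)))"
  have \<Phi>: "cmap (cotangent_chart A b) \<circ> cinv u = ?\<Phi>"
    by (simp add: cotangent_chart_def o_def)
  have "?\<Phi> differentiable at \<eta>" by (intro smooth_on_differentiable[OF _ assms] smooth_join)
  then have "linear (frechet_derivative ?\<Phi> (at \<eta>))" by (rule linear_frechet_derivative)
  then have D: "?D *v v = dird v ?\<Phi> \<eta>" for v
    unfolding \<Phi> cinv_u(2)[OF assms] dird_def by (simp add: matrix_works)
  have "hyper_metric \<eta> = transpose ?D ** bs_metric J g \<delta> b ?q ** ?D"
    unfolding hyper_metric_def induced_bs_metric_def Let_def b_eq[symmetric] ..
  then have "e \<bullet> (hyper_metric \<eta> *v f) = bs_form J g \<delta> b ?q (dird e ?\<Phi> \<eta>) (dird f ?\<Phi> \<eta>)"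
    by (simp only: matrix_vector_mul_assoc[symmetric] inner_transpose_mult bs_metric_form D)
  also have "\<dots> = lagrangian \<delta> uh e f \<eta>"
  proof -
    have vp: "vertical_part g b ?q (dird v ?\<Phi> \<eta>) = gb (xh \<eta>) *v D v uh \<eta>" for v
      unfolding dird_join[OF assms] vertical_part_join[OF assms] dird_ph[OF assms] by simp
    have hp: "horizontal_part (dird v ?\<Phi> \<eta>) = dird v (\<lambda>\<eta>. xh \<eta>) \<eta>" for v
      unfolding dird_join[OF assms] by (simp add: horizontal_part_def vec_eq_iff)
    show ?thesis
      unfolding bs_form_def Let_def vp hp dual_J_ph[OF assms] coinner_gb[OF assms] lagrangian_def
      by (simp add: inner_of_def inn_def cinv_xh[OF assms] matvec.minus_right)
  qed
  finally show ?thesis .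
qed

lemma smooth_hyper_metric: "smooth_on Y hyper_metric"
proof (intro smooth_on_vec open_Y)
  fix i j
  have "hyper_metric \<eta> $ i $ j = axis i 1 \<bullet> (hyper_metric \<eta> *v axis j 1)" for \<eta>
    by (simp add: inner_axis' matrix_vector_mul_component inner_axis)
  then show "smooth_on Y (\<lambda>\<eta>. hyper_metric \<eta> $ i $ j)"
    using smooth_on_cong[OF open_Y smooth_lagrangian[OF smooth_uh, of \<delta> "axis i 1" "axis j 1"]]
      hyper_metric_lagrangian by simp
qed

lemma hyper_metric_sym: "\<eta> \<in> Y \<Longrightarrow> transpose (hyper_metric \<eta>) = hyper_metric \<eta>"
proof -
  assume "\<eta> \<in> Y"
  have "e \<bullet> (transpose (hyper_metric \<eta>) *v f) = e \<bullet> (hyper_metric \<eta> *v f)" for e f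
    unfolding inner_transpose_mult
    using hyper_metric_lagrangian[OF \<open>\<eta> \<in> Y\<close>, of e f] hyper_metric_lagrangian[OF \<open>\<eta> \<in> Y\<close>, of f e]
      inn_commute[OF x_in[OF \<open>\<eta> \<in> Y\<close>]]
    by (simp add: inner_commute lagrangian_def mult_ac)
  then show ?thesis by (metis matrix_eq vector_eq_ldot)
qed

text \<open>By \<open>dird_ph\<close> the derivative of the covector is determined by the two
  vanishing quantities, and the chart is an immersion.\<close>

lemma parametrization_injective:
  assumes "\<eta> \<in> Y" "dird e (\<lambda>\<eta>. xh \<eta>) \<eta> = 0" "D e uh \<eta> = 0"
  shows "e = 0"
proof -
  let ?\<Phi> = "\<lambda>\<eta>. join (xh \<eta>) (ph \<eta>)"
  have "conn (xh \<eta>) 0 = 0" by (simp add: conn_def)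
  then have "dird e (\<lambda>\<eta>. ph \<eta>) \<eta> = 0"
    unfolding dird_ph[OF assms(1)] assms(2,3) by (simp add: transpose_def zero_vec_def matrix_vector_mult_def)
  then have "dird e ?\<Phi> \<eta> = join 0 0"
    using assms by (simp add: dird_join)
  also have "\<dots> = dird 0 ?\<Phi> \<eta>"
    using linear_0[OF linear_dird[OF smooth_on_differentiable[OF smooth_join assms(1)]]]
    by (simp add: vec_eq_iff join_def split: sum.split)
  finally have "frechet_derivative ?\<Phi> (at \<eta>) e = frechet_derivative ?\<Phi> (at \<eta>) 0"
    unfolding dird_def .
  moreover have "inj (frechet_derivative (cmap (cotangent_chart A b) \<circ> cinv u) (at \<eta>))"
    using chart assms(1) unfolding unit_cotangent_chart_def by blast
  then have "inj (frechet_derivative ?\<Phi> (at \<eta>))"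
    by (simp add: cotangent_chart_def o_def)
  ultimately show "e = 0" by (simp add: inj_def)
qed

lemma invertible_hyper_metric:
  assumes "\<eta> \<in> Y" shows "invertible (hyper_metric \<eta>)"
proof (rule positive_definite_invertible)
  fix e :: "real ^ 'n hyper" assume "e \<noteq> 0"
  then have "dird e (\<lambda>\<eta>. xh \<eta>) \<eta> \<noteq> 0 \<or> D e uh \<eta> \<noteq> 0"
    using parametrization_injective[OF assms] by blast
  moreover have "inn (xh \<eta>) X X \<ge> 0" for X
    using inn_pos[OF x_in[OF assms], of X] by (cases "X = 0") auto
  moreover have "inn (xh \<eta>) X X > 0" if "X \<noteq> 0" for X
    using inn_pos[OF x_in[OF assms] that] .
  moreover have "0 \<le> \<delta>\<^sup>2 * (r * r)" for r by simp
  ultimately show "e \<bullet> (hyper_metric \<eta> *v e) > 0"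
    unfolding hyper_metric_lagrangian[OF assms] lagrangian_def
    by (metis (no_types, lifting) add_nonneg_nonneg add_nonneg_pos add_pos_nonneg)
qed

text \<open>The chart map has the rank of the hypersurface, so every vector tangent to the unit cotangent bundle
  comes from a coordinate vector.\<close>

lemma parametrization_surjective:
  assumes "\<eta> \<in> Y" "inn (xh \<eta>) V (uh \<eta>) = 0"
  obtains e where "dird e (\<lambda>\<eta>. xh \<eta>) \<eta> = X" "D e uh \<eta> = V"
proof -
  let ?T = "\<lambda>e. join (dird e (\<lambda>\<eta>. xh \<eta>) \<eta>) (D e uh \<eta>)"
  define vp :: "real ^ ('n + 'n) \<Rightarrow> real ^ 'n" where "vp \<zeta> = (\<chi> i. \<zeta> $ Inr i)" for \<zeta>
  define L where "L \<zeta> = inn (xh \<eta>) (vp \<zeta>) (uh \<eta>)" for \<zeta>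
  have [simp]: "vp (join P Q) = Q" for P Q by (simp add: vp_def vec_eq_iff)
  have vp: "vp (\<zeta> + \<zeta>') = vp \<zeta> + vp \<zeta>'" "vp (r *\<^sub>R \<zeta>) = r *\<^sub>R vp \<zeta>" for \<zeta> \<zeta>' r
    by (simp_all add: vp_def vec_eq_iff)
  have join_lin: "join (P + P') (Q + Q') = join P Q + join P' Q'" "join (r *\<^sub>R P) (r *\<^sub>R Q) = r *\<^sub>R join P Q"
    for P P' Q Q' :: "real ^ 'n" and r :: real
    using linear_add[OF bounded_linear.linear[OF bounded_linear_join], of "(P, Q)" "(P', Q')"]
      linear_scale[OF bounded_linear.linear[OF bounded_linear_join], of r "(P, Q)"] by simp_all
  have lin_x: "linear (\<lambda>e. dird e (\<lambda>\<eta>. xh \<eta>) \<eta>)" and lin_u: "linear (\<lambda>e. dird e uh \<eta>)"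
    by (intro linear_dird smooth_on_differentiable[OF _ assms(1)] smooth_xh smooth_uh)+
  have conn: "conn \<xi> (P + P') = conn \<xi> P + conn \<xi> P'" "conn \<xi> (r *\<^sub>R P) = r *\<^sub>R conn \<xi> P" for \<xi> P P' r
    by (simp_all add: conn_def sum.distrib scaleR_add_left scaleR_sum_right)
  have lin_D: "linear (\<lambda>e. D e uh \<eta>)"
    by (rule linearI)
      (simp_all add: cov_def linear_add[OF lin_x] linear_add[OF lin_u] linear_scale[OF lin_x] linear_scale[OF lin_u]
        conn matvec.add_left matvec.scaleR_left scaleR_add_right)
  have lin_T: "linear ?T"
    by (rule linearI)
      (simp_all add: join_lin linear_add[OF lin_x] linear_add[OF lin_D] linear_scale[OF lin_x] linear_scale[OF lin_D])
  have sub: "subspace {\<zeta>. L \<zeta> = 0}"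
    by (rule subspaceI) (simp_all add: L_def vp, simp add: vp_def zero_vec_def[symmetric])
  have inj_T: "inj ?T"
    unfolding linear_injective_0[OF lin_T]
  proof (intro allI impI)
    fix e assume "?T e = 0"
    then have "?T e $ Inl i = 0" "?T e $ Inr i = 0" for i by simp_all
    then show "e = 0"
      by (intro parametrization_injective[OF assms(1)]) (simp_all add: vec_eq_iff)
  qed
  have range_T: "range ?T \<subseteq> {\<zeta>. L \<zeta> = 0}"
  proof (clarsimp simp: L_def)
    fix e
    have "dird e (\<lambda>\<eta>. inn (xh \<eta>) (uh \<eta>) (uh \<eta>)) \<eta> = dird e (\<lambda>\<eta>. 1) \<eta>"
      by (rule dird_cong[OF open_Y assms(1) uh_unit])
    then show "inn (xh \<eta>) (D e uh \<eta>) (uh \<eta>) = 0"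
      using inn_commute[OF x_in[OF assms(1)], of "uh \<eta>" "D e uh \<eta>"]
      by (simp add: dird_inn[OF smooth_uh smooth_uh assms(1)])
  qed
  have "dim (range ?T) = CARD('n hyper)"
    using dim_image_eq[OF lin_T, of UNIV] inj_T by simp
  moreover have "dim {\<zeta>. L \<zeta> = 0} < CARD('n + 'n)"
  proof -
    \<comment> \<open>Since \<open>u\<close> is a unit vector, \<open>L\<close> does not vanish at
      \<open>(0, u)\<close>; its kernel is a proper subspace, of dimension at most that of the
      hypersurface.\<close>
    have "join 0 (uh \<eta>) \<notin> {\<zeta>. L \<zeta> = 0}" using uh_unit[OF assms(1)] by (simp add: L_def)
    then have "span {\<zeta>. L \<zeta> = 0} \<subset> span UNIV"
      unfolding span_eq_iff[THEN iffD2, OF sub] span_UNIV by blast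
    then show ?thesis using dim_psubset[of "{\<zeta>. L \<zeta> = 0}" UNIV] by simp
  qed
  ultimately have "dim {\<zeta>. L \<zeta> = 0} \<le> dim (range ?T)"
    by (simp add: CARD_hyper card_UNIV_sum)
  then have "range ?T = {\<zeta>. L \<zeta> = 0}"
    using linear_subspace_image[OF lin_T subspace_UNIV] sub range_T by (intro subspace_dim_equal)
  moreover have "join X V \<in> {\<zeta>. L \<zeta> = 0}"
    using assms(2) by (simp add: L_def)
  ultimately obtain e where "join X V = ?T e" by blast
  then show ?thesis using that[of e] by (simp add: join_eq_iff)
qed

section \<open>From the geodesic equation to the tested equation of motion\<close>

lemma geodesic_first_variation:
  assumes "open U" "C ` U \<subseteq> cdom u" "smooth_on U (\<lambda>t. cmap u (C t))" "t \<in> U"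
    and "cov_deriv (induced_bs_metric A J g \<delta>) C (velocity C) u t = 0"
  defines "y \<equiv> \<lambda>t. cmap u (C t)"
  shows "dird 1 (\<lambda>t. dird 1 y t \<bullet> (hyper_metric (y t) *v e)) t =
    (1 / 2) * (dird 1 y t \<bullet> (dird e hyper_metric (y t) *v dird 1 y t))"
proof -
  have "C t \<in> cdom u" using assms by blast
  then have yt: "y t \<in> Y" "cinv u (y t) = C t"
    by (simp_all add: y_def inv_into_f_f[OF inj_u])
  show ?thesis
    using geodesic_first_form[OF inj_u open_Y smooth_hyper_metric[unfolded hyper_metric_def[abs_def]] assms(1,2,3,4) _ _ assms(5), of e]
      invertible_hyper_metric[OF yt(1)] hyper_metric_sym[OF yt(1)]
    by (simp add: hyper_metric_def[abs_def] yt(2)) (simp add: y_def)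
qed

text \<open>A test pair \<open>X\<close>, \<open>V\<close> is realized by a coordinate vector
  \<open>e\<close>, and the variation is \<open>y s + \<tau> e\<close> in hypersurface coordinates.
  On it the Euler-Lagrange expression vanishes at \<open>\<tau> = 0\<close>, and
  \<open>first_variation\<close> rewrites it in terms of the base.\<close>

lemma unit_cotangent_geodesic:
  assumes U: "open U" "connected U" and C: "C ` U \<subseteq> cdom u"
    and smooth_C: "smooth_on U (\<lambda>t. cmap u (C t))"
    and geodesic: "\<And>t. t \<in> U \<Longrightarrow> cov_deriv (induced_bs_metric A J g \<delta>) C (velocity C) u t = 0"
  defines "y \<equiv> \<lambda>t. cmap u (C t)"
  shows "unit_cotangent_geodesic (cmap b ` cdom b) (\<lambda>\<xi>. gb \<xi>) (\<lambda>\<xi>. Jb \<xi>) (christoffel_matrix g b) U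
    (\<lambda>t. xh (y t)) (\<lambda>t. uh (y t)) \<delta>
    (\<lambda>t. inn (xh (y t)) (cov (\<lambda>t. xh (y t)) 1 (\<lambda>t. uh (y t)) t) (Jb (xh (y t)) *v uh (y t)))"
proof -
  have y: "smooth_on U y" "\<And>t. t \<in> U \<Longrightarrow> y t \<in> Y"
    using smooth_C C by (auto simp: y_def)
  have smooth_xy: "smooth_on U (\<lambda>t. xh (y t))" and smooth_uy: "smooth_on U (\<lambda>t. uh (y t))"
    using smooth_on_compose[OF U(1) y(1) smooth_xh] smooth_on_compose[OF U(1) y(1) smooth_uh] y(2) by auto
  interpret c: map_into_chart "cmap b ` cdom b" gb Jb "christoffel_matrix g b" U "\<lambda>t. xh (y t)"
    by unfold_locales (use U smooth_xy x_in y(2) in auto)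
  show ?thesis
  proof
    show "connected U" "smooth_on U (\<lambda>t. uh (y t))" by fact+
    show "inn (xh (y t)) (uh (y t)) (uh (y t)) = 1" if "t \<in> U" for t
      by (rule uh_unit[OF y(2)[OF that]])
  next
    fix t V X assume "t \<in> U" and V: "inn (xh (y t)) V (uh (y t)) = 0"
    obtain e where e: "dird e (\<lambda>\<eta>. xh \<eta>) (y t) = X" "D e uh (y t) = V"
      by (rule parametrization_surjective[OF y(2)[OF \<open>t \<in> U\<close>] V])
    define \<phi> where "\<phi> z = y (fst z) + snd z *\<^sub>R e" for z :: "real \<times> real"
    \<comment> \<open>The shifted point must stay in the image of the chart; \<open>W\<close> is
      open and contains the whole unvaried curve \<open>\<tau> = 0\<close>.\<close>
    define W where "W = {z \<in> U \<times> UNIV. \<phi> z \<in> Y}"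
    have UU: "open (U \<times> (UNIV :: real set))" using U by (simp add: open_Times)
    have smooth_\<phi>': "smooth_on (U \<times> UNIV) \<phi>"
      unfolding \<phi>_def[abs_def]
      by (intro smooth_on_add smooth_on_scaleR smooth_on_const UU
          smooth_on_compose[OF UU smooth_on_bounded_linear[OF UU bounded_linear_fst smooth_on_ident] y(1)]
          smooth_on_bounded_linear[OF UU bounded_linear_snd smooth_on_ident]) auto
    have "open W"
      unfolding W_def using continuous_open_preimage[OF smooth_on_continuous[OF smooth_\<phi>'] UU open_Y]
      by (simp add: vimage_def Int_def)
    have smooth_\<phi>: "smooth_on W \<phi>"
      by (rule smooth_on_subset[OF smooth_\<phi>']) (auto simp: W_def)
    have W_in: "fst z \<in> U" "\<phi> z \<in> Y" if "z \<in> W" for z using that by (auto simp: W_def)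
    have in_W: "(s, 0) \<in> W" if "s \<in> U" for s using that y(2) by (simp add: W_def \<phi>_def)
    have \<phi>0 [simp]: "\<phi> (s, 0) = y s" for s by (simp add: \<phi>_def)
    interpret two: map_into_chart "cmap b ` cdom b" gb Jb "christoffel_matrix g b" W "\<lambda>z. xh (\<phi> z)"
    proof unfold_locales
      show "smooth_on W (\<lambda>z. xh (\<phi> z))"
        using smooth_on_compose[OF \<open>open W\<close> smooth_\<phi> smooth_xh] W_in(2) by blast
    qed (use \<open>open W\<close> x_in W_in in auto)
    let ?\<mu> = "\<lambda>z. uh (\<phi> z)"
    have \<mu>: "smooth_on W ?\<mu>"
      using smooth_on_compose[OF \<open>open W\<close> smooth_\<phi> smooth_uh] W_in(2) by blast
    have d\<phi>: "dird v \<phi> z = fst v *\<^sub>R dird 1 y (fst z) + snd v *\<^sub>R e" if "z \<in> W" for v z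
    proof -
      have "y differentiable at (fst z)"
        by (rule smooth_on_differentiable[OF y(1) W_in(1)[OF that]])
      note y' = has_derivative_compose[OF has_derivative_fst[OF has_derivative_ident] has_derivative_dird[OF this]]
        linear_scale[OF linear_dird[OF this], of _ 1]
      have "(\<phi> has_derivative (\<lambda>v. dird (fst v) y (fst z) + snd v *\<^sub>R e)) (at z)"
        unfolding \<phi>_def[abs_def]
        by (intro has_derivative_add has_derivative_scaleR_left has_derivative_snd has_derivative_ident y'(1))
      then show ?thesis
        using y'(2)[of "fst v"] by (simp add: dird_eqI)
    qed
    have along: "dird v (\<lambda>z. xh (\<phi> z)) z = dird (dird v \<phi> z) (\<lambda>\<eta>. xh \<eta>) (\<phi> z)"
      "two.D v ?\<mu> z = D (dird v \<phi> z) uh (\<phi> z)" if "z \<in> W" for v z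
    proof -
      have d: "\<phi> differentiable at z" "(\<lambda>\<eta>. xh \<eta>) differentiable at (\<phi> z)" "uh differentiable at (\<phi> z)"
        by (rule smooth_on_differentiable[OF smooth_\<phi> that] smooth_on_differentiable[OF smooth_xh W_in(2)[OF that]]
            smooth_on_differentiable[OF smooth_uh W_in(2)[OF that]])+
      show "dird v (\<lambda>z. xh (\<phi> z)) z = dird (dird v \<phi> z) (\<lambda>\<eta>. xh \<eta>) (\<phi> z)"
        by (rule dird_compose[OF d(1,2)])
      show "two.D v ?\<mu> z = D (dird v \<phi> z) uh (\<phi> z)"
        by (rule cov_pullback[OF d])
    qed
    have lag: "two.lagrangian \<delta> ?\<mu> v w z = dird v \<phi> z \<bullet> (hyper_metric (\<phi> z) *v dird w \<phi> z)" if "z \<in> W" for v w z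
      unfolding hyper_metric_lagrangian[OF W_in(2)[OF that]] two.lagrangian_def lagrangian_def along[OF that] ..
    \<comment> \<open>Derivatives in direction \<open>(1, 0)\<close> at \<open>\<tau> = 0\<close>
      see only the unvaried curve.\<close>
    have slice: "dird 1 (\<lambda>s. f (s, 0)) s = dird (1, 0) f (s, 0)"
      if "smooth_on W f" "s \<in> U" for f :: "real \<times> real \<Rightarrow> 'c::real_normed_vector" and s
    proof -
      have "((\<lambda>s::real. (s, 0::real)) has_derivative (\<lambda>s. (s, 0))) (at s)"
        by (intro has_derivative_Pair has_derivative_ident has_derivative_const)
      from has_derivative_compose[OF this has_derivative_dird[OF smooth_on_differentiable[OF that(1) in_W[OF that(2)]]]]
      show ?thesis by (rule dird_eqI)
    qed
    have slice_cov: "two.D (1, 0) V' (s, 0) = c.D 1 (\<lambda>s. V' (s, 0)) s" if "smooth_on W V'" "s \<in> U" for V' s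
      using slice[OF that] slice[OF two.smooth_x that(2)] by (simp add: cov_def)
    have "dird (1, 0) (two.lagrangian \<delta> ?\<mu> (1, 0) (0, 1)) (t, 0) =
        dird 1 (\<lambda>s. two.lagrangian \<delta> ?\<mu> (1, 0) (0, 1) (s, 0)) t"
      by (rule slice[OF two.smooth_lagrangian[OF \<mu>] \<open>t \<in> U\<close>, symmetric])
    also have "\<dots> = dird 1 (\<lambda>s. dird 1 y s \<bullet> (hyper_metric (y s) *v e)) t"
      by (rule dird_cong[OF U(1) \<open>t \<in> U\<close>]) (simp add: lag[OF in_W] d\<phi>[OF in_W])
    also have "\<dots> = (1 / 2) * (dird 1 y t \<bullet> (dird e hyper_metric (y t) *v dird 1 y t))"
      unfolding y_def by (rule geodesic_first_variation[OF U(1) C smooth_C \<open>t \<in> U\<close> geodesic[OF \<open>t \<in> U\<close>]])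
    also have "dird 1 y t \<bullet> (dird e hyper_metric (y t) *v dird 1 y t) =
        dird (0, 1) (two.lagrangian \<delta> ?\<mu> (1, 0) (1, 0)) (t, 0)"
    proof -
      let ?L = "two.lagrangian \<delta> ?\<mu> (1, 0) (1, 0)" and ?a = "dird 1 y t"
      define S where "S = {\<tau>::real. y t + \<tau> *\<^sub>R e \<in> Y}"
      have "open S"
        unfolding S_def
        using continuous_open_preimage[of UNIV "\<lambda>\<tau>::real. y t + \<tau> *\<^sub>R e" Y] open_Y
        by (simp add: vimage_def continuous_intros)
      have "0 \<in> S" using y(2)[OF \<open>t \<in> U\<close>] by (simp add: S_def)
      have "((\<lambda>\<tau>::real. (t, \<tau>)) has_derivative (\<lambda>\<tau>. (0, \<tau>))) (at 0)"
        by (intro has_derivative_Pair has_derivative_ident has_derivative_const)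
      from has_derivative_compose[OF this has_derivative_dird[OF smooth_on_differentiable[OF two.smooth_lagrangian[OF \<mu>] in_W[OF \<open>t \<in> U\<close>]]]]
      have "dird (0, 1) ?L (t, 0) = dird 1 (\<lambda>\<tau>. ?L (t, \<tau>)) 0" by (rule dird_eqI[symmetric])
      \<comment> \<open>For fixed time the velocity of the variation is \<open>?a\<close> for every
        \<open>\<tau>\<close>, because the variation is affine with constant \<open>e\<close>. Only
        the metric is differentiated.\<close>
      also have "\<dots> = dird 1 (\<lambda>\<tau>. ?a \<bullet> (hyper_metric (y t + \<tau> *\<^sub>R e) *v ?a)) 0"
      proof (rule dird_cong[OF \<open>open S\<close> \<open>0 \<in> S\<close>])
        fix \<tau> assume "\<tau> \<in> S"
        then have "(t, \<tau>) \<in> W" using \<open>t \<in> U\<close> by (simp add: S_def W_def \<phi>_def)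
        then show "?L (t, \<tau>) = ?a \<bullet> (hyper_metric (y t + \<tau> *\<^sub>R e) *v ?a)"
          by (simp add: lag d\<phi>) (simp add: \<phi>_def)
      qed
      also have "\<dots> = ?a \<bullet> (dird e hyper_metric (y t) *v ?a)"
      proof (rule dird_eqI[where f' = "\<lambda>r. ?a \<bullet> (dird (r *\<^sub>R e) hyper_metric (y t) *v ?a)", THEN trans])
        have "((\<lambda>\<tau>::real. y t + \<tau> *\<^sub>R e) has_derivative (\<lambda>\<tau>. \<tau> *\<^sub>R e)) (at 0)"
          by (auto intro!: derivative_eq_intros)
        moreover have "(hyper_metric has_derivative (\<lambda>v. dird v hyper_metric (y t))) (at (y t + 0 *\<^sub>R e))"
          using has_derivative_dird[OF smooth_on_differentiable[OF smooth_hyper_metric y(2)[OF \<open>t \<in> U\<close>]]] by simp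
        ultimately have "((\<lambda>\<tau>. hyper_metric (y t + \<tau> *\<^sub>R e)) has_derivative (\<lambda>r. dird (r *\<^sub>R e) hyper_metric (y t))) (at 0)"
          by (rule has_derivative_compose)
        then show "((\<lambda>\<tau>. ?a \<bullet> (hyper_metric (y t + \<tau> *\<^sub>R e) *v ?a)) has_derivative
            (\<lambda>r. ?a \<bullet> (dird (r *\<^sub>R e) hyper_metric (y t) *v ?a))) (at 0)"
          by (intro bounded_linear.has_derivative[OF bounded_linear_inner_right]
              bounded_linear.has_derivative[OF matvec.bounded_linear_left])
      qed simp
      finally show ?thesis ..
    qed
    finally have "dird (1, 0) (two.lagrangian \<delta> ?\<mu> (1, 0) (0, 1)) (t, 0)
        - (1 / 2) * dird (0, 1) (two.lagrangian \<delta> ?\<mu> (1, 0) (1, 0)) (t, 0) = 0"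
      by simp
    moreover have dx: "dird (1, 0) (\<lambda>z. xh (\<phi> z)) (s, 0) = dird 1 (\<lambda>t. xh (y t)) s" if "s \<in> U" for s
      using slice[OF two.smooth_x that] by simp
    moreover have du: "two.D (1, 0) ?\<mu> (s, 0) = c.D 1 (\<lambda>t. uh (y t)) s" if "s \<in> U" for s
      using slice_cov[OF \<mu> that] by simp
    moreover have "two.D (1, 0) (dird (1, 0) (\<lambda>z. xh (\<phi> z))) (t, 0) = c.D 1 (dird 1 (\<lambda>t. xh (y t))) t"
      using slice_cov[OF smooth_on_dird[OF two.smooth_x] \<open>t \<in> U\<close>] c.cov_cong[OF \<open>t \<in> U\<close> dx] by simp
    moreover have "two.D (1, 0) (two.D (1, 0) ?\<mu>) (t, 0) = c.D 1 (c.D 1 (\<lambda>t. uh (y t))) t"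
      using slice_cov[OF two.smooth_cov[OF \<mu>] \<open>t \<in> U\<close>] c.cov_cong[OF \<open>t \<in> U\<close> du] by simp
    moreover have "dird (0, 1) (\<lambda>z. xh (\<phi> z)) (t, 0) = X" "two.D (0, 1) ?\<mu> (t, 0) = V"
      using along[OF in_W[OF \<open>t \<in> U\<close>]] d\<phi>[OF in_W[OF \<open>t \<in> U\<close>], of "(0, 1)"] e by simp_all
    moreover have "dird (1, 0) (\<lambda>z. inn (xh (\<phi> z)) (two.D (1, 0) ?\<mu> z) (Jb (xh (\<phi> z)) *v ?\<mu> z)) (t, 0) =
        dird 1 (\<lambda>t. inn (xh (y t)) (c.D 1 (\<lambda>t. uh (y t)) t) (Jb (xh (y t)) *v uh (y t))) t"
    proof -
      have "smooth_on W (\<lambda>z. inn (xh (\<phi> z)) (two.D (1, 0) ?\<mu> z) (Jb (xh (\<phi> z)) *v ?\<mu> z))"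
        by (intro two.smooth_inn two.smooth_cov two.smooth_J_mult \<mu>)
      from slice[OF this \<open>t \<in> U\<close>] show ?thesis
        using dird_cong[OF U(1) \<open>t \<in> U\<close>, of "\<lambda>s. inn (xh (\<phi> (s, 0))) (two.D (1, 0) ?\<mu> (s, 0)) (Jb (xh (\<phi> (s, 0))) *v ?\<mu> (s, 0))"
            "\<lambda>s. inn (xh (y s)) (c.D 1 (\<lambda>t. uh (y t)) s) (Jb (xh (y s)) *v uh (y s))" 1] du
        by simp
    qed
    ultimately show "inn (xh (y t)) (c.D 1 (dird 1 (\<lambda>t. xh (y t))) t) X
      + inn (xh (y t)) (c.D 1 (c.D 1 (\<lambda>t. uh (y t))) t) V
      + inn (xh (y t)) (c.D 1 (\<lambda>t. uh (y t)) t) (Riem (xh (y t)) (dird 1 (\<lambda>t. xh (y t)) t) X *v uh (y t))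
      + \<delta>\<^sup>2 * (dird 1 (\<lambda>t. inn (xh (y t)) (c.D 1 (\<lambda>t. uh (y t)) t) (Jb (xh (y t)) *v uh (y t))) t
          * inn (xh (y t)) V (Jb (xh (y t)) *v uh (y t))
        + inn (xh (y t)) (c.D 1 (\<lambda>t. uh (y t)) t) (Jb (xh (y t)) *v uh (y t))
          * (inn (xh (y t)) (Riem (xh (y t)) (dird 1 (\<lambda>t. xh (y t)) t) X *v uh (y t)) (Jb (xh (y t)) *v uh (y t))
            + 2 * inn (xh (y t)) V (Jb (xh (y t)) *v c.D 1 (\<lambda>t. uh (y t)) t))) = 0"
      using two.first_variation[OF \<mu> in_W[OF \<open>t \<in> U\<close>], where \<delta> = \<delta> and v = "(1, 0)" and w = "(0, 1)"] \<open>t \<in> U\<close> by simp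
  qed (rule refl)
qed

section \<open>Comparison with the Frenet apparatus on the manifold\<close>

lemma conn_christoffel:
  assumes "x \<in> cdom b"
  shows "conn (cmap b x) X *v Z = (\<chi> h. \<Sum>i\<in>UNIV. \<Sum>j\<in>UNIV. christoffel g b x h i j * X $ i * Z $ j)"
proof -
  have "(\<Sum>j\<in>UNIV. \<Sum>i\<in>UNIV. christoffel g b x h i j * X $ i * Z $ j) =
      (\<Sum>i\<in>UNIV. \<Sum>j\<in>UNIV. christoffel g b x h i j * X $ i * Z $ j)" for h
    by (rule sum.swap)
  then show ?thesis
    using inv_into_f_f[OF inj_b assms]
    by (simp add: vec_eq_iff conn_def christoffel_matrix_def matrix_vector_mult_def sum_distrib_left
        sum_distrib_right mult_ac)
qed

end

text \<open>Smoothness of a curve is granted in some chart around each point; a transition map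
  carries it to the prescribed chart \<open>b\<close>.\<close>

lemma smooth_curve_in_chart_differentiable:
  assumes A: "smooth_manifold A" and "b \<in> A"
    and \<beta>: "smooth_curve A K \<beta>" and "s \<in> K"
    and U: "open U" "s \<in> U" "\<beta> ` U \<subseteq> cdom b"
  shows "(\<lambda>s. cmap b (\<beta> s)) differentiable at s"
proof -
  obtain b' U' where b': "b' \<in> A" "open U'" "s \<in> U'" "\<beta> ` U' \<subseteq> cdom b'" "smooth_on U' (\<lambda>s. cmap b' (\<beta> s))"
    using \<beta> \<open>s \<in> K\<close> unfolding smooth_curve_def o_def by blast
  have inj: "inj_on (cmap b') (cdom b')"
    and trans: "smooth_on (cmap b' ` (cdom b' \<inter> cdom b)) (\<lambda>\<eta>. cmap b (cinv b' \<eta>))"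
    using A \<open>b \<in> A\<close> \<open>b' \<in> A\<close> unfolding smooth_manifold_def o_def by blast+
  have "smooth_on (U \<inter> U') (\<lambda>s. cmap b (cinv b' (cmap b' (\<beta> s))))"
    using U b' by (intro smooth_on_compose[OF _ _ trans] smooth_on_subset[OF b'(5)]) auto
  then have "smooth_on (U \<inter> U') (\<lambda>s. cmap b (\<beta> s))"
  proof (rule smooth_on_cong[rotated])
    fix r assume "r \<in> U \<inter> U'"
    then have "\<beta> r \<in> cdom b'" using b' by blast
    then show "cmap b (cinv b' (cmap b' (\<beta> r))) = cmap b (\<beta> r)" by (simp add: inj)
  qed (use U b' in auto)
  then show ?thesis
    by (rule smooth_on_differentiable) (use U b' in auto)
qed

theorem theorem5p12:
  fixes A :: "('a, 'n::finite) chart set"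
    and J g :: "('a, 'n) chart \<Rightarrow> 'a \<Rightarrow> real ^ 'n ^ 'n"
    and \<delta> :: real
    and m :: nat
    and I K :: "real set"
    and C :: "real \<Rightarrow> ('a, 'n) cotangent_point"
    and \<beta> :: "real \<Rightarrow> 'a"
    and r :: nat
    and \<nu> :: "nat \<Rightarrow> ('a, 'n) chart \<Rightarrow> real \<Rightarrow> real ^ 'n"
    and \<kappa> :: "nat \<Rightarrow> real \<Rightarrow> real"
  assumes "CARD('n) = 2 * m"
    and "standard_kaehler A J g"
    and "locally_symmetric A g"
    and "open I" and "is_interval I" and "I \<noteq> {}"
    and "geodesic (unit_cotangent_atlas A g) (induced_bs_metric A J g \<delta>) I C"
    and "unit_speed (unit_cotangent_atlas A g) (induced_bs_metric A J g \<delta>) I C"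
    and "arc_length_parametrization A g I (fst \<circ> C) K \<beta>"
    and "frenet_apparatus A g K \<beta> r \<nu> \<kappa>"
  shows "\<forall>i\<in>{1..r}. \<kappa> i constant_on K"
proof -
  obtain s :: "real \<Rightarrow> real" where smooth_s: "smooth_on I s" and s_pos: "\<And>t. t \<in> I \<Longrightarrow> deriv s t > 0"
    and s_image: "s ` I = K" and C_\<beta>: "\<And>t. t \<in> I \<Longrightarrow> fst (C t) = \<beta> (s t)"
    and \<beta>: "smooth_curve A K \<beta>"
    using assms(9) unfolding arc_length_parametrization_def o_def by blast
  have "1 \<le> r" and fields: "\<And>i. 1 \<le> i \<Longrightarrow> i \<le> r \<Longrightarrow> vector_field_along A K \<beta> (\<nu> i)"
    and \<kappa>_pos: "\<And>i \<sigma>. \<sigma> \<in> K \<Longrightarrow> 1 \<le> i \<Longrightarrow> i < r \<Longrightarrow> \<kappa> i \<sigma> > 0" and \<kappa>_nonneg: "\<And>\<sigma>. \<sigma> \<in> K \<Longrightarrow> \<kappa> r \<sigma> \<ge> 0"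
    using assms(10) by (auto simp: frenet_apparatus_def)
  have frame: "\<nu> 1 b \<sigma> = velocity \<beta> b \<sigma>"
      "1 \<le> i \<Longrightarrow> i \<le> (if \<kappa> r \<sigma> = 0 then r else r + 1) \<Longrightarrow> inner_of g b (\<beta> \<sigma>) (\<nu> i b \<sigma>) (\<nu> i b \<sigma>) = 1"
      "cov_deriv g \<beta> (\<nu> 1) b \<sigma> = \<kappa> 1 \<sigma> *\<^sub>R \<nu> 2 b \<sigma>"
      "2 \<le> i \<Longrightarrow> i \<le> r \<Longrightarrow> cov_deriv g \<beta> (\<nu> i) b \<sigma> = - \<kappa> (i - 1) \<sigma> *\<^sub>R \<nu> (i - 1) b \<sigma> + \<kappa> i \<sigma> *\<^sub>R \<nu> (i + 1) b \<sigma>"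
    if "\<sigma> \<in> K" "b \<in> A" "\<beta> \<sigma> \<in> cdom b" for \<sigma> b i
    using assms(10) that unfolding frenet_apparatus_def by (metis atLeastAtMost_iff)+
  \<comment> \<open>Hypersurface charts cover the curve only piecewise, so constancy is shown near
    each \<open>t0\<close> and spread afterwards over the connected set \<open>I\<close>.\<close>
  have local_constant: "\<exists>W. open W \<and> t0 \<in> W \<and> (\<forall>i\<in>{1..r}. (\<lambda>t. \<kappa> i (s t)) constant_on W)" if "t0 \<in> I" for t0
  proof -
    obtain u U where u: "u \<in> unit_cotangent_atlas A g" "open U" "t0 \<in> U" "U \<subseteq> I" "C ` U \<subseteq> cdom u"
        "smooth_on U (\<lambda>t. cmap u (C t))"
      using assms(7) \<open>t0 \<in> I\<close> unfolding geodesic_def smooth_curve_def o_def by blast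
    \<comment> \<open>A ball, so that the parameter domain is connected.\<close>
    obtain \<epsilon> where "\<epsilon> > 0" "ball t0 \<epsilon> \<subseteq> U"
      using u(2,3) open_contains_ball by blast
    define W where "W = ball t0 \<epsilon>"
    have W: "open W" "connected W" "t0 \<in> W" "W \<subseteq> I" "C ` W \<subseteq> cdom u"
      using \<open>\<epsilon> > 0\<close> \<open>ball t0 \<epsilon> \<subseteq> U\<close> u by (auto simp: W_def)
    have smooth_C: "smooth_on W (\<lambda>t. cmap u (C t))"
      using \<open>ball t0 \<epsilon> \<subseteq> U\<close> by (intro smooth_on_subset[OF u(6)]) (simp add: W_def)
    have geodesic: "cov_deriv (induced_bs_metric A J g \<delta>) C (velocity C) u t = 0" if "t \<in> W" for t
      using assms(7) u(1) that W unfolding geodesic_def by blast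
    define b where "b = (SOME b. unit_cotangent_chart A g b u)"
    have "unit_cotangent_chart A g b u"
      using u(1) unfolding b_def unit_cotangent_atlas_def by (auto intro: someI_ex)
    then interpret unit_cotangent_coordinates A J g \<delta> u b
      by unfold_locales (use assms b_def in auto)
    interpret geo: unit_cotangent_geodesic "cmap b ` cdom b" "\<lambda>\<xi>. g b (cinv b \<xi>)" "\<lambda>\<xi>. J b (cinv b \<xi>)"
      "christoffel_matrix g b" W "\<lambda>t. xh (cmap u (C t))" "\<lambda>t. uh (cmap u (C t))" \<delta>
      "\<lambda>t. inn (xh (cmap u (C t))) (cov (\<lambda>t. xh (cmap u (C t))) 1 (\<lambda>t. uh (cmap u (C t))) t)
        (Jb (xh (cmap u (C t))) *v uh (cmap u (C t)))"
      by (rule unit_cotangent_geodesic[OF W(1,2,5) smooth_C geodesic])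
    let ?x = "\<lambda>t. xh (cmap u (C t))"
    have in_K: "s t \<in> K" if "t \<in> W" for t using that W(4) s_image by blast
    have x_eq: "?x t = cmap b (\<beta> (s t))" and \<beta>_in: "\<beta> (s t) \<in> cdom b" if "t \<in> W" for t
    proof -
      have "C t \<in> cdom u" using that W(5) by blast
      then show "?x t = cmap b (\<beta> (s t))" "\<beta> (s t) \<in> cdom b"
        using cdom_u(1)[of "C t"] C_\<beta>[of t] that W(4) inv_into_f_f[OF inj_u] by auto
    qed
    have inn_eq: "inn (?x t) X Z = inner_of g b (\<beta> (s t)) X Z" if "t \<in> W" for t X Z
      using inv_into_f_f[OF inj_b \<beta>_in[OF that]] by (simp add: x_eq[OF that] inn_def inner_of_def)
    have ds: "(s has_derivative (\<lambda>h. h * deriv s t)) (at t)" if "t \<in> W" for t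
    proof -
      have "s differentiable at t"
        using that W(4) by (intro smooth_on_differentiable[OF smooth_s]) auto
      then have "(s has_real_derivative deriv s t) (at t)"
        by (simp add: DERIV_deriv_iff_real_differentiable)
      then show ?thesis by (simp add: has_field_derivative_def mult.commute[of _ "deriv s t"])
    qed
    have chain: "dird 1 (\<lambda>t. f (s t)) t = deriv s t *\<^sub>R dird 1 f (s t)"
      if "t \<in> W" "f differentiable at (s t)" for f :: "real \<Rightarrow> real ^ 'n" and t
      using dird_eqI[OF has_derivative_compose[OF ds[OF that(1)] has_derivative_dird[OF that(2)]], of 1]
        linear_scale[OF linear_dird[OF that(2)], of "deriv s t" 1] by simp
    have nbhd: "\<exists>V. open V \<and> s t \<in> V \<and> V \<subseteq> K \<and> \<beta> ` V \<subseteq> cdom b \<and> smooth_on V (\<nu> i b)"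
      if "t \<in> W" "1 \<le> i" "i \<le> r" for t i
      using fields[OF that(2,3)] in_K[OF that(1)] b_in \<beta>_in[OF that(1)] unfolding vector_field_along_def by blast
    have d\<nu>: "\<nu> i b differentiable at (s t)" if "t \<in> W" "1 \<le> i" "i \<le> r" for t i
      using nbhd[OF that] smooth_on_differentiable by blast
    have d\<beta>: "(\<lambda>\<sigma>. cmap b (\<beta> \<sigma>)) differentiable at (s t)" if "t \<in> W" for t
    proof -
      have "smooth_manifold A" using assms(2) by (simp add: standard_kaehler_def)
      then show ?thesis
        using nbhd[OF that order_refl \<open>1 \<le> r\<close>]
          smooth_curve_in_chart_differentiable[OF _ b_in \<beta> in_K[OF that]] by blast
    qed
    have vel: "velocity \<beta> b (s t) = dird 1 (\<lambda>\<sigma>. cmap b (\<beta> \<sigma>)) (s t)" if "t \<in> W" for t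
      unfolding velocity_def by (rule vector_derivative_dird[OF open_UNIV UNIV_I d\<beta>[OF that]]) simp
    have dx: "dird 1 ?x t = deriv s t *\<^sub>R \<nu> 1 b (s t)" if "t \<in> W" for t
    proof -
      have "dird 1 ?x t = dird 1 (\<lambda>t. cmap b (\<beta> (s t))) t"
        by (rule dird_cong[OF W(1) that x_eq])
      then show ?thesis
        using chain[OF that d\<beta>[OF that]] vel[OF that] frame(1)[OF in_K[OF that] b_in \<beta>_in[OF that]] by simp
    qed
    \<comment> \<open>The velocity of the projected curve is dragged, so its length, which is
      \<open>deriv s t\<close>, is constant.\<close>
    obtain c where c: "\<And>t. t \<in> W \<Longrightarrow> (deriv s t)\<^sup>2 = c"
    proof -
      obtain c where c: "\<And>t. t \<in> W \<Longrightarrow> inn (?x t) (dird 1 ?x t) (dird 1 ?x t) = c"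
        using geo.dragged_norm_constant[OF geo.dragged_velocity] by (auto simp: constant_on_def)
      have "(deriv s t)\<^sup>2 = c" if "t \<in> W" for t
        using c[OF that] frame(2)[OF in_K[OF that] b_in \<beta>_in[OF that], of 1] \<open>1 \<le> r\<close>
        by (simp add: dx[OF that] inn_eq[OF that, symmetric] power2_eq_square)
      then show ?thesis by (rule that)
    qed
    define v where "v = deriv s t0"
    have "v > 0" using s_pos[OF \<open>t0 \<in> I\<close>] by (simp add: v_def)
    have v: "deriv s t = v" if "t \<in> W" for t
    proof (rule power2_eq_imp_eq)
      show "(deriv s t)\<^sup>2 = v\<^sup>2" using c[OF that] c[OF W(3)] by (simp add: v_def)
      show "0 \<le> deriv s t" "0 \<le> v" using s_pos[of t] that W(4) \<open>v > 0\<close> by auto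
    qed
    define N where "N i t = \<nu> i b (s t)" for i t
    \<comment> \<open>Differentiation with respect to \<open>t\<close> is \<open>v\<close> times
      that with respect to arc length, so the Frenet formulas keep their form with every curvature
      multiplied by \<open>v\<close>.\<close>
    define k where "k i t = v * \<kappa> i (s t)" for i t
    have DN: "geo.D 1 (N i) t = v *\<^sub>R cov_deriv g \<beta> (\<nu> i) b (s t)" if "t \<in> W" "1 \<le> i" "i \<le> r" for t i
    proof -
      have "dird 1 (N i) t = v *\<^sub>R vector_derivative (\<nu> i b) (at (s t))"
        unfolding N_def using chain[OF that(1) d\<nu>[OF that]] v[OF that(1)]
          vector_derivative_dird[OF open_UNIV UNIV_I d\<nu>[OF that], of "\<nu> i b"] by simp
      moreover have "conn (?x t) (dird 1 ?x t) *v N i t =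
          v *\<^sub>R (conn (cmap b (\<beta> (s t))) (velocity \<beta> b (s t)) *v \<nu> i b (s t))"
        using conn_commute[OF geo.x_in[OF that(1)]] x_eq[OF that(1)]
        by (simp add: dx[OF that(1)] v[OF that(1)] N_def matvec.scaleR_right
            frame(1)[OF in_K[OF that(1)] b_in \<beta>_in[OF that(1)], symmetric])
      ultimately show ?thesis
        by (simp add: cov_def cov_deriv_def conn_christoffel[OF \<beta>_in[OF that(1)]] scaleR_add_right)
    qed
    have "(\<lambda>t. \<kappa> i (s t)) constant_on W" if "i \<in> {1..r}" for i
    proof -
      have "geo.dragged (N i) \<and> k i constant_on W"
      proof (rule geo.frenet_curvatures_constant[where c = "1 / v" and r = r])
        fix t assume t: "t \<in> W"
        note fr = frame[OF in_K[OF t] b_in \<beta>_in[OF t]]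
        show "N 1 t = (1 / v) *\<^sub>R dird 1 ?x t"
          using \<open>v > 0\<close> by (simp add: dx[OF t] v[OF t] N_def)
        show "0 < k j t" if "1 \<le> j" "j < r" for j
          using \<kappa>_pos[OF in_K[OF t] that] \<open>v > 0\<close> by (simp add: k_def)
        show "0 \<le> k r t" using \<kappa>_nonneg[OF in_K[OF t]] \<open>v > 0\<close> by (simp add: k_def)
        show "inn (?x t) (N j t) (N j t) = 1" if "1 \<le> j" "j \<le> r" for j
          using fr(2)[of j] that by (simp add: N_def inn_eq[OF t])
        show "inn (?x t) (N (Suc r) t) (N (Suc r) t) = 1" if "k r t \<noteq> 0"
          using fr(2)[of "Suc r"] that by (simp add: N_def k_def inn_eq[OF t])
        show "geo.D 1 (N 1) t = k 1 t *\<^sub>R N 2 t"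
          using DN[OF t order_refl \<open>1 \<le> r\<close>] fr(3) by (simp add: N_def k_def)
        show "geo.D 1 (N j) t = - k (j - 1) t *\<^sub>R N (j - 1) t + k j t *\<^sub>R N (Suc j) t" if "2 \<le> j" "j \<le> r" for j
          using DN[OF t _ that(2)] fr(4)[OF that] that(1) by (simp add: N_def k_def scaleR_add_right scaleR_diff_right)
      qed (use that in auto)
      then show ?thesis
        using \<open>v > 0\<close> by (auto simp: constant_on_def k_def) (metis mult_cancel_left less_irrefl)
    qed
    with W show ?thesis by blast
  qed
  show ?thesis
  proof
    fix i assume i: "i \<in> {1..r}"
    have "\<kappa> i (s t) = \<kappa> i (s t')" if "t \<in> I" "t' \<in> I" for t t'
    proof (rule connected_local_const[OF is_interval_connected[OF assms(5)] that(1,2)])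
      show "\<forall>a\<in>I. eventually (\<lambda>b. \<kappa> i (s a) = \<kappa> i (s b)) (at a within I)"
      proof
        fix a assume "a \<in> I"
        then obtain W where "open W" "a \<in> W" "(\<lambda>t. \<kappa> i (s t)) constant_on W"
          using local_constant i by blast
        then show "eventually (\<lambda>b. \<kappa> i (s a) = \<kappa> i (s b)) (at a within I)"
          unfolding eventually_at_topological constant_on_def by metis
      qed
    qed
    then show "\<kappa> i constant_on K"
      unfolding s_image[symmetric] constant_on_def by (metis imageE)
  qed
qed

end
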